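(* There exists an algorithm that, given a graph $G$ and a linear arrangement of $G$ of cutwidth $\mathrm{ctw}$ (together with the integer $k$ of the problem instance), solves the Connected Vertex Cover problem in time $\mathcal{O}^*(2^{\mathrm{ctw}})$. The algorithm cannot give false positives and may give false negatives with probability at most $1/2$.
   Context: Graphs are finite, simple, loopless and undirected. A linear arrangement of $G=(V,E)$ with $n=|V|$ is a bijection $\ell\colon \{1,\dots,n\}\to V$; write $v_i=\ell(i)$. The $i$th cut is $E_i=\{\{v_j,v_k\}\in E : j\le i<k\}$, and the cutwidth of $\ell$ is $\max_{i}|E_i|$. $\mathcal{O}^*$ hides factors polynomial in the input size. The algorithm is randomized (Monte Carlo). A vertex cover of a graph is a set of vertices such that every edge is incident to some vertex in the set. Connected Vertex Cover: given a graph $G=(V,E)$ and an integer $k$, decide whether there is a vertex cover $S\subseteq V$ of $G$ of cardinality at most $k$ such that $G[S]$ is connected. *)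

theory Defs
  imports
    "HOL-Probability.Probability"
    "HOL-Computational_Algebra.Polynomial"
    "HOL-Library.Log_Nat"
begin

section \<open>Graphs, linear arrangements, Connected Vertex Cover\<close>

definition simple_graph :: "'a set \<Rightarrow> 'a set set \<Rightarrow> bool" where
  "simple_graph V E \<longleftrightarrow>
     finite V \<and> (\<forall>e\<in>E. \<exists>u\<in>V. \<exists>v\<in>V. u \<noteq> v \<and> e = {u, v})"

text \<open>Positions are numbered from 1, so the values of \<open>l\<close> outside \<open>{1..card V}\<close> are irrelevant.\<close>

definition linear_arrangement :: "'a set \<Rightarrow> (nat \<Rightarrow> 'a) \<Rightarrow> bool" where
  "linear_arrangement V l \<longleftrightarrow> bij_betw l {1..card V} V"

definition cut :: "'a set \<Rightarrow> 'a set set \<Rightarrow> (nat \<Rightarrow> 'a) \<Rightarrow> nat \<Rightarrow> 'a set set" where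
  "cut V E l i = {e \<in> E. \<exists>j\<in>{1..card V}. \<exists>k\<in>{1..card V}. e = {l j, l k} \<and> j \<le> i \<and> i < k}"

text \<open>The cut at 0 is always empty; including it only makes the maximum well defined (namely 0)
  for the graph without vertices.\<close>

definition cutwidth :: "'a set \<Rightarrow> 'a set set \<Rightarrow> (nat \<Rightarrow> 'a) \<Rightarrow> nat" where
  "cutwidth V E l = Max ((\<lambda>i. card (cut V E l i)) ` {0..card V})"

definition vertex_cover :: "'a set \<Rightarrow> 'a set set \<Rightarrow> 'a set \<Rightarrow> bool" where
  "vertex_cover V E S \<longleftrightarrow> S \<subseteq> V \<and> (\<forall>e\<in>E. e \<inter> S \<noteq> {})"

text \<open>Connectedness of the induced subgraph: any two vertices of \<open>S\<close> are joined by a path inside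
  \<open>S\<close>. The empty subgraph counts as connected.\<close>

definition induced_connected :: "'a set set \<Rightarrow> 'a set \<Rightarrow> bool" where
  "induced_connected E S \<longleftrightarrow>
     (\<forall>u\<in>S. \<forall>v\<in>S. (u, v) \<in> {(x, y). x \<in> S \<and> y \<in> S \<and> {x, y} \<in> E}\<^sup>*)"

definition connected_vertex_cover :: "'a set \<Rightarrow> 'a set set \<Rightarrow> int \<Rightarrow> bool" where
  "connected_vertex_cover V E k \<longleftrightarrow>
     (\<exists>S. vertex_cover V E S \<and> int (card S) \<le> k \<and> induced_connected E S)"


section \<open>Randomized random access machines with logarithmic cost\<close>

text \<open>
  Algorithms are structured programs over a memory of natural numbers with indirect addressing
  and a coin-flipping instruction. Every operation is charged according to the binary length of
  the numbers and addresses it handles (schoolbook cost for multiplication and division), so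
  large numbers cannot be used to pack many operations into one.
\<close>

type_synonym mem = "nat \<Rightarrow> nat"

definition bits :: "nat \<Rightarrow> nat" where
  "bits x = Suc (floorlog 2 x)"

datatype expr =
    Const nat
  | Load expr
  | Add expr expr
  | Sub expr expr
  | Mul expr expr
  | Div expr expr

primrec val :: "expr \<Rightarrow> mem \<Rightarrow> nat" where
  "val (Const c) m = c"
| "val (Load e) m = m (val e m)"
| "val (Add e f) m = val e m + val f m"
| "val (Sub e f) m = val e m - val f m"
| "val (Mul e f) m = val e m * val f m"
| "val (Div e f) m = val e m div val f m"

primrec cost :: "expr \<Rightarrow> mem \<Rightarrow> nat" where
  "cost (Const c) m = bits c"
| "cost (Load e) m = cost e m + bits (val e m) + bits (m (val e m))"
| "cost (Add e f) m = cost e m + cost f m + bits (val e m) + bits (val f m)"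
| "cost (Sub e f) m = cost e m + cost f m + bits (val e m) + bits (val f m)"
| "cost (Mul e f) m = cost e m + cost f m + bits (val e m) * bits (val f m)"
| "cost (Div e f) m = cost e m + cost f m + bits (val e m) * bits (val f m)"

text \<open>In \<open>Store a e\<close> and \<open>Flip a\<close>, the expression \<open>a\<close> gives the address of the cell that is
  written; in \<open>Cond\<close> and \<open>While\<close>, a nonzero value means true.\<close>

datatype prog =
    Skip
  | Store expr expr
  | Flip expr
  | Seq prog prog
  | Cond expr prog prog
  | While expr prog

text \<open>\<open>exec c (m, w) t (m', w')\<close>: started in memory \<open>m\<close> with the stream \<open>w\<close> of future coin
  flips, \<open>c\<close> halts after time \<open>t\<close> in memory \<open>m'\<close>, with \<open>w'\<close> the unused coin flips.\<close>

inductive exec :: "prog \<Rightarrow> mem \<times> bool stream \<Rightarrow> nat \<Rightarrow> mem \<times> bool stream \<Rightarrow> bool" where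
  Skip: "exec Skip s 1 s"
| Store: "exec (Store a e) (m, w)
     (cost a m + cost e m + bits (val a m) + bits (val e m)) (m(val a m := val e m), w)"
| Flip: "exec (Flip a) (m, w)
     (cost a m + bits (val a m) + 1) (m(val a m := of_bool (shd w)), stl w)"
| Seq: "exec c s t s' \<Longrightarrow> exec d s' t' s'' \<Longrightarrow> exec (Seq c d) s (t + t') s''"
| Cond_True: "val e m \<noteq> 0 \<Longrightarrow> exec c (m, w) t s' \<Longrightarrow>
     exec (Cond e c d) (m, w) (cost e m + bits (val e m) + t) s'"
| Cond_False: "val e m = 0 \<Longrightarrow> exec d (m, w) t s' \<Longrightarrow>
     exec (Cond e c d) (m, w) (cost e m + bits (val e m) + t) s'"
| While_True: "val e m \<noteq> 0 \<Longrightarrow> exec c (m, w) t s' \<Longrightarrow> exec (While e c) s' t' s'' \<Longrightarrow>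
     exec (While e c) (m, w) (cost e m + bits (val e m) + t + t') s''"
| While_False: "val e m = 0 \<Longrightarrow> exec (While e c) (m, w) (cost e m + bits (val e m)) (m, w)"

inductive_cases exec_SkipE: "exec Skip s t s'"
  and exec_StoreE: "exec (Store a e) s t s'"
  and exec_FlipE: "exec (Flip a) s t s'"
  and exec_SeqE: "exec (Seq c d) s t s'"
  and exec_CondE: "exec (Cond e c d) s t s'"
  and exec_WhileE: "exec (While e c) s t s'"

lemma exec_deterministic:
  "exec c s t s' \<Longrightarrow> exec c s u s'' \<Longrightarrow> u = t \<and> s'' = s'"
proof (induction arbitrary: u s'' rule: exec.induct)
  case (Seq c s t s' d t' s2)
  from Seq.prems obtain t1 s1 t2 where x: "exec c s t1 s1" "exec d s1 t2 s''" "u = t1 + t2"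
    by (rule exec_SeqE)
  from Seq.IH(1)[OF x(1)] Seq.IH(2)[of t2 s''] x show ?case by simp
next
  case (While_True e m c w t s' t' s2)
  from While_True.prems While_True.hyps obtain t1 s1 t2 where
    x: "exec c (m, w) t1 s1" "exec (While e c) s1 t2 s''"
       "u = cost e m + bits (val e m) + t1 + t2"
    by (auto elim: exec_WhileE)
  from While_True.IH(1)[OF x(1)] While_True.IH(2)[of t2 s''] x show ?case by simp
next
  case (Cond_True e m c w t s' d)
  from Cond_True.prems Cond_True.hyps obtain t1 where
    x: "exec c (m, w) t1 s''" "u = cost e m + bits (val e m) + t1"
    by (auto elim: exec_CondE)
  from Cond_True.IH[OF x(1)] x show ?case by simp
next
  case (Cond_False e m d w t s' c)
  from Cond_False.prems Cond_False.hyps obtain t1 where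
    x: "exec d (m, w) t1 s''" "u = cost e m + bits (val e m) + t1"
    by (auto elim: exec_CondE)
  from Cond_False.IH[OF x(1)] x show ?case by simp
qed (auto elim: exec_SkipE exec_StoreE exec_FlipE exec_WhileE)

definition coin_flips :: "bool stream measure" where
  "coin_flips = stream_space (measure_pmf (bernoulli_pmf (1/2)))"

text \<open>The input occupies the first cells, all other cells are initially 0. The answer is read off
  cell 0 on termination: 0 is No, everything else is Yes.\<close>

definition initial_mem :: "nat list \<Rightarrow> mem" where
  "initial_mem xs a = (if a < length xs then xs ! a else 0)"

definition answers :: "prog \<Rightarrow> nat list \<Rightarrow> bool stream \<Rightarrow> nat \<Rightarrow> bool \<Rightarrow> bool" where
  "answers c xs w t b \<longleftrightarrow>
     (\<exists>m w'. exec c (initial_mem xs, w) t (m, w') \<and> b = (m 0 \<noteq> 0))"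

definition input_size :: "nat list \<Rightarrow> nat" where
  "input_size xs = sum_list (map bits xs)"

text \<open>An instance is given by sign and absolute value of \<open>k\<close>, the numbers of vertices and edges,
  the vertices in the order of the arrangement, and the edges, each exactly once, in an arbitrary
  order and with their endpoints in an arbitrary order. Vertices are arbitrary natural numbers.\<close>

definition encodes ::
  "nat set \<Rightarrow> nat set set \<Rightarrow> (nat \<Rightarrow> nat) \<Rightarrow> int \<Rightarrow> nat list \<Rightarrow> bool" where
  "encodes V E l k xs \<longleftrightarrow>
     (\<exists>es. distinct (map (\<lambda>(u, v). {u, v}) es) \<and> set (map (\<lambda>(u, v). {u, v}) es) = E \<and>
       xs = [of_bool (k < 0), nat \<bar>k\<bar>, card V, card E] @ map l [1..<Suc (card V)] @
            concat (map (\<lambda>(u, v). [u, v]) es))"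

end

theory Submission
  imports Defs "HOL-Library.Nat_Bijection"
begin

text \<open>
  Label every edge 0 or 1 and let a vertex of \<open>S\<close> choose a label that all its edges carry. For
  fixed \<open>S\<close> the number of such choices is \<open>2\<close> to the number of edges not covered by \<open>S\<close>, times
  the number of unions of components of \<open>G[S]\<close>; for nonempty \<open>S\<close> it is \<open>2\<close> modulo \<open>4\<close> if \<open>S\<close> is
  a connected vertex cover and \<open>0\<close> modulo \<open>4\<close> otherwise. Counting modulo \<open>4\<close> makes it unnecessary
  to guess a vertex of \<open>S\<close>, and as only edges carry labels, a dynamic program along the arrangement
  has one state for each of the at most \<open>2 ^ ctw\<close> labellings of a cut. The choices are counted with a
  weight \<open>q ^ W v\<close> for each \<open>v \<in> S\<close>, where \<open>q\<close> is a power of two exceeding all counts, so that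
  the base \<open>q\<close> digits of one natural number separate the sets by weight. The weights are random, but
  dominated by the cardinality: by the isolation lemma the connected vertex cover of least weight is
  unique with probability at least \<open>1/2\<close>, and then its digit is \<open>2\<close> modulo \<open>4\<close>.
\<close>

section \<open>Running times in terms of step counts\<close>

text \<open>Two states per edge are enough because failures cancel instead of being recorded: an
  uncovered edge leaves its label free, and a second component of \<open>G[S]\<close> chooses its
  label independently of the first. Either failure adds a factor 2 to the one that every nonempty
  \<open>S\<close> has from exchanging the two labels. Comparing the labellings of two consecutive
  cuts directly could still cost \<open>4 ^ ctw\<close>; going through the labellings of those edges
  that the next vertex does not touch avoids this. With the cardinality as the leading part of a
  weight, the bound \<open>k\<close> becomes a bound on the weights to be inspected. Packing all
  weights into one number is compatible with logarithmic cost: the block of flips for a vertex has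
  logarithmic length, so weights are quadratic in \<open>n\<close> and every number has polynomially
  many bits. Running time can therefore be handled as a number of steps times a polynomial in one
  fixed word length.\<close>

primrec weight :: "expr \<Rightarrow> nat" where
  "weight (Const c) = Suc c"
| "weight (Load e) = Suc (weight e)"
| "weight (Add e f) = weight e + weight f"
| "weight (Sub e f) = weight e + weight f"
| "weight (Mul e f) = weight e + weight f"
| "weight (Div e f) = weight e + weight f"

text \<open>For cells of at most \<open>b\<close> bits, \<open>weight\<close> bounds the length of a
  value in units of \<open>b\<close>, and \<open>expr_factor\<close> the cost of evaluation in units
  of \<open>b\<close> squared, the order of one schoolbook multiplication. A constant
  \<open>c\<close> is generously given weight \<open>Suc c\<close>, as the program text is
  fixed.\<close>

primrec expr_factor :: "expr \<Rightarrow> nat" where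
  "expr_factor (Const c) = bits c"
| "expr_factor (Load e) = expr_factor e + 2 * weight e + 2"
| "expr_factor (Add e f) = expr_factor e + expr_factor f + 2 * weight e + 2 * weight f"
| "expr_factor (Sub e f) = expr_factor e + expr_factor f + 2 * weight e + 2 * weight f"
| "expr_factor (Mul e f) = expr_factor e + expr_factor f + 4 * (weight e * weight f)"
| "expr_factor (Div e f) = expr_factor e + expr_factor f + 4 * (weight e * weight f)"

text \<open>In units of \<open>b\<close> squared, this pays for one pass through the program text;
  the repetitions of loops are left to the step count \<open>N\<close> in \<open>wp\<close>.\<close>

primrec prog_factor :: "prog \<Rightarrow> nat" where
  "prog_factor Skip = 1"
| "prog_factor (Store a e) = expr_factor a + expr_factor e + 2 * weight a + 2 * weight e"
| "prog_factor (Flip a) = expr_factor a + 2 * weight a + 1"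
| "prog_factor (Seq c d) = prog_factor c + prog_factor d"
| "prog_factor (Cond e c d) = expr_factor e + 2 * weight e + prog_factor c + prog_factor d"
| "prog_factor (While e c) = expr_factor e + 2 * weight e + prog_factor c"

lemma weight_pos: "0 < weight e"
  by (induction e) auto

lemma bits_less_power:
  assumes "x < 2 ^ k" shows "bits x \<le> Suc k"
  using floorlog_leI[OF assms] by (simp add: bits_def)

text \<open>Makes \<open>weight\<close> additive for \<open>Add\<close> as it is for
  \<open>Mul\<close>. The bound fails as soon as an exponent is 0, which is why weights and word
  length have to be positive.\<close>

lemma power2_add_le:
  assumes "0 < a" "0 < b" shows "(2::nat) ^ a + 2 ^ b \<le> 2 ^ (a + b)"
proof -
  obtain a' b' where "a = Suc a'" "b = Suc b'" using assms by (metis gr0_implies_Suc)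
  moreover have le: "(2::nat) * x + 2 * y \<le> 4 * (x * y)" if "1 \<le> x" "1 \<le> y" for x y :: nat
    using that by (cases x; cases y) auto
  from le[of "2 ^ a'" "2 ^ b'"] have "2 * (2::nat) ^ a' + 2 * 2 ^ b' \<le> 4 * (2 ^ a' * 2 ^ b')"
    by simp
  ultimately show ?thesis by (simp add: power_add)
qed

lemma val_less_power:
  assumes "\<forall>a. m a < 2 ^ b" "0 < b"
  shows "val e m < 2 ^ (b * weight e)"
proof (induction e)
  case (Const c)
  have "Suc c \<le> b * Suc c" using assms(2) by (cases b) auto
  then have "(2::nat) ^ Suc c \<le> 2 ^ (b * Suc c)" by (intro power_increasing) auto
  moreover have "c < 2 ^ Suc c"
    by (meson Suc_lessD less_exp)
  ultimately show ?case by simp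
next
  case (Load e)
  have "(2::nat) ^ b \<le> 2 ^ (b * Suc (weight e))" by (intro power_increasing) auto
  then show ?case using assms(1)[rule_format, of "val e m"] by (simp add: less_le_trans)
next
  case (Add e f)
  have "val e m + val f m < 2 ^ (b * weight e) + 2 ^ (b * weight f)" using Add by simp
  also have "\<dots> \<le> 2 ^ (b * weight e + b * weight f)"
    by (rule power2_add_le) (auto simp: assms weight_pos)
  finally show ?case by (simp add: distrib_left)
next
  case (Sub e f)
  have "(2::nat) ^ (b * weight e) \<le> 2 ^ (b * weight (Sub e f))" by (intro power_increasing) auto
  moreover have "val e m - val f m \<le> val e m" by simp
  ultimately show ?case using Sub unfolding val.simps by linarith
next
  case (Mul e f)
  then have "val e m * val f m < 2 ^ (b * weight e) * 2 ^ (b * weight f)"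
    by (intro mult_strict_mono) auto
  then show ?case by (simp add: distrib_left power_add)
next
  case (Div e f)
  have "(2::nat) ^ (b * weight e) \<le> 2 ^ (b * weight (Div e f))" by (intro power_increasing) auto
  moreover have "val e m div val f m \<le> val e m" by simp
  ultimately show ?case using Div unfolding val.simps by linarith
qed

lemma bits_val_le:
  assumes "\<forall>a. m a < 2 ^ b" "0 < b"
  shows "bits (val e m) \<le> 2 * weight e * b"
proof -
  have "bits (val e m) \<le> Suc (b * weight e)"
    by (rule bits_less_power) (rule val_less_power[OF assms])
  also have "\<dots> \<le> 2 * weight e * b"
    using assms(2) weight_pos[of e] by (simp add: mult.commute)
  finally show ?thesis .
qed

lemma bits_val_le_square:
  assumes "\<forall>a. m a < 2 ^ b" "0 < b"
  shows "bits (val e m) \<le> 2 * weight e * b\<^sup>2"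
proof -
  have "b \<le> b\<^sup>2" using assms(2) by (simp add: power2_eq_square)
  then have "2 * weight e * b \<le> 2 * weight e * b\<^sup>2" by (rule mult_le_mono2)
  then show ?thesis using bits_val_le[OF assms, of e] by linarith
qed

lemma cost_le:
  assumes "\<forall>a. m a < 2 ^ b" "0 < b"
  shows "cost e m \<le> expr_factor e * b\<^sup>2"
proof (induction e)
  case (Const c)
  then show ?case using assms(2) by simp
next
  case (Load e)
  have "bits (m (val e m)) \<le> Suc b" by (rule bits_less_power) (use assms(1) in blast)
  also have "\<dots> \<le> 2 * b\<^sup>2" using assms(2) by (cases b) (auto simp: power2_eq_square)
  finally show ?case
    using Load bits_val_le_square[OF assms, of e] by (simp add: algebra_simps)
next
  case (Add e f)
  then show ?case
    using bits_val_le_square[OF assms, of e] bits_val_le_square[OF assms, of f]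
    by (simp add: algebra_simps)
next
  case (Sub e f)
  then show ?case
    using bits_val_le_square[OF assms, of e] bits_val_le_square[OF assms, of f]
    by (simp add: algebra_simps)
next
  case (Mul e f)
  have "bits (val e m) * bits (val f m) \<le> (2 * weight e * b) * (2 * weight f * b)"
    by (intro mult_le_mono bits_val_le assms)
  then show ?case using Mul by (simp add: algebra_simps power2_eq_square)
next
  case (Div e f)
  have "bits (val e m) * bits (val f m) \<le> (2 * weight e * b) * (2 * weight f * b)"
    by (intro mult_le_mono bits_val_le assms)
  then show ?case using Div by (simp add: algebra_simps power2_eq_square)
qed

section \<open>A total-correctness calculus\<close>

text \<open>Memory is seen as the read-only input followed by 32 interleaved infinite arrays; a register
  is entry 0 of an array. As memory is unbounded and only address lengths are charged, the arrays
  may be addressed sparsely.\<close>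

type_synonym store = "nat \<Rightarrow> nat \<Rightarrow> nat"

definition layout :: "nat list \<Rightarrow> store \<Rightarrow> mem" where
  "layout xs \<sigma> a = (if a < length xs then xs ! a
     else \<sigma> ((a - length xs) mod 32) ((a - length xs) div 32))"

definition upd :: "store \<Rightarrow> nat \<Rightarrow> nat \<Rightarrow> nat \<Rightarrow> store" where
  "upd \<sigma> r i v = \<sigma>(r := (\<sigma> r)(i := v))"

lemma upd_apply: "upd \<sigma> r i v r' i' = (if r' = r \<and> i' = i then v else \<sigma> r' i')"
  by (simp add: upd_def)

definition fits :: "nat \<Rightarrow> store \<Rightarrow> bool" where
  "fits b \<sigma> \<longleftrightarrow> (\<forall>r i. \<sigma> r i < 2 ^ b)"

text \<open>The arrays begin behind an input of variable length, while addresses in the program are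
  fixed text; so each access recomputes the end of the input from the header cells.\<close>

definition input_end :: expr where
  "input_end = Add (Const 4) (Add (Load (Const 2)) (Mul (Const 2) (Load (Const 3))))"

definition addr :: "nat \<Rightarrow> expr \<Rightarrow> expr" where
  "addr r i = Add input_end (Add (Mul (Const 32) i) (Const r))"

definition Get :: "nat \<Rightarrow> expr \<Rightarrow> expr" where
  "Get r i = Load (addr r i)"

abbreviation Reg :: "nat \<Rightarrow> expr" where
  "Reg r \<equiv> Get r (Const 0)"

definition Put :: "nat \<Rightarrow> expr \<Rightarrow> expr \<Rightarrow> prog" where
  "Put r i e = Store (addr r i) e"

abbreviation Set :: "nat \<Rightarrow> expr \<Rightarrow> prog" where
  "Set r e \<equiv> Put r (Const 0) e"

definition Toss :: "nat \<Rightarrow> prog" where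
  "Toss r = Flip (addr r (Const 0))"

definition For :: "nat \<Rightarrow> expr \<Rightarrow> prog \<Rightarrow> prog" where
  "For r e c = Seq (Set r (Const 0))
     (While (Sub e (Reg r)) (Seq c (Set r (Add (Reg r) (Const 1)))))"

definition Eq :: "expr \<Rightarrow> expr \<Rightarrow> expr" where
  "Eq e f = Sub (Const 1) (Add (Sub e f) (Sub f e))"

definition Less :: "expr \<Rightarrow> expr \<Rightarrow> expr" where
  "Less e f = Sub (Const 1) (Sub (Add e (Const 1)) f)"

fun Seqs :: "prog list \<Rightarrow> prog" where
  "Seqs [] = Skip"
| "Seqs [c] = c"
| "Seqs (c # d # cs) = Seq c (Seqs (d # cs))"

lemma val_Eq: "val (Eq e f) m = of_bool (val e m = val f m)"
  by (auto simp: Eq_def)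

lemma val_Less: "val (Less e f) m = of_bool (val e m < val f m)"
  by (auto simp: Less_def)

text \<open>Keeping \<open>fits b\<close> before and after makes every elementary step cost at most
  a constant times \<open>b\<close> squared, with the same \<open>b\<close> throughout the run. The
  time thus splits into the step count \<open>N\<close>, on which all later reasoning concentrates,
  and a factor given by the program text. Termination is included.\<close>

definition wp ::
  "nat list \<Rightarrow> nat \<Rightarrow> prog \<Rightarrow> nat \<Rightarrow> (store \<Rightarrow> bool stream \<Rightarrow> bool) \<Rightarrow> store \<Rightarrow> bool stream \<Rightarrow> bool" where
  "wp xs b c N Q \<sigma> w \<longleftrightarrow> (fits b \<sigma> \<longrightarrow>
     (\<exists>\<sigma>' w' t. exec c (layout xs \<sigma>, w) t (layout xs \<sigma>', w') \<and> t \<le> N * prog_factor c * b\<^sup>2 \<and>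
        fits b \<sigma>' \<and> Q \<sigma>' w'))"

lemma wp_mono:
  assumes "wp xs b c N Q \<sigma> w" "N \<le> N'" "\<And>\<sigma>' w'. Q \<sigma>' w' \<Longrightarrow> Q' \<sigma>' w'"
  shows "wp xs b c N' Q' \<sigma> w"
proof -
  have "N * prog_factor c * b\<^sup>2 \<le> N' * prog_factor c * b\<^sup>2"
    by (intro mult_le_mono1 assms(2))
  then show ?thesis using assms(1,3) unfolding wp_def by (meson le_trans)
qed

lemma wp_Seq:
  assumes "wp xs b c N (wp xs b d N' Q) \<sigma> w"
  shows "wp xs b (Seq c d) (N + N') Q \<sigma> w"
  unfolding wp_def
proof
  assume "fits b \<sigma>"
  with assms obtain \<sigma>1 w1 t1 where 1: "exec c (layout xs \<sigma>, w) t1 (layout xs \<sigma>1, w1)"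
      "t1 \<le> N * prog_factor c * b\<^sup>2" "fits b \<sigma>1" "wp xs b d N' Q \<sigma>1 w1"
    unfolding wp_def by blast
  then obtain \<sigma>2 w2 t2 where 2: "exec d (layout xs \<sigma>1, w1) t2 (layout xs \<sigma>2, w2)"
      "t2 \<le> N' * prog_factor d * b\<^sup>2" "fits b \<sigma>2" "Q \<sigma>2 w2"
    unfolding wp_def by blast
  have "t1 + t2 \<le> (N + N') * prog_factor (Seq c d) * b\<^sup>2"
    using 1(2) 2(2) by (simp add: algebra_simps)
  with 1 2 show "\<exists>\<sigma>' w' t. exec (Seq c d) (layout xs \<sigma>, w) t (layout xs \<sigma>', w') \<and>
      t \<le> (N + N') * prog_factor (Seq c d) * b\<^sup>2 \<and> fits b \<sigma>' \<and> Q \<sigma>' w'"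
    by (blast intro: exec.Seq)
qed

locale machine_input =
  fixes xs :: "nat list" and n m b :: nat
  assumes length_input: "length xs = 4 + n + 2 * m"
    and input_n: "xs ! 2 = n" and input_m: "xs ! 3 = m"
    and input_fits: "\<And>x. x \<in> set xs \<Longrightarrow> x < 2 ^ b"
    and b_pos: "0 < b"
begin

lemma val_input_end: "val input_end (layout xs \<sigma>) = length xs"
  by (simp add: input_end_def layout_def length_input input_n input_m)

lemma val_addr: "val (addr r i) (layout xs \<sigma>) = length xs + (32 * val i (layout xs \<sigma>) + r)"
  by (simp add: addr_def val_input_end)

lemma val_Get: "r < 32 \<Longrightarrow> val (Get r i) (layout xs \<sigma>) = \<sigma> r (val i (layout xs \<sigma>))"
  unfolding Get_def by (simp add: val_addr layout_def)

lemma layout_upd: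
  assumes "r < 32"
  shows "(layout xs \<sigma>)(length xs + (32 * i + r) := v) = layout xs (upd \<sigma> r i v)"
proof
  fix a
  show "((layout xs \<sigma>)(length xs + (32 * i + r) := v)) a = layout xs (upd \<sigma> r i v) a"
  proof (cases "a < length xs")
    case False
    then obtain d where a: "a = length xs + d" by (metis le_Suc_ex not_less)
    have "d = 32 * i + r \<longleftrightarrow> d mod 32 = r \<and> d div 32 = i"
      using assms by auto
    then show ?thesis by (auto simp: a layout_def upd_apply)
  qed (auto simp: layout_def)
qed

lemma layout_fits: "fits b \<sigma> \<Longrightarrow> \<forall>a. layout xs \<sigma> a < 2 ^ b"
  by (simp add: layout_def fits_def input_fits)

lemma wp_Put:
  assumes "r < 32"
    and "fits b \<sigma> \<Longrightarrow> val e (layout xs \<sigma>) < 2 ^ b"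
    and "Q (upd \<sigma> r (val i (layout xs \<sigma>)) (val e (layout xs \<sigma>))) w"
  shows "wp xs b (Put r i e) 1 Q \<sigma> w"
  unfolding wp_def
proof
  let ?m = "layout xs \<sigma>" and ?\<sigma> = "upd \<sigma> r (val i (layout xs \<sigma>)) (val e (layout xs \<sigma>))"
  assume f: "fits b \<sigma>"
  have "exec (Put r i e) (?m, w)
     (cost (addr r i) ?m + cost e ?m + bits (val (addr r i) ?m) + bits (val e ?m))
     (?m(val (addr r i) ?m := val e ?m), w)"
    unfolding Put_def by (rule exec.Store)
  moreover have "?m(val (addr r i) ?m := val e ?m) = layout xs ?\<sigma>"
    by (simp only: val_addr layout_upd[OF assms(1)])
  moreover have "cost (addr r i) ?m + cost e ?m + bits (val (addr r i) ?m) + bits (val e ?m) \<le>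
      1 * prog_factor (Put r i e) * b\<^sup>2"
    using cost_le[of ?m b "addr r i", OF layout_fits[OF f] b_pos]
      cost_le[of ?m b e, OF layout_fits[OF f] b_pos]
      bits_val_le_square[of ?m b e, OF layout_fits[OF f] b_pos]
      bits_val_le_square[of ?m b "addr r i", OF layout_fits[OF f] b_pos]
    by (simp add: Put_def algebra_simps)
  moreover have "fits b ?\<sigma>" using f assms(2) by (auto simp: fits_def upd_apply)
  ultimately show "\<exists>\<sigma>' w' t. exec (Put r i e) (?m, w) t (layout xs \<sigma>', w') \<and>
      t \<le> 1 * prog_factor (Put r i e) * b\<^sup>2 \<and> fits b \<sigma>' \<and> Q \<sigma>' w'"
    using assms(3) by auto
qed

lemma wp_Toss:
  assumes "r < 32" and "Q (upd \<sigma> r 0 (of_bool (shd w))) (stl w)"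
  shows "wp xs b (Toss r) 1 Q \<sigma> w"
  unfolding wp_def
proof
  let ?m = "layout xs \<sigma>" and ?\<sigma> = "upd \<sigma> r 0 (of_bool (shd w))"
  let ?a = "addr r (Const 0)"
  assume f: "fits b \<sigma>"
  have "exec (Toss r) (?m, w) (cost ?a ?m + bits (val ?a ?m) + 1)
     (?m(val ?a ?m := of_bool (shd w)), stl w)"
    unfolding Toss_def by (rule exec.Flip)
  moreover have "?m(val ?a ?m := of_bool (shd w)) = layout xs ?\<sigma>"
    by (simp only: val_addr layout_upd[OF assms(1)] val.simps)
  moreover have "cost ?a ?m + bits (val ?a ?m) + 1 \<le> 1 * prog_factor (Toss r) * b\<^sup>2"
  proof -
    have "1 \<le> b\<^sup>2" using b_pos by simp
    then show ?thesis
      using cost_le[of ?m b ?a, OF layout_fits[OF f] b_pos]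
        bits_val_le_square[of ?m b ?a, OF layout_fits[OF f] b_pos]
      by (simp add: Toss_def algebra_simps)
  qed
  moreover have "fits b ?\<sigma>"
    using f one_less_power[of "2::nat" b, OF _ b_pos] by (auto simp: fits_def upd_apply)
  ultimately show "\<exists>\<sigma>' w' t. exec (Toss r) (?m, w) t (layout xs \<sigma>', w') \<and>
      t \<le> 1 * prog_factor (Toss r) * b\<^sup>2 \<and> fits b \<sigma>' \<and> Q \<sigma>' w'"
    using assms(2) by auto
qed

text \<open>The exact number \<open>M\<close> of passes is known beforehand, and the induction is on
  the number \<open>d\<close> of passes still to come. A pass is charged \<open>N + 1\<close>, the 1
  paying for the guard; the final 1 is the failing test.\<close>

lemma wp_While:
  assumes "I 0 \<sigma> w"
    and body: "\<And>i \<sigma> w. i < M \<Longrightarrow> I i \<sigma> w \<Longrightarrow> wp xs b c N (I (Suc i)) \<sigma> w"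
    and guard: "\<And>i \<sigma> w. i \<le> M \<Longrightarrow> I i \<sigma> w \<Longrightarrow> val e (layout xs \<sigma>) \<noteq> 0 \<longleftrightarrow> i < M"
    and fin: "\<And>\<sigma> w. I M \<sigma> w \<Longrightarrow> Q \<sigma> w"
  shows "wp xs b (While e c) (M * (N + 1) + 1) Q \<sigma> w"
proof -
  have cost: "cost e (layout xs \<sigma>) + bits (val e (layout xs \<sigma>)) \<le> prog_factor (While e c) * b\<^sup>2"
    if "fits b \<sigma>" for \<sigma>
  proof -
    have "cost e (layout xs \<sigma>) + bits (val e (layout xs \<sigma>)) \<le>
        expr_factor e * b\<^sup>2 + 2 * weight e * b\<^sup>2"
      by (intro add_mono cost_le bits_val_le_square layout_fits that b_pos)
    then show ?thesis by (simp add: distrib_right)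
  qed
  have "wp xs b (While e c) (d * (N + 1) + 1) Q \<sigma> w" if "I (M - d) \<sigma> w" "d \<le> M" for d \<sigma> w
    using that
  proof (induction d arbitrary: \<sigma> w)
    case 0
    show ?case unfolding wp_def
    proof
      assume f: "fits b \<sigma>"
      have "val e (layout xs \<sigma>) = 0" using guard[of M \<sigma> w] 0 by simp
      from exec.While_False[OF this] cost[OF f] f fin[of \<sigma> w] 0
      show "\<exists>\<sigma>' w' t. exec (While e c) (layout xs \<sigma>, w) t (layout xs \<sigma>', w') \<and>
          t \<le> (0 * (N + 1) + 1) * prog_factor (While e c) * b\<^sup>2 \<and> fits b \<sigma>' \<and> Q \<sigma>' w'"
        by (metis add_0 diff_zero mult_1 mult_zero_left)
    qed
  next
    case (Suc d)
    show ?case unfolding wp_def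
    proof
      assume f: "fits b \<sigma>"
      let ?k = "prog_factor (While e c)"
      have v: "val e (layout xs \<sigma>) \<noteq> 0" using guard[of "M - Suc d" \<sigma> w] Suc.prems by simp
      have "Suc (M - Suc d) = M - d" using Suc.prems by simp
      with body[of "M - Suc d" \<sigma> w] Suc.prems have "wp xs b c N (I (M - d)) \<sigma> w" by simp
      with f obtain \<sigma>1 w1 t1 where 1: "exec c (layout xs \<sigma>, w) t1 (layout xs \<sigma>1, w1)"
        "t1 \<le> N * prog_factor c * b\<^sup>2" "fits b \<sigma>1" "I (M - d) \<sigma>1 w1"
        unfolding wp_def by blast
      from Suc.IH[OF 1(4)] Suc.prems have "wp xs b (While e c) (d * (N + 1) + 1) Q \<sigma>1 w1" by simp
      with 1(3) obtain \<sigma>2 w2 t2 where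
        2: "exec (While e c) (layout xs \<sigma>1, w1) t2 (layout xs \<sigma>2, w2)"
        "t2 \<le> (d * (N + 1) + 1) * ?k * b\<^sup>2" "fits b \<sigma>2" "Q \<sigma>2 w2"
        unfolding wp_def by blast
      have "N * prog_factor c * b\<^sup>2 \<le> N * ?k * b\<^sup>2" by simp
      with 1(2) have t1: "t1 \<le> N * ?k * b\<^sup>2" by linarith
      have "cost e (layout xs \<sigma>) + bits (val e (layout xs \<sigma>)) + t1 + t2 \<le>
          ?k * b\<^sup>2 + N * ?k * b\<^sup>2 + (d * (N + 1) + 1) * ?k * b\<^sup>2"
        by (intro add_mono cost[OF f] t1 2(2))
      also have "\<dots> = (Suc d * (N + 1) + 1) * ?k * b\<^sup>2"
      proof -
        have "K * B + N * K * B + (d * (N + 1) + 1) * K * B = (Suc d * (N + 1) + 1) * K * B"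
          for K B :: nat by (simp add: algebra_simps)
        then show ?thesis .
      qed
      finally show "\<exists>\<sigma>' w' t. exec (While e c) (layout xs \<sigma>, w) t (layout xs \<sigma>', w') \<and>
          t \<le> (Suc d * (N + 1) + 1) * ?k * b\<^sup>2 \<and> fits b \<sigma>' \<and> Q \<sigma>' w'"
        using exec.While_True[OF v 1(1) 2(1)] 2(3,4) by blast
    qed
  qed
  from this[of M \<sigma> w] assms(1) show ?thesis by simp
qed

text \<open>The bound \<open>e\<close> is evaluated anew before every pass, so the invariant must
  guarantee that it still has the value \<open>M\<close>. After the body, the invariant is required
  for the store with the counter already advanced. The overhead of 2 per pass is increment and
  guard, the final 2 initialization and failing test.\<close>

lemma wp_For:
  assumes r: "r < 32" and M: "M < 2 ^ b"
    and init: "I 0 (upd \<sigma> r 0 0) w"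
    and body: "\<And>i \<sigma> w. i < M \<Longrightarrow> \<sigma> r 0 = i \<Longrightarrow> I i \<sigma> w \<Longrightarrow>
      wp xs b c N (\<lambda>\<sigma> w. \<sigma> r 0 = i \<and> I (Suc i) (upd \<sigma> r 0 (Suc i)) w) \<sigma> w"
    and bound: "\<And>i \<sigma> w. i \<le> M \<Longrightarrow> \<sigma> r 0 = i \<Longrightarrow> I i \<sigma> w \<Longrightarrow> val e (layout xs \<sigma>) = M"
    and fin: "\<And>\<sigma> w. \<sigma> r 0 = M \<Longrightarrow> I M \<sigma> w \<Longrightarrow> Q \<sigma> w"
  shows "wp xs b (For r e c) (M * (N + 2) + 2) Q \<sigma> w"
proof -
  let ?I = "\<lambda>i \<sigma> w. \<sigma> r 0 = i \<and> I i \<sigma> w"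
  let ?c = "Seq c (Set r (Add (Reg r) (Const 1)))"
  have "wp xs b (While (Sub e (Reg r)) ?c) (M * ((N + 1) + 1) + 1) Q
      (upd \<sigma> r 0 0) w"
  proof (rule wp_While[where I = ?I])
    show "?I 0 (upd \<sigma> r 0 0) w" using init by (simp add: upd_apply)
  next
    fix i \<sigma> w assume i: "i < M" "?I i \<sigma> w"
    have "wp xs b (Set r (Add (Reg r) (Const 1))) 1 (?I (Suc i)) \<sigma>' w'"
      if "\<sigma>' r 0 = i \<and> I (Suc i) (upd \<sigma>' r 0 (Suc i)) w'" for \<sigma>' w'
      by (rule wp_Put[OF r]) (use that i M in \<open>auto simp: val_Get r upd_apply\<close>)
    then show "wp xs b ?c (N + 1) (?I (Suc i)) \<sigma> w"
      by (intro wp_Seq wp_mono[OF body[of i \<sigma> w]]) (use i in auto)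
  next
    fix i \<sigma> w assume i: "i \<le> M" "?I i \<sigma> w"
    with bound[of i \<sigma> w] have "val e (layout xs \<sigma>) = M" by blast
    with i show "val (Sub e (Reg r)) (layout xs \<sigma>) \<noteq> 0 \<longleftrightarrow> i < M"
      by (auto simp: val_Get r)
  qed (use fin in auto)
  then have "wp xs b (Seq (Set r (Const 0)) (While (Sub e (Reg r)) ?c))
      (1 + (M * ((N + 1) + 1) + 1)) Q \<sigma> w"
    by (intro wp_Seq wp_Put[OF r]) auto
  then show ?thesis unfolding For_def by (rule wp_mono) auto
qed

end

section \<open>Counting labellings modulo 4\<close>

text \<open>Graphs are given by the sets \<open>I v\<close> of edges incident to a vertex \<open>v\<close>.\<close>

definition closed_parts :: "('v \<Rightarrow> 'e set) \<Rightarrow> 'v set \<Rightarrow> 'v set set" where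
  "closed_parts I S = {C. C \<subseteq> S \<and> (\<forall>u\<in>C. \<forall>v\<in>S - C. I u \<inter> I v = {})}"

definition linked :: "('v \<Rightarrow> 'e set) \<Rightarrow> 'v set \<Rightarrow> bool" where
  "linked I S \<longleftrightarrow>
     (\<forall>u\<in>S. \<forall>v\<in>S. (u, v) \<in> {(x, y). x \<in> S \<and> y \<in> S \<and> I x \<inter> I y \<noteq> {}}\<^sup>*)"

lemma finite_closed_parts: "finite S \<Longrightarrow> finite (closed_parts I S)"
  by (rule finite_subset[of _ "Pow S"]) (auto simp: closed_parts_def)

text \<open>Complementation in \<open>S\<close> exchanges the parts that contain a fixed vertex
  \<open>a\<close> with those that do not.\<close>

lemma even_card_closed_parts:
  assumes "finite S" "S \<noteq> {}"
  shows "even (card (closed_parts I S))"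
proof -
  obtain a where a: "a \<in> S" using assms(2) by blast
  let ?A = "{C \<in> closed_parts I S. a \<in> C}" and ?B = "{C \<in> closed_parts I S. a \<notin> C}"
  have compl: "S - C \<in> closed_parts I S" if "C \<in> closed_parts I S" for C
    using that by (fastforce simp: closed_parts_def)
  have "S - (S - C) = C" if "C \<in> closed_parts I S" for C
    using that by (auto simp: closed_parts_def)
  then have "bij_betw (\<lambda>C. S - C) ?A ?B"
    using a compl by (intro bij_betw_byWitness[where f' = "\<lambda>C. S - C"]) auto
  then have "card ?A = card ?B" by (rule bij_betw_same_card)
  moreover have "card (closed_parts I S) = card ?A + card ?B"
    using finite_closed_parts[OF assms(1), of I]
    by (subst card_Un_disjoint[symmetric]) (auto intro: arg_cong[where f = card])
  ultimately show ?thesis by simp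
qed

text \<open>No edge is shared between \<open>P\<close> and \<open>S - P\<close>, so a closed part of
  \<open>S\<close> is an independent choice of closed parts on the two sides.\<close>

lemma card_closed_parts_split:
  assumes "finite S" "P \<in> closed_parts I S"
  shows "card (closed_parts I S) = card (closed_parts I P) * card (closed_parts I (S - P))"
proof -
  have P: "P \<subseteq> S" "\<And>u v. u \<in> P \<Longrightarrow> v \<in> S - P \<Longrightarrow> I u \<inter> I v = {}"
    using assms(2) by (auto simp: closed_parts_def)
  have 1: "C \<union> D \<in> closed_parts I S" if "C \<in> closed_parts I P" "D \<in> closed_parts I (S - P)" for C D
  proof -
    have C: "C \<subseteq> P" "\<forall>u\<in>C. \<forall>v\<in>P - C. I u \<inter> I v = {}"
      and D: "D \<subseteq> S - P" "\<forall>u\<in>D. \<forall>v\<in>S - P - D. I u \<inter> I v = {}"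
      using that by (auto simp: closed_parts_def)
    have "I u \<inter> I v = {}" if "u \<in> C \<union> D" "v \<in> S - (C \<union> D)" for u v
    proof (cases "u \<in> P"; cases "v \<in> P")
      assume "u \<in> P" "v \<in> P"
      then have "u \<in> C" "v \<in> P - C" using that D by auto
      then show ?thesis using C by blast
    next
      assume "u \<notin> P" "v \<notin> P"
      then have "u \<in> D" "v \<in> S - P - D" using that C by auto
      then show ?thesis using D by blast
    next
      assume "u \<in> P" "v \<notin> P"
      then show ?thesis using P(2)[of u v] that by auto
    next
      assume "u \<notin> P" "v \<in> P"
      moreover have "u \<in> S" using that(1) C D P(1) by blast
      ultimately show ?thesis using P(2)[of v u] by auto
    qed
    then show ?thesis using C(1) D(1) P(1) unfolding closed_parts_def by blast
  qed
  have 2: "C \<inter> P \<in> closed_parts I P" "C - P \<in> closed_parts I (S - P)" if "C \<in> closed_parts I S" for C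
    using that P(1) unfolding closed_parts_def by blast+
  have "bij_betw (\<lambda>(C, D). C \<union> D) (closed_parts I P \<times> closed_parts I (S - P)) (closed_parts I S)"
  proof (rule bij_betw_byWitness[where f' = "\<lambda>C. (C \<inter> P, C - P)"])
    show "\<forall>x\<in>closed_parts I P \<times> closed_parts I (S - P).
        (\<lambda>C. (C \<inter> P, C - P)) ((\<lambda>(C, D). C \<union> D) x) = x"
      by (auto simp: closed_parts_def)
  qed (use 1 2 in auto)
  then show ?thesis by (simp add: bij_betw_same_card[symmetric] card_cartesian_product)
qed

lemma card_closed_parts_linked:
  assumes "linked I S" "S \<noteq> {}"
  shows "card (closed_parts I S) = 2"
proof -
  have "C = {} \<or> C = S" if C: "C \<in> closed_parts I S" for C
  proof (rule ccontr)
    assume "\<not> ?thesis"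
    with C obtain a c where a: "a \<in> C" "c \<in> S" "c \<notin> C" by (auto simp: closed_parts_def)
    with C have "(a, c) \<in> {(x, y). x \<in> S \<and> y \<in> S \<and> I x \<inter> I y \<noteq> {}}\<^sup>*"
      using assms(1) by (auto simp: linked_def closed_parts_def)
    then have "c \<in> C"
      by (induction rule: rtrancl_induct) (use a C in \<open>auto simp: closed_parts_def\<close>)
    with a show False by simp
  qed
  moreover have "{} \<in> closed_parts I S" "S \<in> closed_parts I S" by (auto simp: closed_parts_def)
  ultimately have "closed_parts I S = {{}, S}" by blast
  then show ?thesis using assms(2) by simp
qed

text \<open>If \<open>v\<close> cannot be reached from \<open>u\<close>, the set of vertices
  reachable from \<open>u\<close> is closed and splits \<open>S\<close> into two nonempty sides,
  each of which contributes an even factor.\<close>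

lemma four_dvd_card_closed_parts:
  assumes "finite S" "\<not> linked I S"
  shows "4 dvd card (closed_parts I S)"
proof -
  let ?R = "{(x, y). x \<in> S \<and> y \<in> S \<and> I x \<inter> I y \<noteq> {}}"
  obtain u v where uv: "u \<in> S" "v \<in> S" "(u, v) \<notin> ?R\<^sup>*" using assms(2) by (auto simp: linked_def)
  let ?P = "{x \<in> S. (u, x) \<in> ?R\<^sup>*}"
  have "I x \<inter> I y = {}" if "x \<in> ?P" "y \<in> S - ?P" for x y
  proof (rule ccontr)
    assume "I x \<inter> I y \<noteq> {}"
    with that have "(x, y) \<in> ?R" by auto
    with that show False by (auto dest: rtrancl_into_rtrancl)
  qed
  then have "?P \<in> closed_parts I S" by (auto simp: closed_parts_def)
  from card_closed_parts_split[OF assms(1) this]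
  have "card (closed_parts I S) = card (closed_parts I ?P) * card (closed_parts I (S - ?P))" .
  moreover have "even (card (closed_parts I ?P))"
    by (rule even_card_closed_parts) (use assms uv in auto)
  moreover have "even (card (closed_parts I (S - ?P)))"
    by (rule even_card_closed_parts) (use assms uv in auto)
  ultimately have "2 * 2 dvd card (closed_parts I S)" by (simp only: mult_dvd_mono)
  then show ?thesis by simp
qed

text \<open>The number of labels that \<open>v\<close> may choose when \<open>F\<close> is the set
  of edges labelled 1. A vertex without edges may choose both.\<close>

definition agree :: "('v \<Rightarrow> 'e set) \<Rightarrow> 'e set \<Rightarrow> 'v \<Rightarrow> nat" where
  "agree I F v = of_bool (I v \<subseteq> F) + of_bool (I v \<inter> F = {})"

definition labelling_count :: "('v \<Rightarrow> 'e set) \<Rightarrow> 'e set \<Rightarrow> 'v set \<Rightarrow> nat" where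
  "labelling_count I E S = card (closed_parts I S) * 2 ^ card (E - \<Union> (I ` S))"

definition solution :: "('v \<Rightarrow> 'e set) \<Rightarrow> 'e set \<Rightarrow> 'v set \<Rightarrow> bool" where
  "solution I E S \<longleftrightarrow> linked I S \<and> E \<subseteq> \<Union> (I ` S)"

lemma prod_of_bool: "finite A \<Longrightarrow> (\<Prod>x\<in>A. of_bool (P x)) = (of_bool (\<forall>x\<in>A. P x) :: nat)"
  by (induction A rule: finite_induct) auto

text \<open>Pairs of a labelling \<open>F\<close> and the set \<open>C\<close> of vertices that
  choose label 1 are counted in two ways. For given \<open>C\<close> the labels of all edges touched
  by \<open>S\<close> are forced, and the demands are consistent exactly if \<open>C\<close> is
  closed; the labels of the untouched edges are free.\<close>

lemma sum_prod_agree: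
  assumes "finite E" "finite S" "\<And>v. v \<in> S \<Longrightarrow> I v \<subseteq> E"
  shows "(\<Sum>F\<in>Pow E. \<Prod>v\<in>S. agree I F v) = labelling_count I E S"
proof -
  let ?ok = "\<lambda>C F. (\<forall>v\<in>C. I v \<subseteq> F) \<and> (\<forall>v\<in>S - C. I v \<inter> F = {})"
  let ?k = "card (E - \<Union> (I ` S))"
  have count: "card {F \<in> Pow E. ?ok C F} = of_bool (C \<in> closed_parts I S) * 2 ^ ?k"
    if C: "C \<subseteq> S" for C
  proof (cases "C \<in> closed_parts I S")
    case True
    have "{F \<in> Pow E. ?ok C F} = (\<lambda>G. G \<union> \<Union> (I ` C)) ` Pow (E - \<Union> (I ` S))"
      (is "?A = ?f ` ?B")
    proof (intro equalityI subsetI)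
      fix F assume F: "F \<in> ?A"
      have "F \<inter> \<Union> (I ` S) \<subseteq> \<Union> (I ` C)" using F by blast
      then have "F = ?f (F - \<Union> (I ` S))" using F by blast
      moreover have "F - \<Union> (I ` S) \<in> ?B" using F by blast
      ultimately show "F \<in> ?f ` ?B" by blast
    next
      fix F assume "F \<in> ?f ` ?B"
      then obtain G where G: "G \<subseteq> E - \<Union> (I ` S)" "F = G \<union> \<Union> (I ` C)" by blast
      have "I v \<inter> F = {}" if "v \<in> S - C" for v
        using that G True unfolding closed_parts_def by blast
      moreover have "F \<subseteq> E" using G C assms(3) by blast
      ultimately show "F \<in> ?A" using G by blast
    qed
    moreover have "inj_on ?f ?B"
      by (rule inj_on_inverseI[where g = "\<lambda>F. F - \<Union> (I ` S)"]) (use C in blast)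
    ultimately have "card ?A = card ?B" by (simp only: card_image)
    then show ?thesis using assms(1) True by (simp add: card_Pow)
  next
    case False
    with C obtain u v e where "u \<in> C" "v \<in> S - C" "e \<in> I u" "e \<in> I v"
      unfolding closed_parts_def by blast
    then have "{F \<in> Pow E. ?ok C F} = {}" by blast
    then have "card {F \<in> Pow E. ?ok C F} = 0" by (simp only: card.empty)
    then show ?thesis using False by (simp only: of_bool_def if_False mult_zero_left)
  qed
  have "(\<Prod>v\<in>S. agree I F v) = (\<Sum>C\<in>Pow S. of_bool (?ok C F))" for F
  proof -
    have "(\<Prod>v\<in>S. agree I F v) = (\<Sum>C\<in>Pow S. (\<Prod>v\<in>C. of_bool (I v \<subseteq> F)) *
        (\<Prod>v\<in>S - C. of_bool (I v \<inter> F = {})))"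
      unfolding agree_def by (rule prod_add[OF assms(2)])
    also have "\<dots> = (\<Sum>C\<in>Pow S. of_bool (?ok C F))"
    proof (rule sum.cong[OF refl])
      fix C assume "C \<in> Pow S"
      then have "finite C" "finite (S - C)" using assms(2) finite_subset by auto
      then show "(\<Prod>v\<in>C. of_bool (I v \<subseteq> F)) * (\<Prod>v\<in>S - C. of_bool (I v \<inter> F = {})) =
          (of_bool (?ok C F) :: nat)"
        by (simp only: prod_of_bool of_bool_conj)
    qed
    finally show ?thesis .
  qed
  then have "(\<Sum>F\<in>Pow E. \<Prod>v\<in>S. agree I F v) = (\<Sum>F\<in>Pow E. \<Sum>C\<in>Pow S. of_bool (?ok C F))"
    by (simp only:)
  also have "\<dots> = (\<Sum>C\<in>Pow S. \<Sum>F\<in>Pow E. of_bool (?ok C F))" by (rule sum.swap)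
  also have "\<dots> = (\<Sum>C\<in>Pow S. of_bool (C \<in> closed_parts I S) * (2::nat) ^ ?k)"
  proof (rule sum.cong[OF refl])
    fix C assume "C \<in> Pow S"
    then have "C \<subseteq> S" by simp
    moreover have "(\<Sum>F\<in>Pow E. of_bool (?ok C F)) = card {F \<in> Pow E. ?ok C F}"
      using assms(1) by (subst sum_of_bool_eq) (simp_all only: finite_Pow_iff of_nat_id Int_def mem_Collect_eq)
    ultimately show "(\<Sum>F\<in>Pow E. of_bool (?ok C F)) = of_bool (C \<in> closed_parts I S) * (2::nat) ^ ?k"
      by (simp only: count)
  qed
  also have "\<dots> = card (Pow S \<inter> closed_parts I S) * 2 ^ ?k"
    unfolding sum_distrib_right[symmetric] using assms(2)
    by (subst sum_of_bool_eq) (simp_all only: finite_Pow_iff of_nat_id Collect_mem_eq)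
  also have "Pow S \<inter> closed_parts I S = closed_parts I S" by (auto simp: closed_parts_def)
  finally show ?thesis by (simp add: labelling_count_def)
qed

text \<open>A second factor 2 comes from a free label if an edge is uncovered, and from a second
  component if \<open>S\<close> is disconnected. The empty set has only one closed part and lacks
  even the first factor 2 from complementation.\<close>

lemma labelling_count_mod_4:
  assumes "finite S" "S \<noteq> {}" "finite E"
  shows "labelling_count I E S mod 4 = (if solution I E S then 2 else 0)"
proof (cases "E \<subseteq> \<Union> (I ` S)")
  case True
  then have "E - \<Union> (I ` S) = {}" by blast
  then have "labelling_count I E S = card (closed_parts I S)" by (simp only: labelling_count_def) simp
  then show ?thesis
    using True assms card_closed_parts_linked[of I S] four_dvd_card_closed_parts[of S I]
    by (auto simp: solution_def)
next
  case False
  then have "0 < card (E - \<Union> (I ` S))" using assms(3) by (auto simp: card_gt_0_iff)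
  then have "even ((2::nat) ^ card (E - \<Union> (I ` S)))" by simp
  with even_card_closed_parts[OF assms(1,2), of I] have "2 * 2 dvd labelling_count I E S"
    unfolding labelling_count_def by (rule mult_dvd_mono)
  then show ?thesis using False by (simp add: solution_def)
qed

text \<open>The summand 1 in the factor of \<open>v\<close> stands for leaving \<open>v\<close> out
  of \<open>S\<close>. For each labelling this is a product over vertices, the form that a sweep can
  evaluate although the sum over all sets \<open>S\<close> is implicit.\<close>

definition partition_sum :: "('v \<Rightarrow> 'e set) \<Rightarrow> 'e set \<Rightarrow> 'v set \<Rightarrow> ('v \<Rightarrow> nat) \<Rightarrow> nat" where
  "partition_sum I E X z = (\<Sum>F\<in>Pow E. \<Prod>v\<in>X. 1 + z v * agree I F v)"

lemma partition_sum_expand: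
  assumes "finite E" "finite X" "\<And>v. v \<in> X \<Longrightarrow> I v \<subseteq> E"
  shows "partition_sum I E X z = (\<Sum>S\<in>Pow X. (\<Prod>v\<in>S. z v) * labelling_count I E S)"
proof -
  have "partition_sum I E X z = (\<Sum>F\<in>Pow E. \<Sum>S\<in>Pow X. (\<Prod>v\<in>S. z v * agree I F v))"
    unfolding partition_sum_def
  proof (rule sum.cong[OF refl])
    fix F
    show "(\<Prod>v\<in>X. 1 + z v * agree I F v) = (\<Sum>S\<in>Pow X. (\<Prod>v\<in>S. z v * agree I F v))"
      using prod_add[OF assms(2), of "\<lambda>v. z v * agree I F v" "\<lambda>_. 1"] by (simp add: add.commute)
  qed
  also have "\<dots> = (\<Sum>S\<in>Pow X. \<Sum>F\<in>Pow E. (\<Prod>v\<in>S. z v * agree I F v))" by (rule sum.swap)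
  also have "\<dots> = (\<Sum>S\<in>Pow X. (\<Prod>v\<in>S. z v) * labelling_count I E S)"
  proof (rule sum.cong[OF refl])
    fix S assume "S \<in> Pow X"
    then have S: "S \<subseteq> X" by simp
    have "(\<Sum>F\<in>Pow E. (\<Prod>v\<in>S. z v * agree I F v)) =
        (\<Prod>v\<in>S. z v) * (\<Sum>F\<in>Pow E. \<Prod>v\<in>S. agree I F v)"
      by (simp add: prod.distrib sum_distrib_left)
    also have "(\<Sum>F\<in>Pow E. \<Prod>v\<in>S. agree I F v) = labelling_count I E S"
      using S assms finite_subset by (intro sum_prod_agree) auto
    finally show "(\<Sum>F\<in>Pow E. (\<Prod>v\<in>S. z v * agree I F v)) =
        (\<Prod>v\<in>S. z v) * labelling_count I E S" .
  qed
  finally show ?thesis .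
qed

text \<open>Origin of the base \<open>q\<close>: there are \<open>2 ^ card X\<close> sets, each with
  at most \<open>2 ^ card X\<close> closed parts and \<open>2 ^ card E\<close> labellings of
  uncovered edges. One more bit makes the bound strict, so that no digit overflows.\<close>

lemma sum_labelling_count_less:
  assumes "finite E" "finite X"
  shows "(\<Sum>S\<in>Pow X. labelling_count I E S) < 2 ^ (card E + 2 * card X + 1)"
proof -
  have "labelling_count I E S \<le> 2 ^ card X * 2 ^ card E" if "S \<in> Pow X" for S
  proof -
    have "finite S" using that assms(2) finite_subset by auto
    have "closed_parts I S \<subseteq> Pow X" using that by (auto simp: closed_parts_def)
    then have "card (closed_parts I S) \<le> 2 ^ card X"
      using assms(2) card_mono[of "Pow X"] by (simp add: card_Pow)
    moreover have "(2::nat) ^ card (E - \<Union> (I ` S)) \<le> 2 ^ card E"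
      using assms(1) by (intro power_increasing card_mono) auto
    ultimately show ?thesis unfolding labelling_count_def by (rule mult_le_mono)
  qed
  then have "(\<Sum>S\<in>Pow X. labelling_count I E S) \<le> card (Pow X) * (2 ^ card X * 2 ^ card E)"
    using sum_bounded_above[of "Pow X" "labelling_count I E" "2 ^ card X * 2 ^ card E"] by simp
  also have "\<dots> = 2 ^ (card E + 2 * card X)"
    using assms(2) by (simp add: card_Pow power_add mult_2)
  finally have "(\<Sum>S\<in>Pow X. labelling_count I E S) \<le> 2 ^ (card E + 2 * card X)" .
  also have "(2::nat) ^ (card E + 2 * card X) < 2 ^ (card E + 2 * card X + 1)" by simp
  finally show ?thesis .
qed

text \<open>Since no digit reaches the base, division by \<open>q ^ t\<close> removes exactly the
  lower digits, and all higher ones vanish modulo 4 together with \<open>q\<close>.\<close>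

lemma digit_mod_4:
  fixes a :: "nat \<Rightarrow> nat"
  assumes "\<And>s. a s < q" "4 dvd q"
  shows "(\<Sum>s<T. a s * q ^ s) div q ^ t mod 4 = (if t < T then a t mod 4 else 0)"
  using assms(1)
proof (induction t arbitrary: a T)
  case 0
  show ?case
  proof (cases T)
    case (Suc T')
    have "(\<Sum>s<T. a s * q ^ s) = a 0 + q * (\<Sum>s<T'. a (Suc s) * q ^ s)"
      unfolding Suc by (subst sum.lessThan_Suc_shift) (simp add: sum_distrib_left mult_ac)
    moreover obtain c where "q = 4 * c" using assms(2) by (rule dvdE)
    ultimately show ?thesis using Suc by (simp add: mult.assoc)
  qed simp
next
  case (Suc t)
  show ?case
  proof (cases T)
    case (Suc T')
    have "(\<Sum>s<T. a s * q ^ s) = a 0 + q * (\<Sum>s<T'. a (Suc s) * q ^ s)"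
      unfolding Suc by (subst sum.lessThan_Suc_shift) (simp add: sum_distrib_left mult_ac)
    moreover have "a 0 < q" using Suc.prems .
    ultimately have "(\<Sum>s<T. a s * q ^ s) div q = (\<Sum>s<T'. a (Suc s) * q ^ s)" by simp
    then have "(\<Sum>s<T. a s * q ^ s) div q ^ Suc t = (\<Sum>s<T'. a (Suc s) * q ^ s) div q ^ t"
      by (simp add: div_mult2_eq)
    then show ?thesis using Suc.IH[of "\<lambda>s. a (Suc s)" T'] Suc.prems Suc by simp
  qed simp
qed

text \<open>Only for \<open>t = 0\<close>, where the empty set contributes, would the coefficient be different.\<close>

lemma partition_sum_digit:
  assumes fin: "finite E" "finite X" and I: "\<And>v. v \<in> X \<Longrightarrow> I v \<subseteq> E"
    and W: "\<And>v. v \<in> X \<Longrightarrow> 0 < W v" and "0 < t"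
    and q: "q = 2 ^ (card E + 2 * card X + 1)" and "0 < card E"
  shows "partition_sum I E X (\<lambda>v. q ^ W v) div q ^ t mod 4 = 2 \<longleftrightarrow>
    odd (card {S \<in> Pow X. solution I E S \<and> sum W S = t})"
proof -
  define a where "a s = (\<Sum>S\<in>{S \<in> Pow X. sum W S = s}. labelling_count I E S)" for s
  define T where "T = Suc (max t (sum W X))"
  have T: "t < T" by (simp add: T_def)
  have finP: "finite {S \<in> Pow X. P S}" for P using fin(2) by simp
  have a_less: "a s < q" for s
  proof -
    have "a s \<le> (\<Sum>S\<in>Pow X. labelling_count I E S)"
      unfolding a_def using fin(2) by (intro sum_mono2) auto
    then show ?thesis using sum_labelling_count_less[OF fin, of I] q by simp
  qed
  have dvd: "4 dvd q"
  proof -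
    have "2 * 2 dvd (2::nat) ^ card E * (2 ^ (2 * card X) * 2)"
      using \<open>0 < card E\<close> by (intro mult_dvd_mono) auto
    then show ?thesis by (simp add: q power_add mult_ac)
  qed
  have "partition_sum I E X (\<lambda>v. q ^ W v) = (\<Sum>S\<in>Pow X. q ^ sum W S * labelling_count I E S)"
    by (simp add: partition_sum_expand[OF fin I] power_sum)
  also have "\<dots> = (\<Sum>s<T. \<Sum>S\<in>{S \<in> Pow X. sum W S = s}. q ^ sum W S * labelling_count I E S)"
  proof (rule sum.group[symmetric])
    show "sum W ` Pow X \<subseteq> {..<T}"
    proof
      fix s assume "s \<in> sum W ` Pow X"
      then obtain S where "S \<subseteq> X" "s = sum W S" by blast
      then have "s \<le> sum W X" using fin(2) by (auto intro: sum_mono2)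
      then show "s \<in> {..<T}" by (simp add: T_def)
    qed
  qed (use fin in auto)
  also have "\<dots> = (\<Sum>s<T. a s * q ^ s)"
    by (intro sum.cong) (auto simp: a_def sum_distrib_left mult.commute)
  finally have "partition_sum I E X (\<lambda>v. q ^ W v) div q ^ t mod 4 = a t mod 4"
    using digit_mod_4[of a q T t, OF a_less dvd] T by simp
  \<comment> \<open>Solutions contribute 2 each and other nonempty sets nothing, so the digit is
    twice the number of solutions of weight \<open>t\<close>. The empty set is not among the
    summands, its weight being 0.\<close>
  moreover have "a t mod 4 = (2 * card {S \<in> Pow X. solution I E S \<and> sum W S = t}) mod 4"
  proof -
    have "a t mod 4 = (\<Sum>S\<in>{S \<in> Pow X. sum W S = t}. labelling_count I E S mod 4) mod 4"
      unfolding a_def by (simp add: mod_sum_eq)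
    also have "(\<Sum>S\<in>{S \<in> Pow X. sum W S = t}. labelling_count I E S mod 4) =
        (\<Sum>S\<in>{S \<in> Pow X. sum W S = t}. if solution I E S then 2 else 0)"
    proof (rule sum.cong[OF refl])
      fix S assume S: "S \<in> {S \<in> Pow X. sum W S = t}"
      then have "S \<noteq> {}" "finite S" using \<open>0 < t\<close> fin(2) finite_subset by auto
      then show "labelling_count I E S mod 4 = (if solution I E S then 2 else 0)"
        by (intro labelling_count_mod_4 fin(1))
    qed
    also have "\<dots> = (\<Sum>S\<in>{S \<in> Pow X. sum W S = t \<and> solution I E S}. 2)"
      using finP by (subst sum.inter_filter[symmetric]) (auto intro: sum.cong)
    finally show ?thesis by (simp add: conj_commute mult.commute)
  qed
  moreover have "(2 * k) mod 4 = 2 \<longleftrightarrow> odd k" for k :: nat by presburger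
  ultimately show ?thesis by simp
qed

section \<open>Sweeping along the arrangement\<close>

text \<open>\<open>A i\<close> is the set of edges in the \<open>i\<close>th cut. In \<open>msg\<close>, the index 0, 1, 2 tells whether the
  next vertex is outside \<open>S\<close>, or inside with label 0 or 1 on all its edges; the labels of its edges
  to the left are summed out here, so that sums over the labellings of a single cut suffice.\<close>

definition fits_state :: "'e set \<Rightarrow> 'e set \<Rightarrow> nat \<Rightarrow> 'e set \<Rightarrow> bool" where
  "fits_state A J s F \<longleftrightarrow> (s = 1 \<longrightarrow> F \<inter> J = {}) \<and> (s = 2 \<longrightarrow> A \<inter> J \<subseteq> F)"

text \<open>Completes the treatment of a vertex whose edges to the left have been summed out: its
  edges in \<open>F\<close> lead to the right and are tested against its label, and only the rest
  \<open>F - J\<close> was visible to the message. The weight \<open>z\<close> of the vertex enters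
  here and nowhere else.\<close>

definition join ::
  "(nat \<Rightarrow> 'e set \<Rightarrow> nat) \<Rightarrow> 'e set \<Rightarrow> 'e set \<Rightarrow> nat \<Rightarrow> 'e set \<Rightarrow> nat" where
  "join u A J z F = u 0 (F - J) + z * (of_bool (fits_state A J 1 F) * u 1 (F - J) +
     of_bool (fits_state A J 2 F) * u 2 (F - J))"

text \<open>The base case is an imaginary vertex 0 outside \<open>S\<close>: states 1 and 2 have
  value 0 there and the cut at 0 is empty, so the recursion needs no special rule for vertex
  1.\<close>

primrec msg ::
  "(nat \<Rightarrow> 'e set) \<Rightarrow> (nat \<Rightarrow> 'e set) \<Rightarrow> (nat \<Rightarrow> nat) \<Rightarrow> nat \<Rightarrow> nat \<Rightarrow> 'e set \<Rightarrow> nat" where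
  "msg A I z 0 s G = of_bool (s = 0 \<and> G = {})"
| "msg A I z (Suc i) s G = (\<Sum>F\<in>Pow (A i). of_bool (F - I (Suc i) = G \<and>
     fits_state (A i) (I (Suc i)) s F) * join (msg A I z i) (A i) (I i) (z i) F)"

text \<open>The fact that an edge has only two ends is contained in \<open>I_seen\<close>: an edge
  of the next vertex that was seen before must still be open. In \<open>A_Suc\<close> such edges are
  closed and the new ones opened.\<close>

locale sweep =
  fixes A I :: "nat \<Rightarrow> 'e set" and z :: "nat \<Rightarrow> nat" and n :: nat
  assumes finite_I: "\<And>i. i \<in> {1..n} \<Longrightarrow> finite (I i)"
    and A_0: "A 0 = {}"
    and A_Suc: "\<And>i. i < n \<Longrightarrow> A (Suc i) = (A i - I (Suc i)) \<union> (I (Suc i) - \<Union> (I ` {1..i}))"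
    and I_seen: "\<And>i. i < n \<Longrightarrow> I (Suc i) \<inter> \<Union> (I ` {1..i}) \<subseteq> A i"
begin

definition seen :: "nat \<Rightarrow> 'e set" where
  "seen i = \<Union> (I ` {1..i})"

lemma seen_0: "seen 0 = {}" by (simp add: seen_def)

lemma seen_Suc: "seen (Suc i) = seen i \<union> I (Suc i)"
  by (auto simp: seen_def atLeastAtMostSuc_conv)

lemma finite_seen: "i \<le> n \<Longrightarrow> finite (seen i)"
  unfolding seen_def by (auto intro: finite_I)

lemma A_subset_seen: "i \<le> n \<Longrightarrow> A i \<subseteq> seen i"
proof (induction i)
  case (Suc i)
  then show ?case using A_Suc[of i] by (auto simp: seen_Suc)
qed (simp add: A_0)

definition local_prod :: "nat \<Rightarrow> 'e set \<Rightarrow> nat" where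
  "local_prod i H = (\<Prod>v\<in>{1..i}. 1 + z v * agree I H v)"

lemma local_prod_cong:
  assumes "H \<inter> seen i = H' \<inter> seen i" shows "local_prod i H = local_prod i H'"
  unfolding local_prod_def
proof (rule prod.cong[OF refl])
  fix v assume "v \<in> {1..i}"
  then have "I v \<subseteq> seen i" by (auto simp: seen_def)
  with assms have "I v \<inter> H = I v \<inter> H'" by blast
  then have "I v \<subseteq> H \<longleftrightarrow> I v \<subseteq> H'" "I v \<inter> H = {} \<longleftrightarrow> I v \<inter> H' = {}" by blast+
  then show "1 + z v * agree I H v = 1 + z v * agree I H' v"
    by (simp add: agree_def)
qed

definition prefix_sum :: "nat \<Rightarrow> 'e set \<Rightarrow> nat" where
  "prefix_sum i F = (\<Sum>H\<in>{H \<in> Pow (seen i). H \<inter> A i = F}. local_prod i H)"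

text \<open>The left edges of vertex \<open>Suc i\<close> all lie in \<open>A i\<close> and are
  tested when the message is formed; its right edges all lie in \<open>A (Suc i)\<close> and are
  tested in \<open>join\<close>. Both tests together say that all its edges carry its label, so the
  trace on the cut is all that has to be remembered of a labelling.\<close>

lemma join_eq_prefix_sum:
  assumes "i \<le> n" "F \<subseteq> A i"
  shows "join (msg A I z i) (A i) (I i) (z i) F = prefix_sum i F"
  using assms
proof (induction i arbitrary: F)
  case 0
  have "{H \<in> Pow (seen 0). H \<inter> A 0 = F} = {{}}" using 0 by (auto simp: seen_0 A_0)
  then show ?case using 0
    by (simp add: A_0 join_def prefix_sum_def local_prod_def)
next
  case (Suc i)
  let ?J = "I (Suc i)" and ?N = "I (Suc i) - seen i"
  have i: "i < n" using Suc.prems by simp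
  have A: "A (Suc i) = (A i - ?J) \<union> ?N" using A_Suc[OF i] by (simp add: seen_def)
  have J: "?J \<inter> seen i \<subseteq> A i" using I_seen[OF i] by (simp add: seen_def)
  have As: "A i \<subseteq> seen i" using A_subset_seen[of i] i by simp
  \<comment> \<open>The factor of vertex \<open>Suc i\<close>, with each label test split into a
    half on the left edges, visible in \<open>F'\<close>, and a half on the right edges, visible in
    \<open>F\<close>.\<close>
  define w where "w F' = 1 + z (Suc i) * (of_bool (fits_state (A i) ?J 1 F' \<and> fits_state (A (Suc i)) ?J 1 F) +
      of_bool (fits_state (A i) ?J 2 F' \<and> fits_state (A (Suc i)) ?J 2 F))" for F'
  have finA: "finite (A i)" using As finite_seen[of i] i finite_subset by auto
  have "join (msg A I z (Suc i)) (A (Suc i)) ?J (z (Suc i)) F =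
      (\<Sum>F'\<in>Pow (A i). of_bool (F' - ?J = F - ?J) * w F' * join (msg A I z i) (A i) (I i) (z i) F')"
    unfolding join_def[of "msg A I z (Suc i)"] msg.simps w_def
    unfolding sum_distrib_left sum.distrib[symmetric]
    by (intro sum.cong refl) (auto simp: fits_state_def algebra_simps)
  also have "\<dots> = (\<Sum>F'\<in>Pow (A i). of_bool (F' - ?J = F - ?J) * w F' * prefix_sum i F')"
    using Suc.IH i by (intro sum.cong refl) auto
  also have "\<dots> = (\<Sum>F'\<in>Pow (A i). \<Sum>H\<in>{H \<in> Pow (seen i). H \<inter> A i = F'}.
      of_bool (H \<inter> A i - ?J = F - ?J) * w (H \<inter> A i) * local_prod i H)"
    unfolding prefix_sum_def sum_distrib_left by (intro sum.cong refl) auto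
  also have "\<dots> = (\<Sum>H\<in>Pow (seen i).
      of_bool (H \<inter> A i - ?J = F - ?J) * w (H \<inter> A i) * local_prod i H)"
    by (rule sum.group) (use finA finite_seen[of i] i in auto)
  also have "\<dots> = (\<Sum>H\<in>{H \<in> Pow (seen i). H \<inter> A i - ?J = F - ?J}. w (H \<inter> A i) * local_prod i H)"
    using finite_seen[of i] i
    by (subst sum.inter_filter) (auto intro!: sum.cong)
  also have "\<dots> = (\<Sum>H\<in>{H \<in> Pow (seen (Suc i)). H \<inter> A (Suc i) = F}. local_prod (Suc i) H)"
  \<comment> \<open>\<open>F\<close> prescribes the labels of the new edges \<open>?N\<close>, so
    each labelling \<open>H\<close> of the old edges that matches \<open>F\<close> has exactly one
    extension with trace \<open>F\<close>.\<close>
  proof (rule sum.reindex_bij_witness[where i = "\<lambda>H. H \<inter> seen i" and j = "\<lambda>H. H \<union> (F \<inter> ?N)"])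
    fix H assume "H \<in> {H \<in> Pow (seen i). H \<inter> A i - ?J = F - ?J}"
    then have H: "H \<subseteq> seen i" "H \<inter> A i - ?J = F - ?J" by auto
    show "(H \<union> F \<inter> ?N) \<inter> seen i = H" using H by blast
    show "H \<union> F \<inter> ?N \<in> {H \<in> Pow (seen (Suc i)). H \<inter> A (Suc i) = F}"
    proof -
      have "F \<subseteq> A (Suc i)" using Suc.prems by simp
      then have "(H \<union> F \<inter> ?N) \<inter> A (Suc i) = F" using H As unfolding A by blast
      then show ?thesis using H by (auto simp: seen_Suc)
    qed
    have "local_prod i (H \<union> F \<inter> ?N) = local_prod i H" by (rule local_prod_cong) blast
    moreover have "of_bool (fits_state (A i) ?J 2 (H \<inter> A i) \<and> fits_state (A (Suc i)) ?J 2 F) =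
        (of_bool (?J \<subseteq> H \<union> F \<inter> ?N) :: nat)"
    proof -
      have "A (Suc i) \<inter> ?J = ?N" unfolding A using As by blast
      moreover have "A i \<inter> ?J = seen i \<inter> ?J" using As J by blast
      ultimately have "fits_state (A i) ?J 2 (H \<inter> A i) \<and> fits_state (A (Suc i)) ?J 2 F \<longleftrightarrow>
          ?J \<subseteq> H \<union> F \<inter> ?N"
        unfolding fits_state_def using H J by simp blast
      then show ?thesis by simp
    qed
    moreover have "of_bool (fits_state (A i) ?J 1 (H \<inter> A i) \<and> fits_state (A (Suc i)) ?J 1 F) =
        (of_bool (?J \<inter> (H \<union> F \<inter> ?N) = {}) :: nat)"
    proof -
      have "F \<inter> ?J \<subseteq> ?N" using Suc.prems As unfolding A by blast
      then have "fits_state (A i) ?J 1 (H \<inter> A i) \<and> fits_state (A (Suc i)) ?J 1 F \<longleftrightarrow>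
          ?J \<inter> (H \<union> F \<inter> ?N) = {}"
        unfolding fits_state_def using H J by simp blast
      then show ?thesis by simp
    qed
    ultimately show "local_prod (Suc i) (H \<union> F \<inter> ?N) = w (H \<inter> A i) * local_prod i H"
      unfolding w_def local_prod_def
      by (simp add: agree_def mult.commute add.commute)
  next
    fix H assume "H \<in> {H \<in> Pow (seen (Suc i)). H \<inter> A (Suc i) = F}"
    then have H: "H \<subseteq> seen i \<union> ?J" "H \<inter> A (Suc i) = F" by (auto simp: seen_Suc)
    show "H \<inter> seen i \<union> F \<inter> ?N = H" using H unfolding A by blast
    show "H \<inter> seen i \<in> {H \<in> Pow (seen i). H \<inter> A i - ?J = F - ?J}" using H As unfolding A by blast
  qed
  finally show ?case unfolding prefix_sum_def .
qed

text \<open>A second imaginary vertex \<open>Suc n\<close>, again kept outside \<open>S\<close>,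
  makes the last message include the factor of vertex \<open>n\<close>.\<close>

lemma msg_final:
  assumes "A n = {}" "seen n = E"
  shows "msg A I z (Suc n) 0 {} = partition_sum I E {1..n} z"
proof -
  have "msg A I z (Suc n) 0 {} = join (msg A I z n) (A n) (I n) (z n) {}"
    by (simp add: assms(1) fits_state_def)
  also have "\<dots> = prefix_sum n {}" by (rule join_eq_prefix_sum) auto
  finally show ?thesis
    by (simp add: prefix_sum_def assms partition_sum_def local_prod_def Pow_def)
qed

lemma local_prod_le:
  assumes "\<And>v. v \<in> {1..i} \<Longrightarrow> 1 + 2 * z v \<le> K"
  shows "local_prod i H \<le> K ^ i"
proof -
  have "local_prod i H \<le> (\<Prod>v\<in>{1..i}. K)"
    unfolding local_prod_def
  proof (rule prod_mono)
    fix v assume v: "v \<in> {1..i}"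
    have "agree I H v \<le> 2" by (simp add: agree_def)
    then have "z v * agree I H v \<le> z v * 2" by (rule mult_le_mono2)
    then show "0 \<le> 1 + z v * agree I H v \<and> 1 + z v * agree I H v \<le> K" using assms[OF v] by linarith
  qed
  then show ?thesis by simp
qed

text \<open>The sum over a whole cut is bounded rather than single values, because messages and all
  partial sums formed by the program are then bounded as well. This determines the word
  length.\<close>

lemma sum_join_le:
  assumes "i \<le> n" "0 < K" "\<And>v. v \<in> {1..n} \<Longrightarrow> 1 + 2 * z v \<le> K"
  shows "(\<Sum>F\<in>Pow (A i). join (msg A I z i) (A i) (I i) (z i) F) \<le> 2 ^ card (seen n) * K ^ n"
proof -
  have fin: "finite (seen i)" "finite (A i)"
    using finite_seen[of i] A_subset_seen[of i] assms(1) finite_subset by auto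
  have "(\<Sum>F\<in>Pow (A i). join (msg A I z i) (A i) (I i) (z i) F) = (\<Sum>F\<in>Pow (A i). prefix_sum i F)"
    by (intro sum.cong refl join_eq_prefix_sum assms(1)) auto
  also have "\<dots> = (\<Sum>H\<in>Pow (seen i). local_prod i H)"
    unfolding prefix_sum_def by (rule sum.group) (use fin in auto)
  also have "\<dots> \<le> (\<Sum>H\<in>Pow (seen i). K ^ i)"
    using assms by (intro sum_mono local_prod_le) auto
  also have "\<dots> = 2 ^ card (seen i) * K ^ i" using fin by (simp add: card_Pow)
  also have "\<dots> \<le> 2 ^ card (seen n) * K ^ n"
  proof (intro mult_le_mono power_increasing card_mono)
    show "seen i \<subseteq> seen n" unfolding seen_def using assms(1) by (intro UN_mono) auto
  qed (use assms finite_seen[of n] in auto)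
  finally show ?thesis .
qed

end

section \<open>The isolation lemma with coin flips\<close>

definition minimal_in :: "'v set set \<Rightarrow> ('v \<Rightarrow> nat) \<Rightarrow> 'v set \<Rightarrow> bool" where
  "minimal_in \<F> W S \<longleftrightarrow> S \<in> \<F> \<and> (\<forall>T\<in>\<F>. sum W S \<le> sum W T)"

definition tie :: "'v set set \<Rightarrow> ('v \<Rightarrow> nat) \<Rightarrow> 'v \<Rightarrow> bool" where
  "tie \<F> W v \<longleftrightarrow> (\<exists>S T. minimal_in \<F> W S \<and> minimal_in \<F> W T \<and> v \<in> S \<and> v \<notin> T)"

lemma tie_if_not_unique:
  assumes "\<F> \<noteq> {}" "\<F> \<subseteq> Pow X" "\<not> (\<exists>!S. minimal_in \<F> W S)"
  shows "\<exists>v\<in>X. tie \<F> W v"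
proof -
  obtain S0 where "S0 \<in> \<F>" using assms(1) by blast
  have "\<exists>S. minimal_in \<F> W S"
    using arg_min_nat_lemma[of "\<lambda>S. S \<in> \<F>" S0 "sum W"] \<open>S0 \<in> \<F>\<close>
    unfolding minimal_in_def by blast
  with assms(3) obtain S T where "minimal_in \<F> W S" "minimal_in \<F> W T" "S \<noteq> T" by blast
  moreover from this assms(2) have "S \<subseteq> X" "T \<subseteq> X" by (auto simp: minimal_in_def)
  ultimately show ?thesis unfolding tie_def by blast
qed

text \<open>Both the least weight of a member of \<open>\<F>\<close> without \<open>v\<close> and, up to the weight of \<open>v\<close>, the least
  weight of a member with \<open>v\<close> depend on the other weights only; in a tie they coincide.\<close>

lemma tie_determines_weight:
  assumes "\<F> \<subseteq> Pow X" "finite X" "tie \<F> W v" "tie \<F> W' v"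
    and eq: "\<And>u. u \<in> X \<Longrightarrow> u \<noteq> v \<Longrightarrow> W u = W' u"
  shows "W v = W' v"
proof -
  obtain S T where S: "minimal_in \<F> W S" "v \<in> S" and T: "minimal_in \<F> W T" "v \<notin> T"
    using assms(3) by (auto simp: tie_def)
  obtain S' T' where S': "minimal_in \<F> W' S'" "v \<in> S'" and T': "minimal_in \<F> W' T'" "v \<notin> T'"
    using assms(4) by (auto simp: tie_def)
  have with_v: "sum W R + W' v = sum W' R + W v" if "R \<in> \<F>" "v \<in> R" for R
  proof -
    have "R \<subseteq> X" using that assms(1) by auto
    moreover from this have "finite R" using assms(2) by (rule finite_subset)
    moreover have "sum W (R - {v}) = sum W' (R - {v})" using \<open>R \<subseteq> X\<close> by (intro sum.cong eq) auto
    ultimately show ?thesis using that(2) by (simp add: sum.remove[of R v])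
  qed
  have without_v: "sum W R = sum W' R" if "R \<in> \<F>" "v \<notin> R" for R
    using that assms(1) by (intro sum.cong eq) auto
  have F: "S \<in> \<F>" "T \<in> \<F>" "S' \<in> \<F>" "T' \<in> \<F>" using S T S' T' by (auto simp: minimal_in_def)
  have "sum W S = sum W T" "sum W' S' = sum W' T'"
    using S T S' T' F by (auto simp: minimal_in_def intro: antisym)
  moreover have "sum W T \<le> sum W T'" "sum W S \<le> sum W S'" "sum W' T' \<le> sum W' T" "sum W' S' \<le> sum W' S"
    using S T S' T' F by (auto simp: minimal_in_def)
  ultimately show ?thesis
    using with_v[OF F(1) S(2)] with_v[OF F(3) S'(2)] without_v[OF F(2) T(2)] without_v[OF F(4) T'(2)]
    by linarith
qed

text \<open>The first flip is the leading digit, as the program doubles its register before adding a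
  new flip.\<close>

primrec bits_value :: "(nat \<Rightarrow> bool) \<Rightarrow> nat \<Rightarrow> nat" where
  "bits_value f 0 = 0"
| "bits_value f (Suc i) = 2 * bits_value f i + of_bool (f i)"

lemma bits_value_less: "bits_value f h < 2 ^ h"
  by (induction h) (auto simp: of_bool_def)

lemma bits_value_inject: "bits_value f h = bits_value g h \<Longrightarrow> i < h \<Longrightarrow> f i = g i"
proof (induction h)
  case (Suc h)
  then have *: "2 * bits_value f h + of_bool (f h) = 2 * bits_value g h + of_bool (g h)" by simp
  then have "f h = g h" by (cases "f h"; cases "g h") (simp_all, presburger+)
  with * Suc show ?case by (cases "i = h") auto
qed simp

lemma bits_value_cong: "(\<And>i. i < h \<Longrightarrow> f i = g i) \<Longrightarrow> bits_value f h = bits_value g h"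
  by (induction h) auto

text \<open>Vertex \<open>v \<ge> 1\<close> reads its weight from the \<open>v\<close>th block of \<open>h\<close> flips.\<close>

definition block_value :: "nat \<Rightarrow> (nat \<Rightarrow> bool) \<Rightarrow> nat \<Rightarrow> nat" where
  "block_value h f v = bits_value (\<lambda>i. f ((v - 1) * h + i)) h"

lemma block_index:
  fixes n v :: nat
  assumes "v \<in> {1..n}" "i < h"
  shows "(v - 1) * h + i < n * h"
proof -
  obtain u where u: "v = Suc u" using assms(1) by (cases v) auto
  then have "Suc u * h \<le> n * h" using assms(1) by (intro mult_le_mono1) auto
  then show ?thesis using assms(2) u by simp
qed

lemma block_value_cong:
  assumes "\<And>j. j < n * h \<Longrightarrow> f j = g j" "v \<in> {1..n}"
  shows "block_value h f v = block_value h g v"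
  unfolding block_value_def using assms block_index by (intro bits_value_cong) blast

text \<open>In a tie at \<open>v\<close> the weight of \<open>v\<close>, and with it the whole block
  of flips, is determined by the flips outside the block. Overwriting the block of a tied sequence
  by arbitrary flips therefore loses nothing, which gives an injection from pairs of a tied sequence
  and a block into all sequences. In other words, a tie at \<open>v\<close> has probability at most
  \<open>1 / 2 ^ h\<close>.\<close>

lemma card_tie_le:
  assumes \<F>: "\<F> \<subseteq> Pow {1..n}" and v: "v \<in> {1..n}"
  shows "card {bs. length bs = n * h \<and> tie \<F> (\<lambda>u. M + block_value h (\<lambda>j. bs ! j) u) v} * 2 ^ h
    \<le> 2 ^ (n * h)"
proof -
  let ?B = "{bs. length bs = n * h \<and> tie \<F> (\<lambda>u. M + block_value h (\<lambda>j. bs ! j) u) v}"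
  let ?L = "\<lambda>k. {bs :: bool list. length bs = k}"
  let ?p = "(v - 1) * h"
  let ?f = "\<lambda>(bs, cs). take ?p bs @ cs @ drop (?p + h) bs"
  have ph: "?p + h \<le> n * h"
  proof -
    have "?p + h = v * h" using v by (cases v) auto
    also have "\<dots> \<le> n * h" using v by (intro mult_le_mono1) auto
    finally show ?thesis .
  qed
  have card_L: "card (?L k) = 2 ^ k" "finite (?L k)" for k
    using card_lists_length_eq[of "UNIV :: bool set" k] finite_lists_length_eq[of "UNIV :: bool set" k]
    by auto
  have "inj_on ?f (?B \<times> ?L h)"
  proof (rule inj_onI)
    fix p q assume pq: "p \<in> ?B \<times> ?L h" "q \<in> ?B \<times> ?L h" "?f p = ?f q"
    obtain bs cs bs' cs' where p: "p = (bs, cs)" and q: "q = (bs', cs')" by fastforce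
    from pq have len: "length bs = n * h" "length bs' = n * h" "length cs = h" "length cs' = h"
      and t: "tie \<F> (\<lambda>u. M + block_value h (\<lambda>j. bs ! j) u) v"
        "tie \<F> (\<lambda>u. M + block_value h (\<lambda>j. bs' ! j) u) v"
      by (auto simp: p q)
    from pq(3) have "take ?p bs @ cs @ drop (?p + h) bs = take ?p bs' @ cs' @ drop (?p + h) bs'"
      by (simp add: p q)
    then have eq: "take ?p bs = take ?p bs'" "cs = cs'" "drop (?p + h) bs = drop (?p + h) bs'"
      using ph len by auto
    have outside: "bs ! j = bs' ! j" if "j < n * h" "j < ?p \<or> ?p + h \<le> j" for j
      using that(2)
    proof
      assume "j < ?p"
      then show ?thesis using eq(1) by (metis nth_take)
    next
      assume "?p + h \<le> j"
      then obtain d where "j = ?p + h + d" using le_Suc_ex by blast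
      then show ?thesis using eq(3) len ph that(1) by (metis nth_drop less_imp_le_nat le_trans)
    qed
    have "M + block_value h (\<lambda>j. bs ! j) v = M + block_value h (\<lambda>j. bs' ! j) v"
    proof (rule tie_determines_weight[OF \<F> _ t])
      fix u assume u: "u \<in> {1..n}" "u \<noteq> v"
      have "bs ! ((u - 1) * h + i) = bs' ! ((u - 1) * h + i)" if i: "i < h" for i
      proof (rule outside[OF block_index[OF u(1) i]])
        show "(u - 1) * h + i < ?p \<or> ?p + h \<le> (u - 1) * h + i"
        proof (cases "u < v")
          case True
          then have "Suc (u - 1) * h \<le> ?p" using u(1) by (intro mult_le_mono1) auto
          then show ?thesis using i by simp
        next
          case False
          then have "Suc (v - 1) * h \<le> (u - 1) * h" using u v by (intro mult_le_mono1) auto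
          then show ?thesis by simp
        qed
      qed
      then have "block_value h (\<lambda>j. bs ! j) u = block_value h (\<lambda>j. bs' ! j) u"
        unfolding block_value_def by (rule bits_value_cong)
      then show "M + block_value h (\<lambda>j. bs ! j) u = M + block_value h (\<lambda>j. bs' ! j) u" by simp
    qed simp
    then have inside: "bs ! (?p + i) = bs' ! (?p + i)" if "i < h" for i
      using bits_value_inject[of "\<lambda>i. bs ! (?p + i)" h "\<lambda>i. bs' ! (?p + i)" i] that
      by (simp add: block_value_def)
    have "bs = bs'"
    proof (rule nth_equalityI)
      fix j assume "j < length bs"
      then show "bs ! j = bs' ! j"
        using outside[of j] inside[of "j - ?p"] len by (cases "j < ?p \<or> ?p + h \<le> j") auto
    qed (use len in simp)
    with eq show "p = q" by (simp add: p q)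
  qed
  moreover have "?f ` (?B \<times> ?L h) \<subseteq> ?L (n * h)" using ph by auto
  ultimately have "card (?B \<times> ?L h) \<le> card (?L (n * h))" by (rule card_inj_on_le) (rule card_L(2))
  then show ?thesis by (simp only: card_cartesian_product card_L)
qed

text \<open>All measure theory is confined here: an event determined by \<open>D\<close> flips is
  measured by counting lists. The induction splits off the first flip, using the recursive structure
  of the stream space. Padding with \<open>False\<close> is an arbitrary choice.\<close>

lemma measure_coin_flips:
  assumes "\<And>w w'. (\<And>j. j < D \<Longrightarrow> w !! j = w' !! j) \<Longrightarrow> P w \<longleftrightarrow> P w'"
  shows "{w. P w} \<in> sets coin_flips \<and>
    measure coin_flips {w. P w} = card {bs. length bs = D \<and> P (bs @- sconst False)} / 2 ^ D"
  using assms
proof (induction D arbitrary: P)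
  case 0
  interpret S: prob_space coin_flips
    unfolding coin_flips_def by (rule prob_space.prob_space_stream_space[OF prob_space_measure_pmf])
  have UNIV: "space coin_flips = UNIV" by (simp add: coin_flips_def space_stream_space)
  have const: "P w \<longleftrightarrow> P (sconst False)" for w by (rule 0) simp
  show ?case
  proof (cases "P (sconst False)")
    case True
    then have all: "{w. P w} = space coin_flips" using const unfolding UNIV by blast
    have "{bs. length bs = 0 \<and> P (bs @- sconst False)} = {[]}" using True by auto
    from arg_cong[OF this, of card] have "card {bs. length bs = 0 \<and> P (bs @- sconst False)} = 1"
      by simp
    then show ?thesis
      by (simp only: all sets.top S.prob_space of_nat_1 power_0 div_by_1 simp_thms)
  next
    case False
    then have none: "{w. P w} = {}" using const by blast
    have "{bs. length bs = 0 \<and> P (bs @- sconst False)} = {}" using False by auto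
    from arg_cong[OF this, of card] have "card {bs. length bs = 0 \<and> P (bs @- sconst False)} = 0"
      by simp
    then show ?thesis
      by (simp only: none sets.empty_sets measure_empty of_nat_0 div_0 simp_thms)
  qed
next
  case (Suc D)
  interpret S: prob_space coin_flips
    unfolding coin_flips_def by (rule prob_space.prob_space_stream_space[OF prob_space_measure_pmf])
  let ?P = "\<lambda>c w. P (c ## w)"
  let ?n = "\<lambda>c. card {bs. length bs = D \<and> ?P c (bs @- sconst False)}"
  have IH: "{w. ?P c w} \<in> sets coin_flips"
      "measure coin_flips {w. ?P c w} = ?n c / 2 ^ D" for c
  proof -
    have "{w. ?P c w} \<in> sets coin_flips \<and> measure coin_flips {w. ?P c w} = ?n c / 2 ^ D"
    proof (rule Suc.IH)
      fix w w' :: "bool stream" assume "\<And>j. j < D \<Longrightarrow> w !! j = w' !! j"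
      then have "(c ## w) !! j = (c ## w') !! j" if "j < Suc D" for j
        using that by (cases j) auto
      then show "?P c w \<longleftrightarrow> ?P c w'" by (rule Suc.prems)
    qed
    then show "{w. ?P c w} \<in> sets coin_flips"
      "measure coin_flips {w. ?P c w} = ?n c / 2 ^ D" by auto
  qed
  have UNIV: "space coin_flips = UNIV" by (simp add: coin_flips_def space_stream_space)
  have sets: "{w. P w} \<in> sets coin_flips"
  proof -
    let ?S = "\<lambda>c. (shd -` {c} \<inter> space coin_flips) \<inter> (stl -` {w. ?P c w} \<inter> space coin_flips)"
    have "?S c \<in> sets coin_flips" for c
    proof (rule sets.Int)
      show "shd -` {c} \<inter> space coin_flips \<in> sets coin_flips"
        unfolding coin_flips_def by (rule measurable_sets[OF measurable_shd]) simp
      show "stl -` {w. ?P c w} \<inter> space coin_flips \<in> sets coin_flips"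
        using IH(1)[of c] unfolding coin_flips_def by (rule measurable_sets[OF measurable_stl])
    qed
    then have "?S True \<union> ?S False \<in> sets coin_flips" by (intro sets.Un)
    moreover have "{w. P w} = ?S True \<union> ?S False"
    proof (intro set_eqI)
      fix w
      show "w \<in> {w. P w} \<longleftrightarrow> w \<in> ?S True \<union> ?S False"
        using stream.collapse[of w] by (cases "shd w") (auto simp: UNIV)
    qed
    ultimately show ?thesis by simp
  qed
  have "emeasure coin_flips {w. P w} =
      (\<integral>\<^sup>+c. emeasure coin_flips {w. ?P c w} \<partial>measure_pmf (bernoulli_pmf (1/2)))"
    using prob_space.emeasure_stream_space[OF prob_space_measure_pmf, of "{w. P w}" "bernoulli_pmf (1/2)"] sets
    by (simp add: coin_flips_def space_stream_space)
  also have "\<dots> = ennreal (measure coin_flips {w. ?P True w}) * ennreal (1/2) +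
      ennreal (measure coin_flips {w. ?P False w}) * ennreal (1/2)"
    by (subst nn_integral_measure_pmf_support[of UNIV])
      (auto simp: UNIV_bool S.emeasure_eq_measure)
  also have "\<dots> = ennreal (measure coin_flips {w. ?P True w} * (1/2) +
      measure coin_flips {w. ?P False w} * (1/2))"
    by (simp only: ennreal_mult[symmetric] ennreal_plus[symmetric] measure_nonneg
      mult_nonneg_nonneg zero_le_divide_1_iff zero_le_numeral)
  finally have "ennreal (measure coin_flips {w. P w}) =
      ennreal (measure coin_flips {w. ?P True w} * (1/2) + measure coin_flips {w. ?P False w} * (1/2))"
    by (simp only: S.emeasure_eq_measure)
  then have "measure coin_flips {w. P w} =
      measure coin_flips {w. ?P True w} * (1/2) + measure coin_flips {w. ?P False w} * (1/2)"
    by (subst (asm) ennreal_inj) auto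
  also have "\<dots> = real (?n True + ?n False) / 2 ^ Suc D"
    by (simp add: IH add_divide_distrib)
  also have "?n True + ?n False = card {bs. length bs = Suc D \<and> P (bs @- sconst False)}"
  proof -
    let ?L = "\<lambda>c. {bs. length bs = D \<and> ?P c (bs @- sconst False)}"
    have fin: "finite (?L c)" for c
      using finite_lists_length_eq[of "UNIV :: bool set" D] by (rule rev_finite_subset) auto
    have "{bs. length bs = Suc D \<and> P (bs @- sconst False)} = (#) True ` ?L True \<union> (#) False ` ?L False"
    proof (intro equalityI subsetI)
      fix bs assume "bs \<in> {bs. length bs = Suc D \<and> P (bs @- sconst False)}"
      then obtain c cs where "bs = c # cs" "length cs = D" "P (bs @- sconst False)"
        by (auto simp: length_Suc_conv)
      then show "bs \<in> (#) True ` ?L True \<union> (#) False ` ?L False" by (cases c) auto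
    qed auto
    moreover have "card ((#) True ` ?L True \<union> (#) False ` ?L False) = ?n True + ?n False"
      using fin by (subst card_Un_disjoint) (auto simp: card_image)
    ultimately show ?thesis by simp
  qed
  finally show ?case using sets by blast
qed

text \<open>Union bound: each of the \<open>n\<close> vertices is tied with probability at most
  \<open>1 / 2 ^ h\<close>, which is at most \<open>1 / (2 * n)\<close>. Taking any event
  \<open>P\<close> inside the failure of uniqueness makes the bound directly applicable to
  rejection.\<close>

lemma isolation:
  assumes \<F>: "\<F> \<subseteq> Pow {1..n}" "\<F> \<noteq> {}" and h: "2 * n \<le> 2 ^ h"
    and P: "\<And>w w'. (\<And>j. j < n * h \<Longrightarrow> w !! j = w' !! j) \<Longrightarrow> P w \<longleftrightarrow> P w'"
    and unique: "\<And>w. P w \<Longrightarrow> \<not> (\<exists>!S. minimal_in \<F> (\<lambda>u. M + block_value h (\<lambda>j. w !! j) u) S)"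
  shows "{w. P w} \<in> sets coin_flips" "measure coin_flips {w. P w} \<le> 1 / 2"
proof -
  let ?D = "n * h"
  let ?A = "{bs. length bs = ?D \<and> P (bs @- sconst False)}"
  let ?B = "\<lambda>v. {bs. length bs = ?D \<and> tie \<F> (\<lambda>u. M + block_value h (\<lambda>j. bs ! j) u) v}"
  from measure_coin_flips[of ?D P, OF P]
  have m: "{w. P w} \<in> sets coin_flips" "measure coin_flips {w. P w} = card ?A / 2 ^ ?D" by auto
  show "{w. P w} \<in> sets coin_flips" by (rule m)
  have "?A \<subseteq> (\<Union>v\<in>{1..n}. ?B v)"
  proof
    fix bs assume bs: "bs \<in> ?A"
    then have "\<exists>v\<in>{1..n}. tie \<F> (\<lambda>u. M + block_value h (\<lambda>j. (bs @- sconst False) !! j) u) v"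
      using unique[of "bs @- sconst False"] by (intro tie_if_not_unique \<F>) auto
    then obtain v where v: "v \<in> {1..n}"
        "tie \<F> (\<lambda>u. M + block_value h (\<lambda>j. (bs @- sconst False) !! j) u) v" by blast
    have W: "M + block_value h (\<lambda>j. (bs @- sconst False) !! j) u = M + block_value h (\<lambda>j. bs ! j) u"
      if "u \<in> {1..n}" for u
      using block_value_cong[of n h "\<lambda>j. (bs @- sconst False) !! j" "\<lambda>j. bs ! j" u] that bs by simp
    have "sum (\<lambda>u. M + block_value h (\<lambda>j. (bs @- sconst False) !! j) u) S =
        sum (\<lambda>u. M + block_value h (\<lambda>j. bs ! j) u) S" if "S \<in> \<F>" for S
      using that \<F>(1) by (intro sum.cong W refl) blast
    then have "minimal_in \<F> (\<lambda>u. M + block_value h (\<lambda>j. (bs @- sconst False) !! j) u) S \<longleftrightarrow>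
        minimal_in \<F> (\<lambda>u. M + block_value h (\<lambda>j. bs ! j) u) S" for S
      unfolding minimal_in_def by (metis (no_types, lifting))
    then have "tie \<F> (\<lambda>u. M + block_value h (\<lambda>j. bs ! j) u) v" using v(2) by (simp add: tie_def)
    then show "bs \<in> (\<Union>v\<in>{1..n}. ?B v)" using v(1) bs by blast
  qed
  moreover have fin: "finite (?B v)" for v
    using finite_lists_length_eq[of "UNIV :: bool set" ?D] by (rule rev_finite_subset) auto
  ultimately have "card ?A \<le> card (\<Union>v\<in>{1..n}. ?B v)" by (intro card_mono) auto
  also have "\<dots> \<le> (\<Sum>v\<in>{1..n}. card (?B v))" by (rule card_UN_le) simp
  finally have "card ?A * 2 ^ h \<le> (\<Sum>v\<in>{1..n}. card (?B v) * 2 ^ h)"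
    by (simp add: sum_distrib_right[symmetric])
  also have "\<dots> \<le> (\<Sum>v\<in>{1..n}. 2 ^ ?D)" by (intro sum_mono card_tie_le \<F>(1))
  also have "\<dots> = n * 2 ^ ?D" by simp
  finally have 1: "card ?A * 2 ^ h \<le> n * 2 ^ ?D" .
  have "2 * card ?A \<le> 2 ^ ?D"
  proof (cases "n = 0")
    case True
    have "c = 0" if "c * 2 ^ h \<le> n * d" for c d :: nat using that True by simp
    from this[OF 1] show ?thesis by (simp only: mult_0_right le0)
  next
    case False
    have "(2 * card ?A) * n = card ?A * (2 * n)" by simp
    also have "\<dots> \<le> card ?A * 2 ^ h" by (rule mult_le_mono2[OF h])
    also note 1
    finally have "(2 * card ?A) * n \<le> 2 ^ ?D * n" by (simp add: mult.commute)
    with False show ?thesis by simp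
  qed
  then have "real (2 * card ?A) \<le> real (2 ^ ?D)" by (rule of_nat_mono)
  then show "measure coin_flips {w. P w} \<le> 1 / 2" unfolding m(2) by (simp add: field_simps)
qed

section \<open>The program\<close>

abbreviation (input) "rI \<equiv> 0 :: nat"
abbreviation (input) "rJ \<equiv> 1 :: nat"
abbreviation (input) "rE \<equiv> 2 :: nat"
abbreviation (input) "rT \<equiv> 3 :: nat"
abbreviation (input) "rH \<equiv> 4 :: nat"
abbreviation (input) "rPow \<equiv> 5 :: nat"
abbreviation (input) "rBase \<equiv> 6 :: nat"
abbreviation (input) "rFlip \<equiv> 7 :: nat"
abbreviation (input) "rWeight \<equiv> 8 :: nat"
abbreviation (input) "rZ \<equiv> 9 :: nat"
abbreviation (input) "rSeen \<equiv> 10 :: nat"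
abbreviation (input) "rSize \<equiv> 11 :: nat"
abbreviation (input) "rRest \<equiv> 12 :: nat"
abbreviation (input) "rBit \<equiv> 13 :: nat"
abbreviation (input) "rIn \<equiv> 14 :: nat"
abbreviation (input) "rOut \<equiv> 15 :: nat"
abbreviation (input) "rX0 \<equiv> 16 :: nat"
abbreviation (input) "rX1 \<equiv> 17 :: nat"
abbreviation (input) "rY0 \<equiv> 18 :: nat"
abbreviation (input) "rY1 \<equiv> 19 :: nat"
abbreviation (input) "rAct \<equiv> 20 :: nat"
abbreviation (input) "rLab \<equiv> 21 :: nat"
abbreviation (input) "rInc \<equiv> 22 :: nat"
abbreviation (input) "rInc' \<equiv> 23 :: nat"
abbreviation (input) "rVal \<equiv> 24 :: nat"
abbreviation (input) "rTotal \<equiv> 25 :: nat"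
abbreviation (input) "rFound \<equiv> 26 :: nat"
abbreviation (input) "rU \<equiv> (\<lambda>s. 28 + s :: nat)"

abbreviation (input) "in_k \<equiv> Load (Const 1)"
abbreviation (input) "in_n \<equiv> Load (Const 2)"
abbreviation (input) "in_m \<equiv> Load (Const 3)"

text \<open>The ends of an edge differ, so the sum of the two tests is 0 or 1. Vertex
  \<open>i\<close> is found in cell \<open>3 + i\<close>, as vertices are numbered from 1 and follow
  four header cells.\<close>

definition inc_expr :: "expr \<Rightarrow> expr \<Rightarrow> expr" where
  "inc_expr i e = Add
     (Eq (Load (Add (Const 3) i)) (Load (Add (Add (Const 4) in_n) (Mul (Const 2) e))))
     (Eq (Load (Add (Const 3) i)) (Load (Add (Add (Const 5) in_n) (Mul (Const 2) e))))"

text \<open>Instead of an open-ended search for the block length, a loop of \<open>n\<close> passes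
  doubles \<open>rPow\<close> until the flag \<open>rAct\<close> stops it at \<open>2 * n\<close>;
  by \<open>hash_bits_le\<close> this many passes are enough. The second loop computes the base of
  the digits.\<close>

definition init_prog :: prog where
  "init_prog = Seqs [
     Set rPow (Const 1),
     For rI in_n (Seqs [
       Set rAct (Less (Reg rPow) (Mul (Const 2) in_n)),
       Set rH (Add (Reg rH) (Reg rAct)),
       Set rPow (Mul (Reg rPow) (Add (Const 1) (Reg rAct)))]),
     Set rBase (Const 1),
     For rI (Add (Add in_m (Mul (Const 2) in_n)) (Const 1)) (Set rBase (Mul (Const 2) (Reg rBase)))]"

definition toss_prog :: prog where
  "toss_prog = For rT (Reg rH) (Seq (Toss rFlip)
     (Put rWeight (Reg rI) (Add (Mul (Const 2) (Get rWeight (Reg rI))) (Reg rFlip))))"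

text \<open>Pass \<open>i\<close> serves vertex \<open>i + 1\<close>, whose entry in
  \<open>rZ\<close> carries its own number. Entry 0 thereby keeps the value 0 for the imaginary
  vertex 0.\<close>

definition power_prog :: prog where
  "power_prog = For rT (Add (Mul in_n (Reg rPow)) (Get rWeight (Reg rI)))
     (Put rZ (Add (Reg rI) (Const 1)) (Mul (Get rZ (Add (Reg rI) (Const 1))) (Reg rBase)))"

definition weight_prog :: prog where
  "weight_prog = For rI in_n
     (Seqs [toss_prog, Put rZ (Add (Reg rI) (Const 1)) (Const 1), power_prog])"

text \<open>For labelling number \<open>rJ\<close> of the current cut, \<open>rIn\<close> and
  \<open>rOut\<close> collect the codes of the edges labelled 1 that avoid vertex \<open>rI\<close>,
  respectively \<open>rI + 1\<close>. Of the edges in the cut, \<open>rX0\<close> and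
  \<open>rX1\<close> count those at vertex \<open>rI\<close> with label 0 and 1, and
  \<open>rY0\<close> and \<open>rY1\<close> those at \<open>rI + 1\<close>. Truncated subtraction of
  such a counter from 1 gives the indicator that no edge contradicts a state.\<close>

definition label_prog :: prog where
  "label_prog = Seqs [
     Set rRest (Reg rJ), Set rBit (Const 1), Set rIn (Const 0), Set rOut (Const 0),
     Set rX0 (Const 0), Set rX1 (Const 0), Set rY0 (Const 0), Set rY1 (Const 0),
     For rE in_m (Seqs [
       Set rAct (Eq (Get rSeen (Reg rE)) (Const 1)),
       Set rLab (Mul (Reg rAct) (Sub (Reg rRest) (Mul (Const 2) (Div (Reg rRest) (Const 2))))),
       Set rInc (inc_expr (Reg rI) (Reg rE)),
       Set rInc' (inc_expr (Add (Reg rI) (Const 1)) (Reg rE)),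
       Set rIn (Add (Reg rIn) (Mul (Mul (Reg rLab) (Reg rBit)) (Sub (Const 1) (Reg rInc)))),
       Set rOut (Add (Reg rOut) (Mul (Mul (Reg rLab) (Reg rBit)) (Sub (Const 1) (Reg rInc')))),
       Set rX0 (Add (Reg rX0) (Mul (Sub (Reg rAct) (Reg rLab)) (Reg rInc))),
       Set rX1 (Add (Reg rX1) (Mul (Reg rLab) (Reg rInc))),
       Set rY0 (Add (Reg rY0) (Mul (Sub (Reg rAct) (Reg rLab)) (Reg rInc'))),
       Set rY1 (Add (Reg rY1) (Mul (Reg rLab) (Reg rInc'))),
       Set rRest (Div (Reg rRest) (Add (Const 1) (Reg rAct))),
       Set rBit (Mul (Const 2) (Reg rBit))])]"

text \<open>In \<open>sweep_prog\<close>, array \<open>rU s\<close> holds \<open>msg \<dots> i s G\<close> at index \<open>set_encode G * (n + 2) + i\<close>; these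
  indices are exponentially large and sparse, but no cell is used for two purposes or has to be cleared.\<close>

definition table :: "expr \<Rightarrow> expr \<Rightarrow> expr" where
  "table c i = Add (Mul c (Add in_n (Const 2))) i"

definition message_prog :: prog where
  "message_prog = (
     let out = table (Reg rOut) (Add (Reg rI) (Const 1)); inp = table (Reg rIn) (Reg rI)
     in Seqs [
     Set rVal (Add (Get (rU 0) inp) (Mul (Get rZ (Reg rI)) (Add
       (Mul (Sub (Const 1) (Reg rX1)) (Get (rU 1) inp))
       (Mul (Sub (Const 1) (Reg rX0)) (Get (rU 2) inp))))),
     Put (rU 0) out (Add (Get (rU 0) out) (Reg rVal)),
     Put (rU 1) out (Add (Get (rU 1) out) (Mul (Sub (Const 1) (Reg rY1)) (Reg rVal))),
     Put (rU 2) out (Add (Get (rU 2) out) (Mul (Sub (Const 1) (Reg rY0)) (Reg rVal)))])"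

text \<open>An edge is in the current cut exactly if one of its ends has been passed. One doubling
  per such edge gives the number of labellings, so the sweep adapts to each cut and never needs to
  know the cutwidth.\<close>

definition size_prog :: prog where
  "size_prog = Seq (Set rSize (Const 1))
     (For rE in_m (Set rSize
       (Mul (Reg rSize) (Add (Const 1) (Eq (Get rSeen (Reg rE)) (Const 1))))))"

definition seen_prog :: prog where
  "seen_prog = For rE in_m (Put rSeen (Reg rE)
     (Add (Get rSeen (Reg rE)) (inc_expr (Add (Reg rI) (Const 1)) (Reg rE))))"

definition sweep_prog :: prog where
  "sweep_prog = Seq (Put (rU 0) (Const 0) (Const 1))
     (For rI (Add in_n (Const 1)) (Seqs [
       size_prog,
       For rJ (Reg rSize) (Seq label_prog message_prog),
       seen_prog]))"

text \<open>The value of \<open>k\<close> may be exponential in the input size; therefore the loop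
  runs over all possible weights of solutions and \<open>k\<close> enters only through a comparison.
  Digit 0 is skipped because of the empty set.\<close>

definition decode_prog :: prog where
  "decode_prog = Seq (Set rTotal (Get (rU 0) (Add in_n (Const 1))))
     (For rT (Mul (Mul in_n (Reg rPow)) (Add in_n (Const 1))) (Seq
       (Set rFound (Add (Reg rFound) (Mul (Mul (Less (Const 0) (Reg rT))
         (Less (Reg rT) (Mul (Mul in_n (Reg rPow)) (Add in_k (Const 1)))))
         (Eq (Sub (Reg rTotal) (Mul (Const 4) (Div (Reg rTotal) (Const 4)))) (Const 2)))))
       (Set rTotal (Div (Reg rTotal) (Reg rBase)))))"

definition main_prog :: prog where
  "main_prog = Seqs [init_prog, weight_prog, sweep_prog, decode_prog]"

text \<open>Without edges the empty set is a connected vertex cover, which the counting is built to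
  ignore. With at least one edge every solution is nonempty.\<close>

definition cvc_prog :: prog where
  "cvc_prog = Cond (Load (Const 0)) (Store (Const 0) (Const 0))
     (Cond in_m (Seq main_prog (Store (Const 0) (Reg rFound))) (Store (Const 0) (Const 1)))"

section \<open>Correctness of the program\<close>

definition frame :: "nat set \<Rightarrow> store \<Rightarrow> store \<Rightarrow> bool" where
  "frame X \<sigma> \<sigma>' \<longleftrightarrow> (\<forall>r. r \<notin> X \<longrightarrow> \<sigma>' r = \<sigma> r)"

lemma frame_refl: "frame X \<sigma> \<sigma>" by (simp add: frame_def)

lemma frameD: "frame X \<sigma> \<sigma>' \<Longrightarrow> r \<notin> X \<Longrightarrow> \<sigma>' r = \<sigma> r" by (simp add: frame_def)

lemma frame_trans: "frame X \<sigma> \<sigma>' \<Longrightarrow> frame Y \<sigma>' \<sigma>'' \<Longrightarrow> X \<subseteq> Z \<Longrightarrow> Y \<subseteq> Z \<Longrightarrow> frame Z \<sigma> \<sigma>''"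
  unfolding frame_def by (metis subsetD)

lemma frame_upd: "frame X \<sigma> \<sigma>' \<Longrightarrow> r \<in> X \<Longrightarrow> frame X \<sigma> (upd \<sigma>' r i v)"
  by (auto simp: frame_def upd_def)

lemma upd_same [simp]: "upd \<sigma> r i v r = (\<sigma> r)(i := v)"
  by (simp add: upd_def)

lemma upd_other [simp]: "r' \<noteq> r \<Longrightarrow> upd \<sigma> r i v r' = \<sigma> r'"
  by (simp add: upd_def)

lemma wp_time: "wp xs b c N Q \<sigma> w \<Longrightarrow> N \<le> N' \<Longrightarrow> wp xs b c N' Q \<sigma> w"
  by (rule wp_mono)

text \<open>In the rules for assignments the values are computed before they enter the new store, since
  otherwise the terms for successive stores would grow exponentially.\<close>

lemma (in machine_input) wp_Put_last:
  assumes "r < 32" "0 < N" "val i (layout xs \<sigma>) = i'" "val e (layout xs \<sigma>) = v"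
    and "Q (upd \<sigma> r i' v) w" "v < 2 ^ b"
  shows "wp xs b (Put r i e) N Q \<sigma> w"
  by (rule wp_time[OF wp_Put]) (use assms in auto)

lemma (in machine_input) wp_Put_Seq:
  assumes "r < 32" "0 < N" "val i (layout xs \<sigma>) = i'" "val e (layout xs \<sigma>) = v"
    and "wp xs b d (N - 1) Q (upd \<sigma> r i' v) w" "v < 2 ^ b"
  shows "wp xs b (Seq (Put r i e) d) N Q \<sigma> w"
proof -
  have "wp xs b (Seq (Put r i e) d) (1 + (N - 1)) Q \<sigma> w"
    by (intro wp_Seq wp_Put_last) (use assms in auto)
  then show ?thesis using assms(2) by simp
qed

section \<open>Seen edges, and binary numbers for the labellings of a cut\<close>

definition incident :: "nat list \<Rightarrow> nat \<Rightarrow> nat \<Rightarrow> nat \<Rightarrow> nat set" where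
  "incident xs n m i = {e. e < m \<and> xs ! (3 + i) \<in> {xs ! (4 + n + 2 * e), xs ! (5 + n + 2 * e)}}"

definition seen_count :: "(nat \<Rightarrow> nat set) \<Rightarrow> nat \<Rightarrow> nat \<Rightarrow> nat" where
  "seen_count I i e = card {v \<in> {1..i}. e \<in> I v}"

lemma seen_count_0: "seen_count I 0 e = 0"
  by (simp add: seen_count_def)

lemma seen_count_Suc: "seen_count I (Suc i) e = seen_count I i e + of_bool (e \<in> I (Suc i))"
proof -
  have "{v \<in> {1..Suc i}. e \<in> I v} = (if e \<in> I (Suc i) then insert (Suc i) else id) {v \<in> {1..i}. e \<in> I v}"
    by (auto simp: le_Suc_eq)
  then show ?thesis by (simp add: seen_count_def)
qed

lemma seen_count_mono: "i \<le> i' \<Longrightarrow> seen_count I i e \<le> seen_count I i' e"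
  unfolding seen_count_def by (intro card_mono) auto

text \<open>The number \<open>j\<close> of a labelling of the active edges \<open>A\<close> has the label of \<open>e \<in> A\<close> as its binary digit
  at \<open>position A e\<close>.\<close>

definition position :: "nat set \<Rightarrow> nat \<Rightarrow> nat" where
  "position A e = card (A \<inter> {..<e})"

definition labels :: "nat set \<Rightarrow> nat \<Rightarrow> nat set" where
  "labels A j = {e \<in> A. odd (j div 2 ^ position A e)}"

text \<open>Partial sums of \<open>set_encode\<close>. Table indices use the numbers of the edges
  and not their positions in the cut, because a table is written while scanning one cut and read
  while scanning the next; a set must have the same index in both.\<close>

definition code :: "nat set \<Rightarrow> nat \<Rightarrow> nat" where
  "code P e = (\<Sum>x<e. of_bool (x \<in> P) * 2 ^ x)"

lemma position_Suc: "position A (Suc e) = position A e + of_bool (e \<in> A)"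
  by (auto simp: position_def lessThan_Suc)

lemma position_0: "position A 0 = 0" by (simp add: position_def)

lemma position_le: "position A e \<le> e"
  unfolding position_def using card_mono[of "{..<e}" "A \<inter> {..<e}"] by simp

lemma position_all: "A \<subseteq> {..<e} \<Longrightarrow> position A e = card A"
  by (simp add: position_def Int_absorb2)

lemma code_0: "code P 0 = 0" by (simp add: code_def)

lemma code_Suc: "code P (Suc e) = code P e + of_bool (e \<in> P) * 2 ^ e"
  by (simp add: code_def)

lemma code_less: "code P e < 2 ^ e"
  by (induction e) (auto simp: code_0 code_Suc of_bool_def)

text \<open>This and the next three rules have the shape of the register values computed by one pass
  of the loop in \<open>label_prog\<close>, and rewrite them to the invariant for
  \<open>Suc e\<close>.\<close>

lemma code_step:
  "code (F - J) e + of_bool (e \<in> F) * 2 ^ e * (Suc 0 - of_bool (e \<in> J)) = code (F - J) (Suc e)"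
  by (simp add: code_Suc of_bool_def)

lemma position_step_1:
  "position (F \<inter> J) e + of_bool (e \<in> F) * of_bool (e \<in> J) = position (F \<inter> J) (Suc e)"
  by (simp add: position_Suc)

lemma position_step_0:
  "F \<subseteq> A \<Longrightarrow> position (A \<inter> J - F) e + (of_bool (e \<in> A) - of_bool (e \<in> F)) * of_bool (e \<in> J) =
     position (A \<inter> J - F) (Suc e)"
  by (auto simp add: position_Suc)

lemma rest_step:
  "j div 2 ^ position A e div Suc (of_bool (e \<in> A)) = j div 2 ^ position A (Suc e)"
  by (cases "e \<in> A") (simp_all add: position_Suc div_mult2_eq[symmetric] numeral_2_eq_2[symmetric] mult.commute)

lemma code_eq_set_encode:
  assumes "P \<subseteq> {..<e}" shows "code P e = set_encode P"
proof -
  have "code P e = (\<Sum>x<e. if x \<in> P then 2 ^ x else 0)"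
    unfolding code_def by (intro sum.cong) auto
  also have "\<dots> = (\<Sum>x\<in>{..<e} \<inter> P. 2 ^ x)"
    by (simp add: sum.inter_restrict)
  also have "{..<e} \<inter> P = P" using assms by blast
  finally show ?thesis by (simp add: set_encode_def)
qed

lemma bij_betw_position: "finite A \<Longrightarrow> bij_betw (position A) A {..<card A}"
proof -
  assume fin: "finite A"
  have "position A e < position A e'" if "e \<in> A" "e < e'" for e e'
    unfolding position_def using that by (intro psubset_card_mono) auto
  then have inj: "inj_on (position A) A"
    by (intro linorder_inj_onI') (metis less_irrefl)
  have "position A e < card A" if "e \<in> A" for e
    unfolding position_def using that fin by (intro psubset_card_mono) auto
  then have "position A ` A \<subseteq> {..<card A}" by blast
  moreover have "card (position A ` A) = card {..<card A}" using inj by (simp add: card_image)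
  ultimately have "position A ` A = {..<card A}" by (intro card_subset_eq) auto
  with inj show ?thesis by (simp add: bij_betw_def)
qed

text \<open>Every binary digit below \<open>card A\<close> is the label of some edge by
  \<open>bij_betw_position\<close>, and higher digits vanish, so the labelling determines the
  number. Surjectivity follows by counting.\<close>

lemma bij_betw_labels:
  assumes "finite A" shows "bij_betw (labels A) {..<2 ^ card A} (Pow A)"
proof -
  have "inj_on (labels A) {..<2 ^ card A}"
  proof (rule inj_onI)
    fix i j assume ij: "i \<in> {..<2 ^ card A}" "j \<in> {..<2 ^ card A}" "labels A i = labels A j"
    have "odd (i div 2 ^ p) = odd (j div 2 ^ p)" for p
    proof (cases "p < card A")
      case True
      then obtain e where "e \<in> A" "p = position A e"
        using bij_betw_position[OF assms] by (auto simp: bij_betw_def)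
      then show ?thesis using ij(3) by (auto simp: labels_def)
    next
      case False
      then have "(2::nat) ^ card A \<le> 2 ^ p" by (intro power_increasing) auto
      then have "i < 2 ^ p" "j < 2 ^ p" using ij(1,2) by (auto simp: less_le_trans)
      then show ?thesis by simp
    qed
    then have "set_decode i = set_decode j" by (simp add: set_decode_def)
    then show "i = j" by (metis set_decode_inverse)
  qed
  moreover have "labels A ` {..<2 ^ card A} \<subseteq> Pow A" by (auto simp: labels_def)
  moreover from calculation(1) have "card (labels A ` {..<2 ^ card A}) = card (Pow A)"
    using assms by (simp add: card_image card_Pow)
  ultimately show ?thesis
    using assms by (simp add: bij_betw_def card_subset_eq)
qed

definition hash_bits :: "nat \<Rightarrow> nat" where
  "hash_bits n = (LEAST h. 2 * n \<le> 2 ^ h)"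

lemma mult_add_cancel:
  fixes c d :: nat
  assumes "x < k" "y < k" shows "c * k + x = d * k + y \<longleftrightarrow> c = d \<and> x = y"
proof
  assume eq: "c * k + x = d * k + y"
  have "(c * k + x) mod k = x" "(d * k + y) mod k = y" using assms by simp_all
  moreover have "(c * k + x) div k = c" "(d * k + y) div k = d" using assms by simp_all
  ultimately show "c = d \<and> x = y" by (metis eq)
qed simp

text \<open>All assumptions are in terms of edge numbers and positions of vertices; graphs reappear
  only when instances are decoded. In \<open>b_large\<close> there is room for \<open>m\<close>
  labels and, per vertex, for a factor \<open>1 + 2 * z\<close>, where \<open>z\<close> is
  \<open>2 ^ (m + 2 * n + 1)\<close> to the power of the largest weight. Having \<open>n + 1\<close>
  in place of \<open>n\<close> also accommodates the loop bounds.\<close>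

locale cvc_input = machine_input +
  fixes k cw :: nat
  assumes m_pos: "0 < m" and input_k: "xs ! 1 = k"
    and endpoints: "\<And>e. e < m \<Longrightarrow> xs ! (4 + n + 2 * e) \<noteq> xs ! (5 + n + 2 * e)"
    and both_seen: "\<And>e. e < m \<Longrightarrow> seen_count (incident xs n m) n e = 2"
    and cut_le: "\<And>i. i \<le> n \<Longrightarrow> card {e. e < m \<and> seen_count (incident xs n m) i e = 1} \<le> cw"
    and b_large: "m + (n + 1) *
      ((m + 2 * n + 1) * (n * 2 ^ hash_bits n + 2 ^ hash_bits n) + 2) < b"
begin

abbreviation "inc \<equiv> incident xs n m"

definition act :: "nat \<Rightarrow> nat set" where
  "act i = {e. e < m \<and> seen_count inc i e = 1}"

lemma layout_header: "layout xs \<sigma> 1 = k" "layout xs \<sigma> (Suc 0) = k"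
    "layout xs \<sigma> 2 = n" "layout xs \<sigma> 3 = m"
  by (simp_all add: layout_def length_input input_k[simplified] input_n input_m)

lemma val_inc_expr:
  assumes "val i (layout xs \<sigma>) \<le> Suc n" "val e (layout xs \<sigma>) < m"
  shows "val (inc_expr i e) (layout xs \<sigma>) = of_bool (val e (layout xs \<sigma>) \<in> inc (val i (layout xs \<sigma>)))"
proof -
  let ?i = "val i (layout xs \<sigma>)" and ?e = "val e (layout xs \<sigma>)"
  \<comment> \<open>For \<open>?i = 0\<close> and \<open>?i = Suc n\<close> the cell
    \<open>3 + ?i\<close> holds no vertex: it is a header cell or the first endpoint, which lies
    inside the input as \<open>0 < m\<close>. What is read there is harmless since the cuts at 0 and
    \<open>n\<close> are empty.\<close>
  have "layout xs \<sigma> (3 + ?i) = xs ! (3 + ?i)" "layout xs \<sigma> (4 + n + 2 * ?e) = xs ! (4 + n + 2 * ?e)"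
    "layout xs \<sigma> (5 + n + 2 * ?e) = xs ! (5 + n + 2 * ?e)"
    using assms length_input m_pos by (auto simp: layout_def)
  then show ?thesis
    using assms(2) endpoints[OF assms(2)]
    by (simp add: inc_expr_def val_Eq layout_header incident_def)
qed

lemma less_power_b: "x \<le> 2 ^ y \<Longrightarrow> y < b \<Longrightarrow> x < 2 ^ b" for x :: nat
  by (meson le_less_trans one_less_numeral_iff power_strict_increasing semiring_norm(76))

lemma m_less_b: "m < b" using b_large by linarith

lemma one_less_b: "1 < b"
proof -
  have "2 \<le> (n + 1) * ((m + 2 * n + 1) * (n * 2 ^ hash_bits n + 2 ^ hash_bits n) + 2)" by simp
  then show ?thesis using b_large by linarith
qed

lemma small_less: "x \<le> 2 \<Longrightarrow> x < 2 ^ b" for x :: nat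
  by (rule less_power_b[of _ 1]) (use one_less_b in auto)

lemma le_m_less: "x \<le> m \<Longrightarrow> x < 2 ^ b"
  by (rule less_power_b[of _ m]) (use m_less_b in \<open>auto intro: less_imp_le le_less_trans[OF _ less_exp]\<close>)

lemma le_power_m_less: "x \<le> 2 ^ m \<Longrightarrow> x < 2 ^ b" for x :: nat
  by (rule less_power_b[of _ m]) (use m_less_b in auto)

lemma one_less: "Suc 0 < 2 ^ b"
  using small_less[of 1] by simp

lemma of_bool_less: "of_bool P < (2::nat) ^ b"
  by (rule small_less) simp

lemmas val_simps = val_Get val_Eq val_Less layout_header val_inc_expr

definition label_regs :: "nat set" where
  "label_regs = {rE, rRest, rBit, rIn, rOut, rX0, rX1, rY0, rY1, rAct, rLab, rInc, rInc'}"

lemma minus_twice_half: "x - 2 * (x div 2) = of_bool (odd x)" for x :: nat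
  by (simp add: minus_mult_div_eq_mod mod_2_eq_odd)

text \<open>\<open>rRest\<close> loses one binary digit per active edge, which therefore is the
  label of that edge. The 14 steps per edge are 12 assignments and the loop overhead of 2.\<close>

lemma wp_label:
  assumes i: "\<sigma> rI 0 = i" "i \<le> n" and j: "\<sigma> rJ 0 = j"
    and seen: "\<And>e. e < m \<Longrightarrow> \<sigma> rSeen e = seen_count inc i e"
    and j_less: "j < 2 ^ m"
  defines "A \<equiv> act i"
  defines "F \<equiv> labels A j"
  shows "wp xs b label_prog (14 * m + 20) (\<lambda>\<sigma>' w'. w' = w \<and> frame label_regs \<sigma> \<sigma>' \<and>
     \<sigma>' rIn 0 = set_encode (F - inc i) \<and> \<sigma>' rOut 0 = set_encode (F - inc (Suc i)) \<and>
     Suc 0 - \<sigma>' rX1 0 = of_bool (fits_state A (inc i) 1 F) \<and>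
     Suc 0 - \<sigma>' rX0 0 = of_bool (fits_state A (inc i) 2 F) \<and>
     Suc 0 - \<sigma>' rY1 0 = of_bool (fits_state A (inc (Suc i)) 1 F) \<and>
     Suc 0 - \<sigma>' rY0 0 = of_bool (fits_state A (inc (Suc i)) 2 F)) \<sigma> w"
proof -
  have A: "A \<subseteq> {..<m}" by (auto simp: A_def act_def)
  have F: "F \<subseteq> A" by (auto simp: F_def labels_def)
  have sub: "P \<subseteq> {..<m}" if "P \<subseteq> A" for P using that A by blast
  have position_zero: "Suc 0 - position P m = of_bool (P = {})" if "P \<subseteq> A" for P
  proof -
    have "finite P" using sub[OF that] finite_subset by blast
    then show ?thesis unfolding position_all[OF sub[OF that]] by (auto simp: card_gt_0_iff Suc_leI)
  qed
  define Inv where "Inv e \<sigma>' w' \<longleftrightarrow> w' = w \<and> frame label_regs \<sigma> \<sigma>' \<and>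
     \<sigma>' rRest 0 = j div 2 ^ position A e \<and> \<sigma>' rBit 0 = 2 ^ e \<and>
     \<sigma>' rIn 0 = code (F - inc i) e \<and> \<sigma>' rOut 0 = code (F - inc (Suc i)) e \<and>
     \<sigma>' rX0 0 = position (A \<inter> inc i - F) e \<and> \<sigma>' rX1 0 = position (F \<inter> inc i) e \<and>
     \<sigma>' rY0 0 = position (A \<inter> inc (Suc i) - F) e \<and> \<sigma>' rY1 0 = position (F \<inter> inc (Suc i)) e"
     for e \<sigma>' w'
  show ?thesis
    unfolding label_prog_def Seqs.simps
    apply (rule wp_Put_Seq, simp, simp, simp add: val_simps, simp add: val_simps j)+
    apply (rule wp_time, rule wp_For[where I = Inv and M = m and N = 12])
    apply (auto simp: le_m_less)[2]
  proof (goal_cases)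
    case 1
    show ?case using i j by (simp add: Inv_def frame_upd frame_refl label_regs_def val_simps position_0 code_0)
  next
    case (2 e \<sigma>' w')
    have fr: "frame label_regs \<sigma> \<sigma>'" and e: "e < m" "\<sigma>' rE 0 = e" using 2 by (auto simp: Inv_def)
    have st: "\<sigma>' rI 0 = i" "\<sigma>' rSeen e = seen_count inc i e"
      using frameD[OF fr, of rI] frameD[OF fr, of rSeen] i seen[OF e(1)]
      by (auto simp: label_regs_def)
    have act: "seen_count inc i e = Suc 0 \<longleftrightarrow> e \<in> A" using e by (simp add: A_def act_def)
    have lab: "e \<in> F \<longleftrightarrow> e \<in> A \<and> odd (j div 2 ^ position A e)" by (auto simp: F_def labels_def)
    have inv: "w' = w" "\<sigma>' rRest 0 = j div 2 ^ position A e" "\<sigma>' rBit 0 = 2 ^ e"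
      "\<sigma>' rIn 0 = code (F - inc i) e" "\<sigma>' rOut 0 = code (F - inc (Suc i)) e"
      "\<sigma>' rX0 0 = position (A \<inter> inc i - F) e" "\<sigma>' rX1 0 = position (F \<inter> inc i) e"
      "\<sigma>' rY0 0 = position (A \<inter> inc (Suc i) - F) e" "\<sigma>' rY1 0 = position (F \<inter> inc (Suc i)) e"
      using 2 by (auto simp: Inv_def)
    have i': "i \<le> Suc n" using i(2) by simp
    have lab': "of_bool (e \<in> A) * of_bool (odd (j div 2 ^ position A e)) = (of_bool (e \<in> F) :: nat)"
      by (simp add: lab of_bool_conj)
    note steps = code_step position_step_1 position_step_0[OF F] rest_step
    have less: "2 * 2 ^ e < (2::nat) ^ b" "code P (Suc e) < 2 ^ b" "position P (Suc e) < 2 ^ b"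
      "j div 2 ^ x < 2 ^ b" for P x
    proof -
      have le: "(2::nat) ^ Suc e \<le> 2 ^ m" using e(1) by (intro power_increasing) auto
      then show "2 * 2 ^ e < (2::nat) ^ b" by (intro le_power_m_less) simp
      show "code P (Suc e) < 2 ^ b"
        using code_less[of P "Suc e"] le by (intro le_power_m_less) linarith
      show "position P (Suc e) < 2 ^ b"
        using position_le[of P "Suc e"] e(1) by (intro le_m_less) linarith
      show "j div 2 ^ x < 2 ^ b"
        using div_le_dividend[of j "2 ^ x"] j_less by (intro le_power_m_less) linarith
    qed
    show ?case unfolding Seqs.simps
      apply (((rule wp_Put_Seq | rule wp_Put_last), simp, simp, simp add: val_simps,
          simp add: val_simps st e inv i i' minus_twice_half act lab' steps)+)[1]
      apply (simp only: Inv_def)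
      apply (intro conjI frame_upd fr)
      apply (simp_all only: less of_bool_less)
      apply (simp_all add: label_regs_def e inv)
      done
  next
    case (3 e \<sigma>' w')
    then show ?case by (simp add: layout_header)
  next
    case (4 \<sigma>' w')
    have "code (F - inc i) m = set_encode (F - inc i)"
      "code (F - inc (Suc i)) m = set_encode (F - inc (Suc i))"
      by (rule code_eq_set_encode, rule sub, use F in blast)+
    moreover have "fits_state A J 1 F \<longleftrightarrow> F \<inter> J = {}" "fits_state A J 2 F \<longleftrightarrow> A \<inter> J - F = {}" for J
      by (auto simp: fits_state_def)
    moreover have "Suc 0 - position (F \<inter> J) m = of_bool (F \<inter> J = {})"
      "Suc 0 - position (A \<inter> J - F) m = of_bool (A \<inter> J - F = {})" for J
      by (rule position_zero, use F in blast)+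
    ultimately show ?case using 4(2) by (simp only: Inv_def simp_thms)
  qed (use j j_less i in \<open>auto simp: val_simps small_less le_power_m_less less_imp_le\<close>)
qed

lemma wp_message:
  assumes i: "\<sigma> rI 0 = i"
    and x: "Suc 0 - \<sigma> rX1 0 = of_bool f1" "Suc 0 - \<sigma> rX0 0 = of_bool f2"
    and y: "Suc 0 - \<sigma> rY1 0 = of_bool g1" "Suc 0 - \<sigma> rY0 0 = of_bool g2"
    and p: "p = \<sigma> rIn 0 * (n + 2) + i" and q: "q = \<sigma> rOut 0 * (n + 2) + Suc i"
    and v: "v = \<sigma> (rU 0) p + \<sigma> rZ i * (of_bool f1 * \<sigma> (rU 1) p + of_bool f2 * \<sigma> (rU 2) p)"
    and less: "v < 2 ^ b" "\<sigma> (rU 0) q + v < 2 ^ b" "\<sigma> (rU 1) q + of_bool g1 * v < 2 ^ b"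
      "\<sigma> (rU 2) q + of_bool g2 * v < 2 ^ b"
    and Q: "Q (upd (upd (upd (upd \<sigma> rVal 0 v) (rU 0) q (\<sigma> (rU 0) q + v))
      (rU 1) q (\<sigma> (rU 1) q + of_bool g1 * v)) (rU 2) q (\<sigma> (rU 2) q + of_bool g2 * v)) w"
  shows "wp xs b message_prog 4 Q \<sigma> w"
proof -
  have val_tables: "val (table (Reg rIn) (Reg rI)) (layout xs \<sigma>') = p"
    "val (table (Reg rOut) (Add (Reg rI) (Const (Suc 0)))) (layout xs \<sigma>') = q"
    if "\<sigma>' rI = \<sigma> rI" "\<sigma>' rIn = \<sigma> rIn" "\<sigma>' rOut = \<sigma> rOut" for \<sigma>'
    using that by (simp_all add: table_def val_simps i p q)
  show ?thesis
    unfolding message_prog_def Let_def Seqs.simps One_nat_def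
    apply (rule wp_Put_Seq[where v = v], simp, simp, simp)
      apply (simp add: val_simps val_tables i x v)
    apply (rule wp_Put_Seq[where v = "\<sigma> (rU 0) q + v"], simp, simp, simp add: val_tables)
      apply (simp add: val_simps val_tables)
    apply (rule wp_Put_Seq[where v = "\<sigma> (rU 1) q + of_bool g1 * v"], simp, simp, simp add: val_tables)
      apply (simp add: val_simps val_tables y)
    apply (rule wp_Put_last[where v = "\<sigma> (rU 2) q + of_bool g2 * v"], simp, simp, simp add: val_tables)
      apply (simp add: val_simps val_tables y)
    using Q less by simp_all
qed

lemma wp_size:
  assumes "\<And>e. e < m \<Longrightarrow> \<sigma> rSeen e = seen_count inc i e"
  shows "wp xs b size_prog (3 * m + 3)
    (\<lambda>\<sigma>' w'. w' = w \<and> frame {rE, rSize} \<sigma> \<sigma>' \<and> \<sigma>' rSize 0 = 2 ^ card (act i)) \<sigma> w"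
proof -
  define Inv where "Inv e \<sigma>' w' \<longleftrightarrow> w' = w \<and> frame {rE, rSize} \<sigma> \<sigma>' \<and> \<sigma>' rSize 0 = 2 ^ position (act i) e"
    for e \<sigma>' w'
  have pos_m: "position (act i) m = card (act i)" by (rule position_all) (auto simp: act_def)
  show ?thesis
    unfolding size_prog_def
  proof (rule wp_Put_Seq, simp, simp, simp, simp, rule wp_time,
      rule wp_For[where I = Inv and M = m and N = 1], goal_cases)
    case 3
    show ?case by (simp add: Inv_def frame_upd frame_refl position_0)
  next
    case (4 e \<sigma>' w')
    then have st: "\<sigma>' rSeen e = seen_count inc i e" "\<sigma>' rSize 0 = 2 ^ position (act i) e"
      using assms by (auto simp: Inv_def frame_def)
    have act_iff: "seen_count inc i e = Suc 0 \<longleftrightarrow> e \<in> act i" using 4(1) by (simp add: act_def)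
    have "(2::nat) ^ position (act i) (Suc e) \<le> 2 ^ m"
      using position_le[of "act i" "Suc e"] 4(1) by (intro power_increasing) auto
    then have less: "(2::nat) ^ position (act i) (Suc e) < 2 ^ b" by (rule le_power_m_less)
    show ?case
      by (rule wp_Put_last[where v = "2 ^ position (act i) (Suc e)"])
        (use 4 less in \<open>cases "e \<in> act i";
          simp add: val_simps st act_iff position_Suc Inv_def frame_upd\<close>)+
  next
    case (6 \<sigma>' w')
    then show ?case by (simp add: Inv_def pos_m)
  qed (auto simp: le_m_less layout_header one_less)
qed

lemma n_less_b: "n + 1 < b"
proof -
  have "(n + 1) * 1 \<le> (n + 1) * ((m + 2 * n + 1) * (n * 2 ^ hash_bits n + 2 ^ hash_bits n) + 2)"
    by (intro mult_le_mono2) simp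
  from le_trans[OF this le_add2] have "(n + 1) * 1 < b" by (rule le_less_trans) (rule b_large)
  then show ?thesis by simp
qed

lemma le_n_less: "x \<le> n + 1 \<Longrightarrow> x < 2 ^ b"
  using less_exp[of "n + 1"] n_less_b by (intro less_power_b[of _ "n + 1"]) linarith+

lemma seen_count_le: "seen_count I i e \<le> i"
proof -
  have "{v \<in> {1..i}. e \<in> I v} \<subseteq> {1..i}" by blast
  from card_mono[OF _ this] show ?thesis by (simp add: seen_count_def)
qed

lemma wp_seen:
  assumes seen: "\<And>e. e < m \<Longrightarrow> \<sigma> rSeen e = seen_count inc i e" and i: "\<sigma> rI 0 = i" "i \<le> n"
  shows "wp xs b seen_prog (3 * m + 2) (\<lambda>\<sigma>' w'. w' = w \<and> frame {rE, rSeen} \<sigma> \<sigma>' \<and>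
    (\<forall>e<m. \<sigma>' rSeen e = seen_count inc (Suc i) e)) \<sigma> w"
proof -
  define Inv where "Inv e \<sigma>' w' \<longleftrightarrow> w' = w \<and> frame {rE, rSeen} \<sigma> \<sigma>' \<and>
    (\<forall>x<m. \<sigma>' rSeen x = seen_count inc (if x < e then Suc i else i) x)" for e \<sigma>' w'
  show ?thesis
    unfolding seen_prog_def
  proof (rule wp_time, rule wp_For[where I = Inv and M = m and N = 1], goal_cases)
    case 3
    show ?case by (simp add: Inv_def frame_upd frame_refl seen)
  next
    case (4 e \<sigma>' w')
    then have st: "\<sigma>' rSeen e = seen_count inc i e" "\<sigma>' rI 0 = i"
      using i by (auto simp: Inv_def frame_def)
    have less: "seen_count inc (Suc i) e < 2 ^ b"
      using seen_count_le[of inc "Suc i" e] i(2) by (intro le_n_less) simp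
    show ?case
      by (rule wp_Put_last[where v = "seen_count inc (Suc i) e"])
        (use 4 less i in \<open>auto simp: val_simps st seen_count_Suc Inv_def intro!: frame_upd\<close>)
  next
    case (6 \<sigma>' w')
    then show ?case by (simp add: Inv_def)
  qed (auto simp: le_m_less layout_header)
qed

lemma seen_iff: "e \<in> \<Union> (inc ` {1..i}) \<longleftrightarrow> 0 < seen_count inc i e"
  unfolding seen_count_def by (auto simp: card_gt_0_iff)

lemma inc_less: "e \<in> inc i \<Longrightarrow> e < m"
  by (simp add: incident_def)

text \<open>An edge is active while its seen count is 1. The count ends at 2 and never falls, so an
  end met on an already seen edge must be its second, and the edge was active just before.\<close>

sublocale sweep act inc z n for z
proof
  show "finite (inc i)" for i by (rule finite_subset[of _ "{..<m}"]) (auto dest: inc_less)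
  show "act 0 = {}" by (simp add: act_def seen_count_0)
  fix i assume i: "i < n"
  have le: "seen_count inc (Suc i) e \<le> 2" if "e < m" for e
    using seen_count_mono[of "Suc i" n inc e] both_seen[OF that] i by simp
  define U where "U = \<Union> (inc ` {1..i})"
  have U: "e \<in> U \<longleftrightarrow> 0 < seen_count inc i e" for e unfolding U_def by (rule seen_iff)
  have "e \<in> act (Suc i) \<longleftrightarrow> e \<in> act i - inc (Suc i) \<union> (inc (Suc i) - U)" for e
    by (cases "e \<in> inc (Suc i)") (auto simp: act_def seen_count_Suc U dest: inc_less)
  then show "act (Suc i) = act i - inc (Suc i) \<union> (inc (Suc i) - \<Union> (inc ` {1..i}))"
    unfolding U_def by blast
  show "inc (Suc i) \<inter> \<Union> (inc ` {1..i}) \<subseteq> act i"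
  proof
    fix e assume e: "e \<in> inc (Suc i) \<inter> \<Union> (inc ` {1..i})"
    then have "e < m" "0 < seen_count inc i e" using seen_iff[of e i] by (auto dest: inc_less)
    moreover have "Suc (seen_count inc i e) \<le> 2"
      using le[of e] e \<open>e < m\<close> by (simp add: seen_count_Suc)
    ultimately show "e \<in> act i" by (simp add: act_def)
  qed
qed

lemma act_n: "act n = {}"
  using both_seen by (auto simp: act_def)

lemma seen_n: "seen n = {..<m}"
proof -
  have "e \<in> seen n \<longleftrightarrow> e < m" for e
    unfolding seen_def using both_seen[of e] seen_iff[of e n]
    by (metis UN_E inc_less zero_less_numeral)
  then show ?thesis by auto
qed

section \<open>Word length and the tables of messages\<close>

definition max_weight :: nat where
  "max_weight = n * 2 ^ hash_bits n + 2 ^ hash_bits n"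

definition base_bits :: nat where
  "base_bits = m + 2 * n + 1"

lemma b_large': "m + (n + 1) * (base_bits * max_weight + 2) < b"
  using b_large by (simp add: max_weight_def base_bits_def)

text \<open>The exponent of the bound in \<open>sum_join_le\<close>; the summand 2 absorbs the
  estimate of \<open>1 + 2 * z v\<close> by 4 times the largest power.\<close>

definition bits_bound :: "nat" where
  "bits_bound = m + n * (base_bits * max_weight + 2)"

lemma le_bound_less: "x \<le> 2 ^ bits_bound \<Longrightarrow> x < 2 ^ b" for x :: nat
proof (rule less_power_b)
  have "n * (base_bits * max_weight + 2) \<le> (n + 1) * (base_bits * max_weight + 2)"
    by (intro mult_le_mono1) simp
  from le_less_trans[OF add_left_mono[OF this] b_large'] show "bits_bound < b"
    by (simp only: bits_bound_def)
qed

definition sweep_regs :: "nat set" where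
  "sweep_regs = label_regs \<union> {rJ, rVal, rU 0, rU 1, rU 2}"

definition outer_regs :: "nat set" where
  "outer_regs = sweep_regs \<union> {rI, rE, rSize, rSeen}"

context
  fixes z :: "nat \<Rightarrow> nat"
  assumes z_le: "\<And>v. v \<in> {1..n} \<Longrightarrow> z v \<le> 2 ^ (base_bits * max_weight)"
begin

definition vertex_sum :: "nat \<Rightarrow> nat set \<Rightarrow> nat" where
  "vertex_sum i F = join (msg act inc z i) (act i) (inc i) (z i) F"

lemma sum_vertex_sum_le:
  assumes "i \<le> n" shows "(\<Sum>F\<in>Pow (act i). vertex_sum i F) \<le> 2 ^ bits_bound"
proof -
  have "1 + 2 * z v \<le> 2 ^ (base_bits * max_weight + 2)" if "v \<in> {1..n}" for v
  proof -
    have "1 + 2 * z v \<le> 4 * 2 ^ (base_bits * max_weight)"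
      using z_le[OF that] one_le_power[of "2::nat" "base_bits * max_weight"] by linarith
    then show ?thesis by (simp add: power_add)
  qed
  from sum_join_le[of i "2 ^ (base_bits * max_weight + 2)" z, OF assms _ this]
  have "(\<Sum>F\<in>Pow (act i). vertex_sum i F) \<le> 2 ^ m * (2 ^ (base_bits * max_weight + 2)) ^ n"
    by (simp add: vertex_sum_def seen_n)
  also have "\<dots> = 2 ^ bits_bound"
    unfolding bits_bound_def mult.commute[of n] power_mult[symmetric] power_add[symmetric] ..
  finally show ?thesis .
qed

lemma finite_act: "finite (act i)"
  by (rule finite_subset[of _ "{..<m}"]) (auto simp: act_def)

definition partial_msg :: "nat \<Rightarrow> nat \<Rightarrow> nat \<Rightarrow> nat set \<Rightarrow> nat" where
  "partial_msg i j s G = (\<Sum>j'<j. of_bool (labels (act i) j' - inc (Suc i) = G \<and>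
     fits_state (act i) (inc (Suc i)) s (labels (act i) j')) * vertex_sum i (labels (act i) j'))"

lemma partial_msg_all: "partial_msg i (2 ^ card (act i)) s G = msg act inc z (Suc i) s G"
  unfolding partial_msg_def msg.simps vertex_sum_def
  by (rule sum.reindex_bij_betw[OF bij_betw_labels[OF finite_act]])

lemma partial_msg_le:
  assumes "i \<le> n" "j \<le> 2 ^ card (act i)"
  shows "partial_msg i j s G \<le> 2 ^ bits_bound"
proof -
  have "partial_msg i j s G \<le> (\<Sum>j'<j. vertex_sum i (labels (act i) j'))"
    unfolding partial_msg_def by (intro sum_mono) simp
  also have "\<dots> \<le> (\<Sum>j'<2 ^ card (act i). vertex_sum i (labels (act i) j'))"
    using assms(2) by (intro sum_mono2) auto
  also have "\<dots> = (\<Sum>F\<in>Pow (act i). vertex_sum i F)"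
    by (rule sum.reindex_bij_betw[OF bij_betw_labels[OF finite_act]])
  also have "\<dots> \<le> 2 ^ bits_bound" by (rule sum_vertex_sum_le[OF assms(1)])
  finally show ?thesis .
qed

lemma vertex_sum_le:
  assumes "i \<le> n" "F \<subseteq> act i" shows "vertex_sum i F \<le> 2 ^ bits_bound"
proof -
  have "vertex_sum i F \<le> (\<Sum>F\<in>Pow (act i). vertex_sum i F)"
    using assms finite_act by (intro member_le_sum) auto
  then show ?thesis using sum_vertex_sum_le[OF assms(1)] by simp
qed

text \<open>Slice \<open>i\<close> is read and slice \<open>Suc i\<close> is being accumulated.
  Later slices must be known to be 0, since sums will start from them without any clearing; earlier
  ones are dropped in \<open>tables\<close>.\<close>

definition table_value :: "nat \<Rightarrow> nat \<Rightarrow> nat \<Rightarrow> nat \<Rightarrow> nat set \<Rightarrow> nat" where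
  "table_value i j i' s G = (if i' = i then msg act inc z i s G
     else if i' = Suc i then partial_msg i j s G else 0)"

definition tables :: "nat \<Rightarrow> nat \<Rightarrow> store \<Rightarrow> bool" where
  "tables i j \<sigma> \<longleftrightarrow> (\<forall>s<3. \<forall>i'\<in>{i..Suc n}. \<forall>c.
     \<sigma> (rU s) (c * (n + 2) + i') = table_value i j i' s (set_decode c))"

lemma tablesD: "tables i j \<sigma> \<Longrightarrow> s < 3 \<Longrightarrow> i \<le> i' \<Longrightarrow> i' \<le> Suc n \<Longrightarrow>
    \<sigma> (rU s) (c * (n + 2) + i') = table_value i j i' s (set_decode c)"
  by (simp add: tables_def)

lemma tables_upd: "r < 28 \<Longrightarrow> tables i j (upd \<sigma> r x v) \<longleftrightarrow> tables i j \<sigma>"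
  by (simp add: tables_def)

text \<open>A labelling contributes to the single set \<open>?F - ?J\<close>, hence changes one cell
  in each of the three arrays; all other sums gain no term.\<close>

lemma wp_sweep_step:
  assumes i: "\<sigma> rI 0 = i" "i \<le> n" and j: "\<sigma> rJ 0 = j" "j < 2 ^ card (act i)"
    and seen: "\<And>e. e < m \<Longrightarrow> \<sigma> rSeen e = seen_count inc i e"
    and z: "\<sigma> rZ i = z i" and tables: "tables i j \<sigma>"
  shows "wp xs b (Seq label_prog message_prog) (14 * m + 24) (\<lambda>\<sigma>' w'. w' = w \<and>
    frame (sweep_regs - {rJ}) \<sigma> \<sigma>' \<and> tables i (Suc j) \<sigma>') \<sigma> w"
proof -
  let ?F = "labels (act i) j" and ?J = "inc (Suc i)"
  have F: "?F \<subseteq> act i" by (auto simp: labels_def)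
  then have finF: "finite (?F - P)" for P using finite_act finite_subset by blast
  have "card (act i) \<le> m" using card_mono[of "{..<m}" "act i"] by (auto simp: act_def)
  then have j_less: "j < 2 ^ m" using j(2) by (meson less_le_trans one_le_numeral power_increasing)
  let ?Q = "\<lambda>\<sigma>' w'. w' = w \<and> frame (sweep_regs - {rJ}) \<sigma> \<sigma>' \<and> tables i (Suc j) \<sigma>'"
  have "wp xs b message_prog 4 ?Q \<sigma>1 w"
    if fr: "frame label_regs \<sigma> \<sigma>1"
      and inp: "\<sigma>1 rIn 0 = set_encode (?F - inc i)" and out: "\<sigma>1 rOut 0 = set_encode (?F - ?J)"
      and flags: "Suc 0 - \<sigma>1 rX1 0 = of_bool (fits_state (act i) (inc i) 1 ?F)"
        "Suc 0 - \<sigma>1 rX0 0 = of_bool (fits_state (act i) (inc i) 2 ?F)"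
        "Suc 0 - \<sigma>1 rY1 0 = of_bool (fits_state (act i) ?J 1 ?F)"
        "Suc 0 - \<sigma>1 rY0 0 = of_bool (fits_state (act i) ?J 2 ?F)" for \<sigma>1
  proof -
    have same: "\<sigma>1 rI = \<sigma> rI" "\<sigma>1 rZ = \<sigma> rZ" "\<sigma>1 (rU s) = \<sigma> (rU s)" for s
      using fr by (auto simp: frame_def label_regs_def)
    have fr': "frame (sweep_regs - {rJ}) \<sigma> \<sigma>1"
      using fr by (auto simp: frame_def sweep_regs_def label_regs_def)
    define p where "p = \<sigma>1 rIn 0 * (n + 2) + i"
    define q where "q = \<sigma>1 rOut 0 * (n + 2) + Suc i"
    define v where "v = vertex_sum i ?F"
    have tab_p: "\<sigma>1 (rU s) p = msg act inc z i s (?F - inc i)" if "s < 3" for s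
      using tablesD[OF tables that le_refl, of "\<sigma>1 rIn 0"] i(2)
      by (simp add: p_def same table_value_def inp finF)
    have tab_q: "\<sigma>1 (rU s) q = partial_msg i j s (?F - ?J)" if "s < 3" for s
      using tablesD[OF tables that, of "Suc i" "\<sigma>1 rOut 0"] i(2)
      by (simp add: q_def same table_value_def out finF)
    have step: "partial_msg i j s (?F - ?J) + of_bool (fits_state (act i) ?J s ?F) * v =
        partial_msg i (Suc j) s (?F - ?J)" for s
      by (simp add: partial_msg_def v_def)
    have less: "partial_msg i (Suc j) s (?F - ?J) < 2 ^ b" for s
      using partial_msg_le[OF i(2), of "Suc j"] j(2) by (intro le_bound_less) simp
    \<comment> \<open>Slice numbers stay below \<open>n + 2\<close>, so an address determines both
      the slice and the code of the set.\<close>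
    have index: "c * (n + 2) + i' = q \<longleftrightarrow> i' = Suc i \<and> set_decode c = ?F - ?J"
      if "i' \<le> Suc n" for c i'
    proof -
      have "c * (n + 2) + i' = q \<longleftrightarrow> c = \<sigma>1 rOut 0 \<and> i' = Suc i"
        unfolding q_def using that i(2) by (intro mult_add_cancel) auto
      moreover have "c = \<sigma>1 rOut 0 \<longleftrightarrow> set_decode c = ?F - ?J"
        using finF by (metis out set_decode_inverse set_encode_inverse)
      ultimately show ?thesis by blast
    qed
    have other: "partial_msg i (Suc j) s G = partial_msg i j s G" if "G \<noteq> ?F - ?J" for s G
      using that by (auto simp: partial_msg_def)
    let ?\<sigma> = "upd (upd (upd (upd \<sigma>1 rVal 0 v) (rU 0) q (partial_msg i (Suc j) 0 (?F - ?J)))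
        (rU 1) q (partial_msg i (Suc j) 1 (?F - ?J))) (rU 2) q (partial_msg i (Suc j) 2 (?F - ?J))"
    have new: "tables i (Suc j) ?\<sigma>"
      unfolding tables_def
    proof (intro allI impI ballI)
      fix s i' c assume s: "s < (3::nat)" and i': "i' \<in> {i..Suc n}"
      let ?x = "c * (n + 2) + i'"
      have "?\<sigma> (rU s) = (\<sigma> (rU s))(q := partial_msg i (Suc j) s (?F - ?J))"
      proof -
        consider "s = 0" | "s = 1" | "s = 2" using s by linarith
        then show ?thesis using same(3)[of 0] same(3)[of 1] same(3)[of 2] by cases auto
      qed
      then have "?\<sigma> (rU s) ?x = (if ?x = q then partial_msg i (Suc j) s (?F - ?J)
          else table_value i j i' s (set_decode c))"
        using tablesD[OF tables s, of i' c] i' by simp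
      also have "\<dots> = table_value i (Suc j) i' s (set_decode c)"
        using index[of i' c] i' other by (auto simp: table_value_def)
      finally show "?\<sigma> (rU s) ?x = table_value i (Suc j) i' s (set_decode c)" .
    qed
    have f0: "fits_state (act i) ?J 0 ?F" by (simp add: fits_state_def)
    show ?thesis
    proof (rule wp_message[where \<sigma> = \<sigma>1 and p = p and q = q and v = v and i = i, OF _ flags p_def q_def])
      show "v = \<sigma>1 (rU 0) p + \<sigma>1 rZ i * (of_bool (fits_state (act i) (inc i) 1 ?F) * \<sigma>1 (rU 1) p +
          of_bool (fits_state (act i) (inc i) 2 ?F) * \<sigma>1 (rU 2) p)"
        using tab_p[of 0] tab_p[of 1] tab_p[of 2] by (simp add: v_def vertex_sum_def join_def same z)
      show "v < 2 ^ b" unfolding v_def by (rule le_bound_less) (rule vertex_sum_le[OF i(2) F])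
      show "\<sigma>1 (rU 0) q + v < 2 ^ b" using less[of 0] step[of 0] tab_q[of 0] f0 by simp
      show "\<sigma>1 (rU 1) q + of_bool (fits_state (act i) ?J 1 ?F) * v < 2 ^ b"
        using less[of 1] step[of 1] tab_q[of 1] by simp
      show "\<sigma>1 (rU 2) q + of_bool (fits_state (act i) ?J 2 ?F) * v < 2 ^ b"
        using less[of 2] step[of 2] tab_q[of 2] by simp
      have eqs: "\<sigma>1 (rU 0) q + v = partial_msg i (Suc j) 0 (?F - ?J)"
        "\<sigma>1 (rU 1) q + of_bool (fits_state (act i) ?J 1 ?F) * v = partial_msg i (Suc j) 1 (?F - ?J)"
        "\<sigma>1 (rU 2) q + of_bool (fits_state (act i) ?J 2 ?F) * v = partial_msg i (Suc j) 2 (?F - ?J)"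
        using step[of 0] step[of 1] step[of 2] tab_q[of 0] tab_q[of 1] tab_q[of 2] f0 by auto
      have "frame (sweep_regs - {rJ}) \<sigma> ?\<sigma>"
        by (intro frame_upd fr') (auto simp: sweep_regs_def)
      with new show "?Q (upd (upd (upd (upd \<sigma>1 rVal 0 v) (rU 0) q (\<sigma>1 (rU 0) q + v))
          (rU 1) q (\<sigma>1 (rU 1) q + of_bool (fits_state (act i) ?J 1 ?F) * v))
          (rU 2) q (\<sigma>1 (rU 2) q + of_bool (fits_state (act i) ?J 2 ?F) * v)) w"
        unfolding eqs by simp
    qed (use same i in simp)
  qed
  then have "wp xs b (Seq label_prog message_prog) ((14 * m + 20) + 4) ?Q \<sigma> w"
    by (intro wp_Seq wp_mono[OF wp_label[OF i j(1) seen j_less]]) auto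
  then show ?thesis by (rule wp_time) simp
qed

text \<open>This is the only loop with exponentially many passes, and \<open>cut_le\<close> limits
  them to \<open>2 ^ cw\<close>.\<close>

lemma wp_sweep_cut:
  assumes i: "\<sigma> rI 0 = i" "i \<le> n" and size: "\<sigma> rSize 0 = 2 ^ card (act i)"
    and seen: "\<And>e. e < m \<Longrightarrow> \<sigma> rSeen e = seen_count inc i e"
    and z: "\<sigma> rZ i = z i" and tables: "tables i 0 \<sigma>"
  shows "wp xs b (For rJ (Reg rSize) (Seq label_prog message_prog)) (2 ^ cw * (14 * m + 26) + 2)
    (\<lambda>\<sigma>' w'. w' = w \<and> frame sweep_regs \<sigma> \<sigma>' \<and> tables i (2 ^ card (act i)) \<sigma>') \<sigma> w"
proof -
  define Inv where "Inv j \<sigma>' w' \<longleftrightarrow> w' = w \<and> frame sweep_regs \<sigma> \<sigma>' \<and> tables i j \<sigma>'" for j \<sigma>' w'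
  have regs: "rI \<notin> sweep_regs" "rSize \<notin> sweep_regs" "rSeen \<notin> sweep_regs" "rZ \<notin> sweep_regs"
    and J: "rJ \<in> sweep_regs"
    by (auto simp: sweep_regs_def label_regs_def)
  have cw: "(2::nat) ^ card (act i) \<le> 2 ^ cw"
    using cut_le[OF i(2)] by (intro power_increasing) (auto simp: act_def)
  have "card (act i) \<le> m" using card_mono[of "{..<m}" "act i"] by (auto simp: act_def)
  then have "(2::nat) ^ card (act i) \<le> 2 ^ m" by (intro power_increasing) auto
  then have less: "(2::nat) ^ card (act i) < 2 ^ b" by (rule le_power_m_less)
  show ?thesis
  proof (rule wp_time, rule wp_For[where I = Inv and M = "2 ^ card (act i)" and N = "14 * m + 24"],
      goal_cases)
    case 3
    show ?case using tables J by (simp add: Inv_def frame_upd frame_refl tables_upd)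
  next
    case (4 j \<sigma>' w')
    then have fr: "frame sweep_regs \<sigma> \<sigma>'" and tab: "tables i j \<sigma>'" and w: "w' = w"
      by (auto simp: Inv_def)
    have same: "\<sigma>' rI = \<sigma> rI" "\<sigma>' rSeen = \<sigma> rSeen" "\<sigma>' rZ = \<sigma> rZ"
      using frameD[OF fr] regs by auto
    have "wp xs b (Seq label_prog message_prog) (14 * m + 24) (\<lambda>\<sigma>'' w''. w'' = w' \<and>
        frame (sweep_regs - {rJ}) \<sigma>' \<sigma>'' \<and> tables i (Suc j) \<sigma>'') \<sigma>' w'"
      by (rule wp_sweep_step) (use 4 i seen z tab same in auto)
    then show ?case
    proof (rule wp_mono, goal_cases)
      case (2 \<sigma>'' w'')
      then have "\<sigma>'' rJ = \<sigma>' rJ" by (auto intro: frameD)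
      moreover have "frame sweep_regs \<sigma> \<sigma>''" using 2 fr by (auto intro: frame_trans)
      ultimately show ?case using 2 4(2) J w by (simp add: Inv_def tables_upd frame_upd)
    qed simp
  next
    case (5 j \<sigma>' w')
    then show ?case using size frameD[of sweep_regs \<sigma> \<sigma>' rSize] regs by (simp add: val_simps Inv_def)
  next
    case (6 \<sigma>' w')
    then show ?case by (simp add: Inv_def)
  next
    case 7
    show ?case by (rule add_mono[OF mult_le_mono[OF cw] le_refl]) simp
  qed (use less in simp_all)
qed

text \<open>After a complete scan the accumulated sums are the next messages, and the still empty
  sums of the following slice agree with its untouched cells.\<close>

lemma tables_next: "i \<le> n \<Longrightarrow> tables i (2 ^ card (act i)) \<sigma> \<Longrightarrow> tables (Suc i) 0 \<sigma>"
  unfolding tables_def table_value_def partial_msg_all by (simp add: partial_msg_def)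

text \<open>Pass \<open>i\<close> turns slice \<open>i\<close> into slice \<open>Suc i\<close>,
  starting with the imaginary vertex 0. The pass for the empty cut at \<open>n\<close> supplies the
  factor of vertex \<open>n\<close>, hence \<open>n + 1\<close> passes and the result in slice
  \<open>n + 1\<close>.\<close>

lemma wp_sweep:
  assumes zeros: "\<And>s c. s < 3 \<Longrightarrow> \<sigma> (rU s) c = 0" "\<And>e. \<sigma> rSeen e = 0"
    and z: "\<And>i. i \<le> n \<Longrightarrow> \<sigma> rZ i = z i"
  shows "wp xs b sweep_prog ((n + 1) * (2 ^ cw * (20 * m + 40)) + 3) (\<lambda>\<sigma>' w'. w' = w \<and>
    frame outer_regs \<sigma> \<sigma>' \<and> \<sigma>' (rU 0) (n + 1) = partition_sum inc {..<m} {1..n} z) \<sigma> w"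
proof -
  define Inv where "Inv i \<sigma>' w' \<longleftrightarrow> w' = w \<and> frame outer_regs \<sigma> \<sigma>' \<and>
    (\<forall>e<m. \<sigma>' rSeen e = seen_count inc i e) \<and> tables i 0 \<sigma>'" for i \<sigma>' w'
  have frame_tables: "tables i j \<sigma>'' \<longleftrightarrow> tables i j \<sigma>'" if "frame X \<sigma>' \<sigma>''" "rU 0 \<notin> X" "rU 1 \<notin> X" "rU 2 \<notin> X"
    for i j X \<sigma>' \<sigma>''
  proof -
    have "\<sigma>'' (rU s) = \<sigma>' (rU s)" if "s < 3" for s
    proof -
      consider "s = 0" | "s = 1" | "s = 2" using \<open>s < 3\<close> by linarith
      then show ?thesis using that frameD[OF \<open>frame X \<sigma>' \<sigma>''\<close>] \<open>rU 0 \<notin> X\<close> \<open>rU 1 \<notin> X\<close> \<open>rU 2 \<notin> X\<close>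
        by cases simp_all
    qed
    then show ?thesis by (simp add: tables_def)
  qed
  have sub: "sweep_regs \<subseteq> outer_regs" by (auto simp: outer_regs_def)
  have regs: "rZ \<notin> outer_regs" "rI \<in> outer_regs" "rU 0 \<in> outer_regs"
    "rI \<notin> sweep_regs" "rSeen \<notin> sweep_regs" "rSize \<notin> sweep_regs"
    by (auto simp: outer_regs_def sweep_regs_def label_regs_def)
  \<comment> \<open>The empty set has code 0 and the initial slice is number 0, so the only nonzero
    value of the initial message sits at index 0.\<close>
  have init: "tables 0 0 (upd (upd \<sigma> (rU 0) 0 1) rI 0 0)"
    unfolding tables_def
  proof (intro allI impI ballI)
    fix s i' c assume s: "s < (3::nat)" and i': "i' \<in> {0..Suc n}"
    have dec: "set_decode c = {} \<longleftrightarrow> c = 0"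
      by (metis set_decode_inverse set_decode_zero)
    have "c * (n + 2) + i' = 0 \<longleftrightarrow> c = 0 \<and> i' = 0" by auto
    moreover have "upd (upd \<sigma> (rU 0) 0 1) rI 0 0 (rU s) x = of_bool (s = 0 \<and> x = 0)" for x
    proof -
      consider "s = 0" | "s = 1" | "s = 2" using s by linarith
      then show ?thesis using zeros(1)[OF s] by cases simp_all
    qed
    ultimately show "upd (upd \<sigma> (rU 0) 0 1) rI 0 0 (rU s) (c * (n + 2) + i') =
        table_value 0 0 i' s (set_decode c)"
      by (auto simp: table_value_def dec partial_msg_def)
  qed
  show ?thesis
    unfolding sweep_prog_def
  proof (rule wp_Put_Seq, simp, simp, simp, simp, rule wp_time,
      rule wp_For[where I = Inv and M = "n + 1" and
        N = "(3 * m + 3) + ((2 ^ cw * (14 * m + 26) + 2) + (3 * m + 2))"], goal_cases)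
    case 2
    show ?case by (rule le_n_less) simp
  next
    case 3
    show ?case using init regs by (simp add: Inv_def frame_upd frame_refl zeros seen_count_0)
  next
    case (4 i \<sigma>' w')
    then have i: "\<sigma>' rI 0 = i" "i \<le> n" and fr: "frame outer_regs \<sigma> \<sigma>'" and w: "w' = w"
      and seen: "\<And>e. e < m \<Longrightarrow> \<sigma>' rSeen e = seen_count inc i e" and tab: "tables i 0 \<sigma>'"
      by (auto simp: Inv_def)
    have zi: "\<sigma>' rZ i = z i" using frameD[OF fr regs(1)] z i by simp
    let ?Q = "\<lambda>\<sigma> w. \<sigma> rI 0 = i \<and> Inv (Suc i) (upd \<sigma> rI 0 (Suc i)) w"
    have seen_step: "wp xs b seen_prog (3 * m + 2) ?Q \<sigma>2 w"
      if f1: "frame {rE, rSize} \<sigma>' \<sigma>1" and f2: "frame sweep_regs \<sigma>1 \<sigma>2"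
        and tab2: "tables i (2 ^ card (act i)) \<sigma>2" for \<sigma>1 \<sigma>2
    proof -
      have same: "\<sigma>2 rI = \<sigma>' rI" "\<sigma>2 rSeen = \<sigma>' rSeen"
        using frameD[OF f1] frameD[OF f2] regs by auto
      have "wp xs b seen_prog (3 * m + 2) (\<lambda>\<sigma>3 w3. w3 = w \<and> frame {rE, rSeen} \<sigma>2 \<sigma>3 \<and>
          (\<forall>e<m. \<sigma>3 rSeen e = seen_count inc (Suc i) e)) \<sigma>2 w"
        by (rule wp_seen) (use same seen i in auto)
      then show ?thesis
      proof (rule wp_mono, goal_cases)
        case (2 \<sigma>3 w3)
        have "frame outer_regs \<sigma>2 \<sigma>3" "frame outer_regs \<sigma>' \<sigma>1" "frame outer_regs \<sigma>1 \<sigma>2"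
          using 2 f1 f2 sub by (auto simp: frame_def outer_regs_def)
        then have "frame outer_regs \<sigma> \<sigma>3" using fr by (auto intro: frame_trans)
        moreover have "tables (Suc i) 0 \<sigma>3"
        proof (rule tables_next[OF i(2)])
          show "tables i (2 ^ card (act i)) \<sigma>3"
            using frame_tables[of "{rE, rSeen}" \<sigma>2 \<sigma>3] 2 tab2 by simp
        qed
        moreover have "\<sigma>3 rI = \<sigma>2 rI" using 2 by (auto intro: frameD)
        ultimately show ?case using 2 i same regs by (simp add: Inv_def tables_upd frame_upd)
      qed simp
    qed
    have cut_step: "wp xs b (Seq (For rJ (Reg rSize) (Seq label_prog message_prog)) seen_prog)
        ((2 ^ cw * (14 * m + 26) + 2) + (3 * m + 2)) ?Q \<sigma>1 w"
      if f1: "frame {rE, rSize} \<sigma>' \<sigma>1" and size: "\<sigma>1 rSize 0 = 2 ^ card (act i)" for \<sigma>1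
    proof -
      have same: "\<sigma>1 rI = \<sigma>' rI" "\<sigma>1 rSeen = \<sigma>' rSeen" "\<sigma>1 rZ = \<sigma>' rZ"
        using frameD[OF f1] by auto
      have "tables i 0 \<sigma>1" using frame_tables[OF f1] tab by simp
      then have "wp xs b (For rJ (Reg rSize) (Seq label_prog message_prog)) (2 ^ cw * (14 * m + 26) + 2)
          (\<lambda>\<sigma>2 w2. w2 = w \<and> frame sweep_regs \<sigma>1 \<sigma>2 \<and> tables i (2 ^ card (act i)) \<sigma>2) \<sigma>1 w"
        by (intro wp_sweep_cut) (use i same size seen zi in auto)
      then show ?thesis by (intro wp_Seq) (erule wp_mono, use seen_step[OF f1] in auto)
    qed
    have "wp xs b size_prog (3 * m + 3) (\<lambda>\<sigma>1 w1. w1 = w \<and> frame {rE, rSize} \<sigma>' \<sigma>1 \<and>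
        \<sigma>1 rSize 0 = 2 ^ card (act i)) \<sigma>' w"
      using seen by (rule wp_size)
    then show ?case
      unfolding Seqs.simps w by (intro wp_Seq) (erule wp_mono, use cut_step in auto)
  next
    case (5 i \<sigma>' w')
    then show ?case by (simp add: val_simps)
  next
    case (6 \<sigma>' w')
    then have "tables (Suc n) 0 \<sigma>'" by (simp add: Inv_def)
    from tablesD[OF this, of 0 "Suc n" 0] have "\<sigma>' (rU 0) (n + 1) = msg act inc z (Suc n) 0 {}"
      by (simp add: table_value_def)
    also have "\<dots> = partition_sum inc {..<m} {1..n} z" by (rule msg_final[OF act_n seen_n])
    finally show ?case using 6 by (simp add: Inv_def)
  next
    case 7
    have "1 \<le> (2::nat) ^ cw" by simp
    then have "6 * m + 9 \<le> 2 ^ cw * (6 * m + 9)" by (cases "(2::nat) ^ cw") auto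
    then have "(3 * m + 3) + ((2 ^ cw * (14 * m + 26) + 2) + (3 * m + 2)) + 2 \<le> 2 ^ cw * (20 * m + 40)"
      by (simp add: algebra_simps)
    then have "(n + 1) * ((3 * m + 3) + ((2 ^ cw * (14 * m + 26) + 2) + (3 * m + 2)) + 2) \<le>
        (n + 1) * (2 ^ cw * (20 * m + 40))" by (rule mult_le_mono2)
    then show ?case by linarith
  qed (simp_all add: one_less)
qed

end

end

section \<open>Block length, random weights and reading of the digits\<close>

lemma two_times_le_power: "2 * n \<le> 2 ^ n" for n :: nat
proof (induction n)
  case (Suc n)
  show ?case
  proof (cases "n = 0")
    case False
    then have "(2::nat) \<le> 2 ^ n" by (cases n) auto
    with Suc show ?thesis by simp
  qed simp
qed simp

lemma hash_bits_ge: "2 * n \<le> 2 ^ hash_bits n"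
  unfolding hash_bits_def by (rule LeastI[of _ n]) (rule two_times_le_power)

lemma hash_bits_le: "hash_bits n \<le> n"
  unfolding hash_bits_def by (rule Least_le) (rule two_times_le_power)

lemma power_hash_bits_less: "i < hash_bits n \<Longrightarrow> 2 ^ i < 2 * n"
  unfolding hash_bits_def using not_less_Least by (metis not_le)

text \<open>Minimality of the block length keeps the random parts linear in \<open>n\<close>, and
  thereby the weights quadratic and the word length polynomial.\<close>

lemma power_hash_bits_le: "2 ^ hash_bits n \<le> 4 * n + 1"
proof (cases "hash_bits n")
  case (Suc h)
  with power_hash_bits_less[of h n] show ?thesis by simp
qed simp

text \<open>This is the test in the doubling loop of \<open>init_prog\<close>: once the exponent has
  reached \<open>hash_bits n\<close>, the flag stays 0.\<close>

lemma less_hash_bits_iff: "2 ^ min i (hash_bits n) < 2 * n \<longleftrightarrow> i < hash_bits n"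
  using power_hash_bits_less[of i n] hash_bits_ge[of n] by (cases "i < hash_bits n") auto

context cvc_input
begin

lemma le_mass_less: "x \<le> (n + 1) * (base_bits * max_weight) \<Longrightarrow> x < b"
proof -
  assume "x \<le> (n + 1) * (base_bits * max_weight)"
  also have "\<dots> \<le> (n + 1) * (base_bits * max_weight + 2)" by simp
  also have "\<dots> \<le> m + (n + 1) * (base_bits * max_weight + 2)" by simp
  also note b_large'
  finally show "x < b" .
qed

lemma max_weight_pos: "0 < max_weight" by (simp add: max_weight_def)

lemma base_bits_pos: "0 < base_bits" by (simp add: base_bits_def)

lemma base_weight_less: "x \<le> max_weight \<Longrightarrow> base_bits * x < b"
  by (rule le_mass_less) (use mult_le_mono2[of x max_weight base_bits] in \<open>simp add: trans_le_add1\<close>)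

lemma le_base_bits_less: "x \<le> base_bits \<Longrightarrow> x < b"
  using base_weight_less[of 1] max_weight_pos by simp

lemma le_max_weight_less: "x \<le> (n + 1) * max_weight \<Longrightarrow> x < b"
proof (rule le_mass_less)
  assume "x \<le> (n + 1) * max_weight"
  also have "\<dots> \<le> (n + 1) * (base_bits * max_weight)" using base_bits_pos by (intro mult_le_mono2) simp
  finally show "x \<le> (n + 1) * (base_bits * max_weight)" .
qed

lemma less_b_less_power: "x < b \<Longrightarrow> x < 2 ^ b"
  using less_exp[of b] by linarith

definition init_regs :: "nat set" where
  "init_regs = {rI, rPow, rH, rAct, rBase}"

lemma wp_init:
  assumes H: "\<sigma> rH 0 = 0"
  shows "wp xs b init_prog (5 * n + 3 * base_bits + 6) (\<lambda>\<sigma>' w'. w' = w \<and> frame init_regs \<sigma> \<sigma>' \<and>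
    \<sigma>' rPow 0 = 2 ^ hash_bits n \<and> \<sigma>' rH 0 = hash_bits n \<and> \<sigma>' rBase 0 = 2 ^ base_bits) \<sigma> w"
proof -
  let ?H = "hash_bits n"
  define Inv1 where "Inv1 i \<sigma>' w' \<longleftrightarrow> w' = w \<and> frame init_regs \<sigma> \<sigma>' \<and>
    \<sigma>' rPow 0 = 2 ^ min i ?H \<and> \<sigma>' rH 0 = min i ?H" for i \<sigma>' w'
  define Inv2 where "Inv2 i \<sigma>' w' \<longleftrightarrow> w' = w \<and> frame init_regs \<sigma> \<sigma>' \<and>
    \<sigma>' rPow 0 = 2 ^ ?H \<and> \<sigma>' rH 0 = ?H \<and> \<sigma>' rBase 0 = 2 ^ i" for i \<sigma>' w'
  have regs: "rI \<in> init_regs" "rPow \<in> init_regs" "rH \<in> init_regs" "rAct \<in> init_regs" "rBase \<in> init_regs"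
    by (auto simp: init_regs_def)
  have pow_less: "(2::nat) ^ min i ?H < 2 ^ b" for i
    using hash_bits_le[of n] n_less_b by (intro power_strict_increasing) auto
  have H_less: "min i ?H < 2 ^ b" for i
    using hash_bits_le[of n] by (intro le_n_less) linarith
  have loop1: "wp xs b (For rI in_n (Seqs [
       Set rAct (Less (Reg rPow) (Mul (Const 2) in_n)),
       Set rH (Add (Reg rH) (Reg rAct)),
       Set rPow (Mul (Reg rPow) (Add (Const 1) (Reg rAct)))])) (n * (3 + 2) + 2)
     (\<lambda>\<sigma>' w'. w' = w \<and> frame init_regs \<sigma> \<sigma>' \<and> \<sigma>' rPow 0 = 2 ^ ?H \<and> \<sigma>' rH 0 = ?H)
     (upd \<sigma> rPow 0 1) w"
  proof (rule wp_For[where I = Inv1 and M = n], goal_cases)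
    case 2
    show ?case by (rule le_n_less) simp
  next
    case 3
    show ?case using regs H by (simp add: Inv1_def frame_upd frame_refl)
  next
    case (4 i \<sigma>' w')
    then have st: "w' = w" "frame init_regs \<sigma> \<sigma>'" "\<sigma>' rPow 0 = 2 ^ min i ?H" "\<sigma>' rH 0 = min i ?H"
      by (auto simp: Inv1_def)
    have step: "min i ?H + of_bool (i < ?H) = min (Suc i) ?H"
      "2 ^ min i ?H * Suc (of_bool (i < ?H)) = (2::nat) ^ min (Suc i) ?H" by auto
    show ?case
      unfolding Seqs.simps
      apply (rule wp_Put_Seq[where v = "of_bool (i < ?H)"], simp, simp, simp)
        apply (simp add: val_simps st less_hash_bits_iff)
      apply (rule wp_Put_Seq[where v = "min (Suc i) ?H"], simp, simp, simp)
        apply (simp only: val.simps val_simps upd_same upd_other st step, simp add: st val_simps step)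
      apply (rule wp_Put_last[where v = "2 ^ min (Suc i) ?H"], simp, simp, simp)
        apply (simp add: val_simps st step)
      apply (use 4 st regs in \<open>simp add: Inv1_def frame_upd\<close>)
      apply (rule pow_less H_less of_bool_less)+
      done
  next
    case (5 i \<sigma>' w')
    show ?case by (simp add: val_simps)
  next
    case (6 \<sigma>' w')
    then show ?case using hash_bits_le[of n] by (simp add: Inv1_def min_absorb2)
  qed simp
  have loop2: "wp xs b (For rI (Add (Add in_m (Mul (Const 2) in_n)) (Const 1))
       (Set rBase (Mul (Const 2) (Reg rBase)))) (base_bits * (1 + 2) + 2)
     (\<lambda>\<sigma>' w'. w' = w \<and> frame init_regs \<sigma> \<sigma>' \<and>
       \<sigma>' rPow 0 = 2 ^ ?H \<and> \<sigma>' rH 0 = ?H \<and> \<sigma>' rBase 0 = 2 ^ base_bits) (upd \<sigma>1 rBase 0 1) w"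
    if st: "frame init_regs \<sigma> \<sigma>1" "\<sigma>1 rPow 0 = 2 ^ ?H" "\<sigma>1 rH 0 = ?H" for \<sigma>1
  proof (rule wp_For[where I = Inv2 and M = base_bits], goal_cases)
    case 2
    show ?case by (intro less_b_less_power le_base_bits_less) simp
  next
    case 3
    show ?case using st regs by (simp add: Inv2_def frame_upd)
  next
    case (4 i \<sigma>' w')
    then have "(2::nat) ^ Suc i < 2 ^ b"
      by (intro power_strict_increasing le_base_bits_less) auto
    then show ?case
      by (intro wp_Put_last[where v = "2 ^ Suc i"])
        (use 4 regs in \<open>simp_all add: val_simps Inv2_def frame_upd\<close>)
  next
    case (5 i \<sigma>' w')
    show ?case by (simp add: val_simps base_bits_def)
  next
    case (6 \<sigma>' w')
    then show ?case by (simp add: Inv2_def)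
  qed simp
  show ?thesis
    unfolding init_prog_def Seqs.simps
  proof (rule wp_Put_Seq[where i' = 0 and v = 1], simp, simp, simp, simp,
      rule wp_time[where N = "(n * (3 + 2) + 2) + (1 + (base_bits * (1 + 2) + 2))"],
      rule wp_Seq, rule wp_mono[OF loop1[unfolded Seqs.simps] le_refl], goal_cases)
    case (1 \<sigma>1 w1)
    then show ?case using loop2[of \<sigma>1]
      by (intro wp_Seq wp_Put_last[where v = 1]) (auto simp: one_less)
  qed (simp_all add: one_less)
qed

text \<open>The random parts of all \<open>n\<close> vertices together stay below the fixed part
  \<open>n * 2 ^ hash_bits n\<close> of a single vertex, so a comparison of weights first compares
  cardinalities.\<close>

definition vertex_weight :: "bool stream \<Rightarrow> nat \<Rightarrow> nat" where
  "vertex_weight w v = n * 2 ^ hash_bits n + block_value (hash_bits n) (\<lambda>j. w !! j) v"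

lemma block_value_less: "block_value h f v < 2 ^ h"
  unfolding block_value_def by (rule bits_value_less)

lemma vertex_weight_le: "vertex_weight w v \<le> max_weight"
  using block_value_less[of "hash_bits n" "\<lambda>j. w !! j" v] by (simp add: vertex_weight_def max_weight_def)

text \<open>The value 0 at vertex 0 is that of the untouched array entry, which the sweep reads for
  the imaginary vertex.\<close>

definition vertex_power :: "bool stream \<Rightarrow> nat \<Rightarrow> nat" where
  "vertex_power w v = (if v \<in> {1..n} then (2 ^ base_bits) ^ vertex_weight w v else 0)"

lemma vertex_power_le: "vertex_power w v \<le> 2 ^ (base_bits * max_weight)"
  by (simp add: vertex_power_def power_mult[symmetric] vertex_weight_le)

text \<open>The position in the stream is part of the specification, so that vertex
  \<open>Suc i\<close> is known to consume exactly the flips read by \<open>block_value\<close>, and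
  the weights depend on \<open>n * hash_bits n\<close> flips only.\<close>

lemma wp_toss:
  assumes i: "\<sigma> rI 0 = i" and H: "\<sigma> rH 0 = hash_bits n" and W: "\<sigma> rWeight i = 0"
  shows "wp xs b toss_prog (4 * hash_bits n + 2) (\<lambda>\<sigma>' w'. w' = sdrop (i * hash_bits n + hash_bits n) w \<and>
    frame {rT, rFlip, rWeight} \<sigma> \<sigma>' \<and>
    \<sigma>' rWeight = (\<sigma> rWeight)(i := block_value (hash_bits n) (\<lambda>j. w !! j) (Suc i)))
    \<sigma> (sdrop (i * hash_bits n) w)"
proof -
  let ?H = "hash_bits n" and ?bin = "bits_value (\<lambda>j. w !! (i * hash_bits n + j))"
  define Inv where "Inv t \<sigma>' w' \<longleftrightarrow> w' = sdrop (i * ?H + t) w \<and> frame {rT, rFlip, rWeight} \<sigma> \<sigma>' \<and>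
    \<sigma>' rWeight = (\<sigma> rWeight)(i := ?bin t)" for t \<sigma>' w'
  have H_less: "?H < b" using hash_bits_le[of n] n_less_b by linarith
  show ?thesis
    unfolding toss_prog_def
  proof (rule wp_time, rule wp_For[where I = Inv and M = ?H and N = "1 + 1"], goal_cases)
    case 2
    show ?case using H_less by (rule less_b_less_power)
  next
    case 3
    show ?case using W by (auto simp: Inv_def frame_upd frame_refl)
  next
    case (4 t \<sigma>' w')
    then have st: "w' = sdrop (i * ?H + t) w" "frame {rT, rFlip, rWeight} \<sigma> \<sigma>'"
        "\<sigma>' rWeight = (\<sigma> rWeight)(i := ?bin t)" by (auto simp: Inv_def)
    have I: "\<sigma>' rI 0 = i" using frameD[OF st(2), of rI] i by simp
    have "(2::nat) ^ Suc t \<le> 2 ^ ?H" using 4(1) by (intro power_increasing) auto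
    then have "?bin (Suc t) \<le> 2 ^ ?H" using bits_value_less[of "\<lambda>j. w !! (i * ?H + j)" "Suc t"] by linarith
    then have less: "?bin (Suc t) < 2 ^ b" using H_less by (rule less_power_b)
    show ?case
      by (intro wp_Seq wp_Toss wp_Put_last[where i' = i and v = "?bin (Suc t)"])
        (use 4(2) I less in \<open>simp_all add: st val_simps Inv_def frame_upd fun_eq_iff\<close>)
  next
    case (5 t \<sigma>' w')
    then have "\<sigma>' rH = \<sigma> rH" by (auto simp: Inv_def intro: frameD)
    with H show ?case by (simp add: val_simps)
  next
    case (6 \<sigma>' w')
    then show ?case by (simp add: Inv_def block_value_def)
  qed simp_all
qed

lemma wp_power:
  assumes i: "\<sigma> rI 0 = i" and Z: "\<sigma> rZ (Suc i) = 1"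
    and P: "\<sigma> rPow 0 = 2 ^ hash_bits n" and B: "\<sigma> rBase 0 = 2 ^ base_bits"
    and W: "\<sigma> rWeight i < 2 ^ hash_bits n"
  shows "wp xs b power_prog (3 * max_weight + 2) (\<lambda>\<sigma>' w'. w' = w \<and> frame {rT, rZ} \<sigma> \<sigma>' \<and>
    \<sigma>' rZ = (\<sigma> rZ)(Suc i := (2 ^ base_bits) ^ (n * 2 ^ hash_bits n + \<sigma> rWeight i))) \<sigma> w"
proof -
  let ?W = "n * 2 ^ hash_bits n + \<sigma> rWeight i"
  have W_le: "?W \<le> max_weight" using W by (simp add: max_weight_def)
  define Inv where "Inv t \<sigma>' w' \<longleftrightarrow> w' = w \<and> frame {rT, rZ} \<sigma> \<sigma>' \<and>
    \<sigma>' rZ = (\<sigma> rZ)(Suc i := (2 ^ base_bits) ^ t)" for t \<sigma>' w'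
  show ?thesis
    unfolding power_prog_def
  proof (rule wp_time, rule wp_For[where I = Inv and M = ?W and N = 1], goal_cases)
    case 2
    show ?case by (intro less_b_less_power le_max_weight_less) (use W_le in simp)
  next
    case 3
    show ?case using Z by (auto simp: Inv_def frame_upd frame_refl)
  next
    case (4 t \<sigma>' w')
    then have st: "w' = w" "frame {rT, rZ} \<sigma> \<sigma>'"
        "\<sigma>' rZ = (\<sigma> rZ)(Suc i := (2 ^ base_bits) ^ t)" by (auto simp: Inv_def)
    have regs: "\<sigma>' rI 0 = i" "\<sigma>' rBase 0 = 2 ^ base_bits"
      using frameD[OF st(2), of rI] frameD[OF st(2), of rBase] i B by auto
    have "base_bits * Suc t < b" using 4(1) W_le by (intro base_weight_less) linarith
    then have "(2::nat) ^ (base_bits * Suc t) < 2 ^ b" by (intro power_strict_increasing) auto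
    then have less: "((2::nat) ^ base_bits) ^ Suc t < 2 ^ b" by (simp only: power_mult)
    show ?case
      by (intro wp_Put_last[where i' = "Suc i" and v = "(2 ^ base_bits) ^ Suc t"])
        (use 4(2) regs less in \<open>simp_all add: st val_simps Inv_def frame_upd fun_eq_iff\<close>)
  next
    case (5 t \<sigma>' w')
    then have "\<sigma>' rI = \<sigma> rI" "\<sigma>' rPow = \<sigma> rPow" "\<sigma>' rWeight = \<sigma> rWeight"
      by (auto simp: Inv_def intro: frameD)
    with i P show ?case by (simp add: val_simps)
  next
    case (6 \<sigma>' w')
    then show ?case by (simp add: Inv_def)
  qed (use W_le in simp_all)
qed

definition weight_regs :: "nat set" where
  "weight_regs = {rI, rT, rFlip, rWeight, rZ}"

lemma wp_weight:
  assumes W: "\<And>v. \<sigma> rWeight v = 0" and Z: "\<sigma> rZ 0 = 0" and H: "\<sigma> rH 0 = hash_bits n"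
    and P: "\<sigma> rPow 0 = 2 ^ hash_bits n" and B: "\<sigma> rBase 0 = 2 ^ base_bits"
  shows "wp xs b weight_prog (n * (4 * hash_bits n + 3 * max_weight + 7) + 2) (\<lambda>\<sigma>' w'.
    frame weight_regs \<sigma> \<sigma>' \<and> (\<forall>v\<le>n. \<sigma>' rZ v = vertex_power w v)) \<sigma> w"
proof -
  let ?H = "hash_bits n"
  define Inv where "Inv i \<sigma>' w' \<longleftrightarrow> w' = sdrop (i * ?H) w \<and> frame weight_regs \<sigma> \<sigma>' \<and>
    (\<forall>v\<ge>i. \<sigma>' rWeight v = 0) \<and> (\<forall>v\<le>i. \<sigma>' rZ v = vertex_power w v)" for i \<sigma>' w'
  have regs: "rI \<in> weight_regs" "rH \<notin> weight_regs" "rPow \<notin> weight_regs" "rBase \<notin> weight_regs"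
    by (auto simp: weight_regs_def)
  show ?thesis
    unfolding weight_prog_def
  proof (rule wp_time, rule wp_For[where I = Inv and M = n and
        N = "(4 * ?H + 2) + (1 + (3 * max_weight + 2))"], goal_cases)
    case 2
    show ?case by (rule le_n_less) simp
  next
    case 3
    show ?case using W Z regs by (simp add: Inv_def frame_upd frame_refl vertex_power_def)
  next
    case (4 i \<sigma>' w')
    then have w': "w' = sdrop (i * ?H) w" and fr: "frame weight_regs \<sigma> \<sigma>'" and i: "\<sigma>' rI 0 = i" "i < n"
      and W': "\<And>v. i \<le> v \<Longrightarrow> \<sigma>' rWeight v = 0" and Z': "\<And>v. v \<le> i \<Longrightarrow> \<sigma>' rZ v = vertex_power w v"
      by (auto simp: Inv_def)
    have same: "\<sigma>' rH 0 = ?H" "\<sigma>' rPow 0 = 2 ^ ?H" "\<sigma>' rBase 0 = 2 ^ base_bits"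
      using frameD[OF fr regs(2)] frameD[OF fr regs(3)] frameD[OF fr regs(4)] H P B by auto
    let ?bv = "block_value ?H (\<lambda>j. w !! j) (Suc i)"
    let ?Q = "\<lambda>\<sigma> w. \<sigma> rI 0 = i \<and> Inv (Suc i) (upd \<sigma> rI 0 (Suc i)) w"
    have power: "wp xs b power_prog (3 * max_weight + 2) ?Q (upd \<sigma>1 rZ (Suc i) 1)
        (sdrop (i * ?H + ?H) w)"
      if f1: "frame {rT, rFlip, rWeight} \<sigma>' \<sigma>1" and W1: "\<sigma>1 rWeight = (\<sigma>' rWeight)(i := ?bv)" for \<sigma>1
    proof (rule wp_mono[OF wp_power[where i = i] le_refl], goal_cases)
      case (6 \<sigma>2 w2)
      then have f2: "frame {rT, rZ} (upd \<sigma>1 rZ (Suc i) 1) \<sigma>2" by blast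
      have "frame weight_regs \<sigma> \<sigma>2"
        using fr f1 f2 by (auto simp: frame_def weight_regs_def)
      moreover have "\<sigma>2 rWeight = (\<sigma>' rWeight)(i := ?bv)" using frameD[OF f2, of rWeight] W1 by (simp add: fun_eq_iff)
      moreover have "\<sigma>2 rZ = (\<sigma>' rZ)(Suc i := (2 ^ base_bits) ^ vertex_weight w (Suc i))"
        using 6 W1 frameD[OF f1, of rZ] by (simp add: vertex_weight_def)
      moreover have "\<sigma>2 rI 0 = i" using frameD[OF f2, of rI] frameD[OF f1, of rI] i by simp
      ultimately show ?case
        using 6 W' Z' i regs
        by (auto simp: Inv_def frame_upd add.commute vertex_power_def le_Suc_eq)
    qed (use frameD[OF f1, of rI] frameD[OF f1, of rPow] frameD[OF f1, of rBase] i same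
        block_value_less W1 in simp_all)
    have put: "wp xs b (Seq (Put rZ (Add (Reg rI) (Const 1)) (Const 1)) power_prog)
        (1 + (3 * max_weight + 2)) ?Q \<sigma>1 (sdrop (i * ?H + ?H) w)"
      if f1: "frame {rT, rFlip, rWeight} \<sigma>' \<sigma>1" and W1: "\<sigma>1 rWeight = (\<sigma>' rWeight)(i := ?bv)" for \<sigma>1
      by (intro wp_Seq wp_Put_last[where i' = "Suc i" and v = 1] power[OF that])
        (use frameD[OF f1, of rI] i one_less in \<open>simp_all add: val_simps\<close>)
    have "wp xs b toss_prog (4 * ?H + 2) (\<lambda>\<sigma>1 w1. w1 = sdrop (i * ?H + ?H) w \<and>
        frame {rT, rFlip, rWeight} \<sigma>' \<sigma>1 \<and> \<sigma>1 rWeight = (\<sigma>' rWeight)(i := ?bv)) \<sigma>' w'"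
      unfolding w' using wp_toss[of \<sigma>' i w] i same W' by simp
    then show ?case
      unfolding Seqs.simps by (intro wp_Seq) (erule wp_mono, use put in auto)
  next
    case (5 i \<sigma>' w')
    show ?case by (simp add: val_simps)
  next
    case (6 \<sigma>' w')
    then show ?case by (simp add: Inv_def)
  next
    case 7
    show ?case by (simp add: algebra_simps)
  qed simp
qed

text \<open>Sets of at most \<open>k\<close> vertices weigh less than \<open>k + 1\<close> times the
  fixed part of a weight, larger sets at least that much. The upper bound on \<open>t\<close> is
  therefore the condition on the cardinality.\<close>

definition accepting :: "nat \<Rightarrow> nat \<Rightarrow> bool" where
  "accepting P t \<longleftrightarrow> 0 < t \<and> t < n * 2 ^ hash_bits n * (k + 1) \<and> P div (2 ^ base_bits) ^ t mod 4 = 2"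

lemma wp_decode:
  assumes U: "\<sigma> (rU 0) (n + 1) = P" and P_less: "P < 2 ^ b" and found: "\<sigma> rFound 0 = 0"
    and Pow: "\<sigma> rPow 0 = 2 ^ hash_bits n" and B: "\<sigma> rBase 0 = 2 ^ base_bits"
  shows "wp xs b decode_prog (n * 2 ^ hash_bits n * (n + 1) * 4 + 3) (\<lambda>\<sigma>' w'.
    \<sigma>' rFound 0 \<noteq> 0 \<longleftrightarrow> (\<exists>t<n * 2 ^ hash_bits n * (n + 1). accepting P t)) \<sigma> w"
proof -
  let ?M = "n * 2 ^ hash_bits n * (n + 1)"
  define Inv where "Inv t \<sigma>' (w' :: bool stream) \<longleftrightarrow> frame {rT, rTotal, rFound} \<sigma> \<sigma>' \<and>
    \<sigma>' rTotal 0 = P div (2 ^ base_bits) ^ t \<and> \<sigma>' rFound 0 = (\<Sum>s<t. of_bool (accepting P s))" for t \<sigma>' w'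
  have M_less: "?M < b"
    by (rule le_max_weight_less) (simp add: max_weight_def algebra_simps)
  have found_le: "(\<Sum>s<t. of_bool (accepting P s)) \<le> t" for t
    using sum_bounded_above[of "{..<t}" "\<lambda>s. of_bool (accepting P s)" "1::nat"] by simp
  have mod4: "x - 4 * (x div 4) = x mod 4" for x :: nat by (rule minus_mult_div_eq_mod)
  show ?thesis
    unfolding decode_prog_def
  proof (rule wp_Put_Seq[where v = P], simp, simp, simp, goal_cases)
    case 1
    show ?case using U by (simp add: val_simps)
  next
    case 2
    show ?case
    proof (rule wp_time, rule wp_For[where I = Inv and M = ?M and N = 2], goal_cases)
      case 2
      show ?case using M_less by (rule less_b_less_power)
    next
      case 3
      show ?case using found by (simp add: Inv_def frame_upd frame_refl)
    next
      case (4 t \<sigma>' w')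
      then have st: "frame {rT, rTotal, rFound} \<sigma> \<sigma>'" "\<sigma>' rTotal 0 = P div (2 ^ base_bits) ^ t"
          "\<sigma>' rFound 0 = (\<Sum>s<t. of_bool (accepting P s))" by (auto simp: Inv_def)
      have regs: "\<sigma>' rPow 0 = 2 ^ hash_bits n" "\<sigma>' rBase 0 = 2 ^ base_bits"
        using frameD[OF st(1), of rPow] frameD[OF st(1), of rBase] Pow B by auto
      have 1: "val (Add (Reg rFound) (Mul (Mul (Less (Const 0) (Reg rT))
         (Less (Reg rT) (Mul (Mul in_n (Reg rPow)) (Add in_k (Const 1)))))
         (Eq (Sub (Reg rTotal) (Mul (Const 4) (Div (Reg rTotal) (Const 4)))) (Const 2)))) (layout xs \<sigma>') =
         (\<Sum>s<Suc t. of_bool (accepting P s))"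
        using 4(2) st(2,3) regs by (simp add: val_simps accepting_def mod4 of_bool_conj)
      have div: "P div (2 ^ base_bits) ^ t div 2 ^ base_bits = P div (2 ^ base_bits) ^ Suc t"
        by (simp only: power_Suc2 div_mult2_eq)
      show ?case
      proof (rule wp_Put_Seq[OF _ _ _ 1], simp, simp, simp, goal_cases)
        case 1
        show ?case
          by (rule wp_Put_last[where i' = 0 and v = "P div (2 ^ base_bits) ^ Suc t"])
            (use 4(2) st regs div le_less_trans[OF div_le_dividend P_less] in
              \<open>simp_all add: val_simps Inv_def frame_upd\<close>)
      next
        case 2
        show ?case using found_le[of "Suc t"] 4(1) M_less less_b_less_power[of "Suc t"] by linarith
      qed
    next
      case (5 t \<sigma>' w')
      then have "\<sigma>' rPow = \<sigma> rPow" by (auto simp: Inv_def intro: frameD)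
      with Pow show ?case by (simp add: val_simps)
    next
      case (6 \<sigma>' w')
      then have "\<sigma>' rFound 0 = (\<Sum>s<?M. of_bool (accepting P s))" by (simp add: Inv_def)
      then show ?case by (auto simp: sum_eq_0_iff)
    qed simp_all
  qed (use P_less in simp)
qed

definition accepts :: "bool stream \<Rightarrow> bool" where
  "accepts w \<longleftrightarrow> (\<exists>t<n * 2 ^ hash_bits n * (n + 1).
     accepting (partition_sum inc {..<m} {1..n} (vertex_power w)) t)"

definition main_steps :: nat where
  "main_steps = (5 * n + 3 * base_bits + 6) + ((n * (4 * hash_bits n + 3 * max_weight + 7) + 2) +
     (((n + 1) * (2 ^ cw * (20 * m + 40)) + 3) + (n * 2 ^ hash_bits n * (n + 1) * 4 + 3)))"

lemma wp_main:
  "wp xs b main_prog main_steps (\<lambda>\<sigma> w'. \<sigma> rFound 0 \<noteq> 0 \<longleftrightarrow> accepts w) (\<lambda>_ _. 0) w"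
proof -
  let ?z = "vertex_power w" and ?\<sigma> = "\<lambda>_ _. 0 :: nat"
  let ?P = "partition_sum inc {..<m} {1..n} ?z" and ?Q = "\<lambda>\<sigma> w'. \<sigma> rFound 0 \<noteq> 0 \<longleftrightarrow> accepts w"
  let ?H = "hash_bits n"
  let ?weight_steps = "n * (4 * ?H + 3 * max_weight + 7) + 2"
  let ?sweep_steps = "(n + 1) * (2 ^ cw * (20 * m + 40)) + 3"
  let ?decode_steps = "n * 2 ^ ?H * (n + 1) * 4 + 3"
  note z_le = vertex_power_le[of w]
  have P_less: "?P < 2 ^ b"
  proof -
    have "?P = msg act inc ?z (Suc n) 0 {}" by (rule msg_final[OF act_n seen_n, symmetric])
    also have "\<dots> = partial_msg ?z n (2 ^ card (act n)) 0 {}"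
      by (rule partial_msg_all[OF z_le, symmetric])
    also have "\<dots> \<le> 2 ^ bits_bound" by (rule partial_msg_le[OF z_le]) auto
    finally show ?thesis by (rule le_bound_less)
  qed
  have decode: "wp xs b decode_prog ?decode_steps ?Q \<sigma>3 w3"
    if "\<sigma>3 (rU 0) (n + 1) = ?P" "\<sigma>3 rFound 0 = 0" "\<sigma>3 rPow 0 = 2 ^ ?H"
      "\<sigma>3 rBase 0 = 2 ^ base_bits" for \<sigma>3 w3
    using wp_decode[OF that(1) P_less that(2-4)] by (simp only: accepts_def)
  have sweep: "wp xs b (Seq sweep_prog decode_prog)
      (?sweep_steps + ?decode_steps) ?Q \<sigma>2 w2"
    if f: "frame (init_regs \<union> weight_regs) ?\<sigma> \<sigma>2" and z: "\<forall>v\<le>n. \<sigma>2 rZ v = ?z v"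
      and r: "\<sigma>2 rPow 0 = 2 ^ ?H" "\<sigma>2 rBase 0 = 2 ^ base_bits" for \<sigma>2 w2
  proof -
    have "wp xs b sweep_prog ?sweep_steps (\<lambda>\<sigma>' w'. w' = w2 \<and>
        frame outer_regs \<sigma>2 \<sigma>' \<and> \<sigma>' (rU 0) (n + 1) = ?P) \<sigma>2 w2"
    proof (rule wp_sweep[OF z_le])
      show "\<sigma>2 (rU s) c = 0" for s c
        using frameD[OF f, of "rU s"] by (simp add: init_regs_def weight_regs_def)
      show "\<sigma>2 rSeen e = 0" for e
        using frameD[OF f, of rSeen] by (simp add: init_regs_def weight_regs_def)
    qed (use z in simp)
    then show ?thesis
    proof (intro wp_Seq, elim wp_mono, goal_cases)
      case (2 \<sigma>3 w3)
      have "\<sigma>3 rFound = ?\<sigma> rFound" "\<sigma>3 rPow = \<sigma>2 rPow" "\<sigma>3 rBase = \<sigma>2 rBase"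
        using 2 f by (auto simp: frame_def outer_regs_def sweep_regs_def label_regs_def
          init_regs_def weight_regs_def)
      with 2 r show ?case by (intro decode) auto
    qed simp
  qed
  have weight: "wp xs b (Seq weight_prog (Seq sweep_prog decode_prog))
      (?weight_steps +
      (?sweep_steps + ?decode_steps)) ?Q \<sigma>1 w"
    if f: "frame init_regs ?\<sigma> \<sigma>1" and r: "\<sigma>1 rPow 0 = 2 ^ ?H" "\<sigma>1 rH 0 = ?H"
      "\<sigma>1 rBase 0 = 2 ^ base_bits" for \<sigma>1
  proof -
    have "wp xs b weight_prog ?weight_steps (\<lambda>\<sigma>' w'.
        frame weight_regs \<sigma>1 \<sigma>' \<and> (\<forall>v\<le>n. \<sigma>' rZ v = ?z v)) \<sigma>1 w"
      by (rule wp_weight) (use r frameD[OF f, of rWeight] frameD[OF f, of rZ] in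
        \<open>simp_all add: init_regs_def\<close>)
    then show ?thesis
    proof (intro wp_Seq, elim wp_mono, goal_cases)
      case (2 \<sigma>2 w2)
      have "frame (init_regs \<union> weight_regs) ?\<sigma> \<sigma>2" "\<sigma>2 rPow = \<sigma>1 rPow" "\<sigma>2 rBase = \<sigma>1 rBase"
        using 2 f by (auto simp: frame_def weight_regs_def)
      with 2 r show ?case by (intro sweep[unfolded Seqs.simps]) auto
    qed simp
  qed
  have "wp xs b init_prog (5 * n + 3 * base_bits + 6) (\<lambda>\<sigma>' w'. w' = w \<and> frame init_regs ?\<sigma> \<sigma>' \<and>
      \<sigma>' rPow 0 = 2 ^ ?H \<and> \<sigma>' rH 0 = ?H \<and> \<sigma>' rBase 0 = 2 ^ base_bits) ?\<sigma> w"
    by (rule wp_init) simp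
  then show ?thesis
    unfolding main_prog_def main_steps_def Seqs.simps
    by (intro wp_Seq, elim wp_mono) (use weight in auto)
qed

end

section \<open>Acceptance\<close>

context cvc_input
begin

lemma n_pos: "0 < n"
  using both_seen[OF m_pos] seen_count_le[of inc n 0] by simp

definition solutions :: "nat set set" where
  "solutions = {S. S \<subseteq> {1..n} \<and> solution inc {..<m} S}"

lemma accepting_iff:
  assumes "0 < t"
  shows "partition_sum inc {..<m} {1..n} (vertex_power w) div (2 ^ base_bits) ^ t mod 4 = 2 \<longleftrightarrow>
    odd (card {S \<in> solutions. sum (vertex_weight w) S = t})"
proof -
  have "partition_sum inc {..<m} {1..n} (vertex_power w) =
      partition_sum inc {..<m} {1..n} (\<lambda>v. (2 ^ base_bits) ^ vertex_weight w v)"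
    unfolding partition_sum_def by (intro sum.cong prod.cong refl) (simp add: vertex_power_def)
  moreover have "{S \<in> Pow {1..n}. solution inc {..<m} S \<and> sum (vertex_weight w) S = t} =
      {S \<in> solutions. sum (vertex_weight w) S = t}"
    by (auto simp: solutions_def)
  moreover have "partition_sum inc {..<m} {1..n} (\<lambda>v. (2 ^ base_bits) ^ vertex_weight w v)
      div (2 ^ base_bits) ^ t mod 4 = 2 \<longleftrightarrow>
      odd (card {S \<in> Pow {1..n}. solution inc {..<m} S \<and> sum (vertex_weight w) S = t})"
    by (rule partition_sum_digit)
      (use n_pos m_pos assms inc_less in \<open>auto simp: vertex_weight_def base_bits_def\<close>)
  ultimately show ?thesis by simp
qed

lemma sum_vertex_weight:
  assumes "S \<subseteq> {1..n}"
  shows "card S * (n * 2 ^ hash_bits n) \<le> sum (vertex_weight w) S"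
    and "sum (vertex_weight w) S < (card S + 1) * (n * 2 ^ hash_bits n)"
proof -
  let ?M = "n * 2 ^ hash_bits n" and ?b = "block_value (hash_bits n) (\<lambda>j. w !! j)"
  have eq: "sum (vertex_weight w) S = card S * ?M + sum ?b S"
    by (simp add: vertex_weight_def sum.distrib)
  have fin: "finite S" using assms finite_subset by blast
  have "sum ?b S \<le> (\<Sum>v\<in>{1..n}. ?b v)" using assms by (intro sum_mono2) auto
  also have "\<dots> < (\<Sum>v\<in>{1..n}. 2 ^ hash_bits n)"
    using n_pos by (intro sum_strict_mono block_value_less) auto
  finally have "sum ?b S < ?M" by simp
  with eq show "card S * ?M \<le> sum (vertex_weight w) S"
    "sum (vertex_weight w) S < (card S + 1) * ?M" by simp_all
qed

text \<open>Holds for every sequence of flips: residue 2 means that the number of solutions of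
  weight \<open>t\<close> is odd and hence not 0, and \<open>t\<close> is too small for more than
  \<open>k\<close> vertices.\<close>

lemma accepts_sound:
  assumes "accepts w"
  shows "\<exists>S\<in>solutions. card S \<le> k"
proof -
  let ?M = "n * 2 ^ hash_bits n"
  from assms obtain t where t: "0 < t" "t < ?M * (k + 1)"
    "partition_sum inc {..<m} {1..n} (vertex_power w) div (2 ^ base_bits) ^ t mod 4 = 2"
    by (auto simp: accepts_def accepting_def)
  then have "odd (card {S \<in> solutions. sum (vertex_weight w) S = t})" using accepting_iff[OF t(1)] by blast
  then have "{S \<in> solutions. sum (vertex_weight w) S = t} \<noteq> {}" by (metis card.empty even_zero)
  then obtain S where S: "S \<in> solutions" "sum (vertex_weight w) S = t" by blast
  then have "card S * ?M \<le> t" using sum_vertex_weight(1)[of S w] by (simp add: solutions_def)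
  with t(2) have "card S * ?M < (k + 1) * ?M" by (simp add: mult.commute)
  then have "card S < k + 1" by (rule mult_less_cancel2[THEN iffD1, THEN conjunct2])
  with S(1) show ?thesis by (intro bexI[of _ S]) auto
qed

text \<open>At the least weight exactly one solution is counted, an odd number. This weight is at
  most that of \<open>S0\<close>, so it passes the test for \<open>k\<close>, and as
  \<open>S\<close> has at most \<open>n\<close> vertices, the decoding loop reaches it.\<close>

lemma accepts_if_unique:
  assumes S0: "S0 \<in> solutions" "card S0 \<le> k"
    and unique: "\<exists>!S. minimal_in solutions (vertex_weight w) S"
  shows "accepts w"
proof -
  let ?M = "n * 2 ^ hash_bits n" and ?W = "sum (vertex_weight w)"
  from unique obtain S where S: "minimal_in solutions (vertex_weight w) S"
    and only: "\<And>T. minimal_in solutions (vertex_weight w) T \<Longrightarrow> T = S" by blast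
  have sol: "S \<in> solutions" "S \<subseteq> {1..n}" and le: "\<And>T. T \<in> solutions \<Longrightarrow> ?W S \<le> ?W T"
    using S by (auto simp: minimal_in_def solutions_def)
  have M_pos: "0 < ?M" using n_pos by simp
  have "S \<noteq> {}" using sol(1) m_pos by (auto simp: solutions_def solution_def)
  moreover have "finite S" using sol(2) finite_subset by blast
  ultimately have card_pos: "0 < card S" by (simp add: card_gt_0_iff)
  have pos: "0 < ?W S"
    using sum_vertex_weight(1)[OF sol(2), of w] card_pos M_pos
    by (metis less_le_trans mult_pos_pos)
  have "?W S < (card S0 + 1) * ?M"
    using le[OF S0(1)] sum_vertex_weight(2)[of S0 w] S0(1) by (simp add: solutions_def)
  also have "\<dots> \<le> ?M * (k + 1)" using S0(2) by (subst mult.commute) (intro mult_le_mono2, simp)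
  finally have less_k: "?W S < ?M * (k + 1)" .
  have "card S \<le> n" using card_mono[OF _ sol(2)] by simp
  then have "(card S + 1) * ?M \<le> ?M * (n + 1)" by (subst mult.commute) (intro mult_le_mono2, simp)
  then have less_n: "?W S < ?M * (n + 1)" using sum_vertex_weight(2)[OF sol(2), of w] by linarith
  have "{T \<in> solutions. ?W T = ?W S} = {S}"
  proof (intro equalityI subsetI)
    fix T assume T: "T \<in> {T \<in> solutions. ?W T = ?W S}"
    then have "minimal_in solutions (vertex_weight w) T" using le by (simp add: minimal_in_def)
    then show "T \<in> {S}" using only by simp
  qed (use sol(1) in simp)
  then have "accepting (partition_sum inc {..<m} {1..n} (vertex_power w)) (?W S)"
    unfolding accepting_def accepting_iff[OF pos] using pos less_k by simp
  with less_n show ?thesis by (auto simp: accepts_def)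
qed

lemma accepts_cong:
  assumes "\<And>j. j < n * hash_bits n \<Longrightarrow> w !! j = w' !! j"
  shows "accepts w \<longleftrightarrow> accepts w'"
proof -
  have "vertex_power w v = vertex_power w' v" for v
    using block_value_cong[of n "hash_bits n" "\<lambda>j. w !! j" "\<lambda>j. w' !! j" v] assms
    by (simp add: vertex_power_def vertex_weight_def)
  then have "vertex_power w = vertex_power w'" by blast
  then show ?thesis by (simp add: accepts_def)
qed

lemma not_accepts_prob:
  assumes "S0 \<in> solutions" "card S0 \<le> k"
  shows "{w. \<not> accepts w} \<in> sets coin_flips" "measure coin_flips {w. \<not> accepts w} \<le> 1 / 2"
proof -
  have sub: "solutions \<subseteq> Pow {1..n}" "solutions \<noteq> {}" using assms(1) by (auto simp: solutions_def)
  have cong: "\<not> accepts w \<longleftrightarrow> \<not> accepts w'" if "\<And>j. j < n * hash_bits n \<Longrightarrow> w !! j = w' !! j" for w w'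
    using accepts_cong[OF that] by blast
  have unique: "\<not> (\<exists>!S. minimal_in solutions
      (\<lambda>u. n * 2 ^ hash_bits n + block_value (hash_bits n) (\<lambda>j. w !! j) u) S)" if "\<not> accepts w" for w
    using accepts_if_unique[OF assms, of w] that unfolding vertex_weight_def by blast
  show "{w. \<not> accepts w} \<in> sets coin_flips" "measure coin_flips {w. \<not> accepts w} \<le> 1 / 2"
    using isolation[OF sub hash_bits_ge cong unique] by auto
qed

end

section \<open>Runs of the complete program\<close>

lemma initial_mem_eq_layout: "initial_mem xs = layout xs (\<lambda>_ _. 0)"
  by (rule ext) (simp add: initial_mem_def layout_def)

lemma cost_Store_le:
  assumes "\<forall>a. m a < 2 ^ b" "0 < b"
  shows "cost a m + cost e m + bits (val a m) + bits (val e m) \<le> prog_factor (Store a e) * b\<^sup>2"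
proof -
  have "cost a m + cost e m + bits (val a m) + bits (val e m) \<le>
      expr_factor a * b\<^sup>2 + expr_factor e * b\<^sup>2 + 2 * weight a * b\<^sup>2 + 2 * weight e * b\<^sup>2"
    by (intro add_mono cost_le bits_val_le_square assms)
  then show ?thesis by (simp add: distrib_right)
qed

lemma cost_guard_le:
  assumes "\<forall>a. m a < 2 ^ b" "0 < b"
  shows "cost e m + bits (val e m) \<le> (expr_factor e + 2 * weight e) * b\<^sup>2"
  unfolding distrib_right by (intro add_mono cost_le bits_val_le_square assms)

context machine_input
begin

abbreviation "start \<equiv> layout xs (\<lambda>_ _. 0)"

lemma start_less: "\<forall>a. start a < 2 ^ b"
  by (rule layout_fits) (simp add: fits_def)

lemma exec_negative:
  assumes "xs ! 0 \<noteq> 0"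
  shows "\<exists>t m'. exec cvc_prog (start, w) t (m', w) \<and> t \<le> prog_factor cvc_prog * b\<^sup>2 \<and> m' 0 = 0"
proof -
  let ?t = "cost (Const 0) start + cost (Const 0) start + bits (val (Const 0) start) + bits (val (Const 0) start)"
  have "start 0 = xs ! 0" using length_input by (simp add: layout_def)
  then have "val (Load (Const 0)) start \<noteq> 0" using assms by simp
  from exec.Cond_True[OF this exec.Store]
  have "exec cvc_prog (start, w) (cost (Load (Const 0)) start + bits (val (Load (Const 0)) start) + ?t)
      (start(val (Const 0) start := val (Const 0) start), w)"
    unfolding cvc_prog_def .
  moreover have "cost (Load (Const 0)) start + bits (val (Load (Const 0)) start) + ?t \<le>
      (expr_factor (Load (Const 0)) + 2 * weight (Load (Const 0))) * b\<^sup>2 +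
      prog_factor (Store (Const 0) (Const 0)) * b\<^sup>2"
    by (rule add_mono[OF cost_guard_le cost_Store_le]) (rule start_less b_pos)+
  moreover have "\<dots> \<le> prog_factor cvc_prog * b\<^sup>2"
    unfolding cvc_prog_def prog_factor.simps(5) distrib_right by linarith
  ultimately show ?thesis by fastforce
qed

lemma exec_no_edges:
  assumes "xs ! 0 = 0" "m = 0"
  shows "\<exists>t m'. exec cvc_prog (start, w) t (m', w) \<and> t \<le> prog_factor cvc_prog * b\<^sup>2 \<and> m' 0 \<noteq> 0"
proof -
  let ?t = "cost (Const 0) start + cost (Const 1) start + bits (val (Const 0) start) + bits (val (Const 1) start)"
  let ?g = "\<lambda>e. cost e start + bits (val e start)"
  have "start 0 = xs ! 0" "start 3 = m" using length_input input_m by (simp_all add: layout_def)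
  then have v: "val (Load (Const 0)) start = 0" "val in_m start = 0" using assms by simp_all
  from exec.Cond_False[OF v(1) exec.Cond_False[OF v(2) exec.Store]]
  have "exec cvc_prog (start, w) (?g (Load (Const 0)) + (?g in_m + ?t))
      (start(val (Const 0) start := val (Const 1) start), w)"
    unfolding cvc_prog_def .
  moreover have "?g (Load (Const 0)) + (?g in_m + ?t) \<le>
      (expr_factor (Load (Const 0)) + 2 * weight (Load (Const 0))) * b\<^sup>2 +
      ((expr_factor in_m + 2 * weight in_m) * b\<^sup>2 + prog_factor (Store (Const 0) (Const 1)) * b\<^sup>2)"
    by (intro add_mono cost_guard_le cost_Store_le start_less b_pos)
  moreover have "\<dots> \<le> prog_factor cvc_prog * b\<^sup>2"
    unfolding cvc_prog_def prog_factor.simps(5) distrib_right by linarith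
  ultimately show ?thesis by fastforce
qed

end

lemma (in cvc_input) exec_main:
  assumes "xs ! 0 = 0"
  shows "\<exists>t m' w'. exec cvc_prog (start, w) t (m', w') \<and>
    t \<le> (main_steps + 1) * prog_factor cvc_prog * b\<^sup>2 \<and> (m' 0 \<noteq> 0 \<longleftrightarrow> accepts w)"
proof -
  let ?g = "\<lambda>e. cost e start + bits (val e start)" and ?k = "prog_factor cvc_prog"
  let ?s = "Store (Const 0) (Reg rFound)"
  have v: "val (Load (Const 0)) start = 0" "val in_m start \<noteq> 0"
    using length_input assms m_pos layout_header by (simp_all add: layout_def)
  have "fits b (\<lambda>_ _. 0)" by (simp add: fits_def)
  with wp_main[of w] obtain \<sigma> w' t1 where 1: "exec main_prog (start, w) t1 (layout xs \<sigma>, w')"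
    "t1 \<le> main_steps * prog_factor main_prog * b\<^sup>2" "fits b \<sigma>" "\<sigma> rFound 0 \<noteq> 0 \<longleftrightarrow> accepts w"
    unfolding wp_def by blast
  let ?m = "layout xs \<sigma>"
  let ?t2 = "cost (Const 0) ?m + cost (Reg rFound) ?m + bits (val (Const 0) ?m) + bits (val (Reg rFound) ?m)"
  let ?m' = "?m(val (Const 0) ?m := val (Reg rFound) ?m)"
  from exec.Cond_False[OF v(1) exec.Cond_True[OF v(2) exec.Seq[OF 1(1) exec.Store]]]
  have "exec cvc_prog (start, w) (?g (Load (Const 0)) + (?g in_m + (t1 + ?t2))) (?m', w')"
    unfolding cvc_prog_def .
  moreover have "?g (Load (Const 0)) + (?g in_m + (t1 + ?t2)) \<le> (main_steps + 1) * ?k * b\<^sup>2"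
  proof -
    have "?g (Load (Const 0)) + (?g in_m + ?t2) \<le>
        (expr_factor (Load (Const 0)) + 2 * weight (Load (Const 0))) * b\<^sup>2 +
        ((expr_factor in_m + 2 * weight in_m) * b\<^sup>2 + prog_factor ?s * b\<^sup>2)"
      by (intro add_mono cost_guard_le cost_Store_le start_less b_pos layout_fits 1(3))
    also have "\<dots> \<le> ?k * b\<^sup>2"
      unfolding cvc_prog_def prog_factor.simps(4,5) distrib_right by linarith
    finally have "?g (Load (Const 0)) + (?g in_m + ?t2) \<le> ?k * b\<^sup>2" .
    moreover have "main_steps * prog_factor main_prog * b\<^sup>2 \<le> main_steps * ?k * b\<^sup>2"
      by (intro mult_le_mono1 mult_le_mono2) (simp add: cvc_prog_def)
    ultimately show ?thesis using 1(2) unfolding distrib_right mult_1 by linarith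
  qed
  moreover have "?m' 0 = \<sigma> rFound 0" by (simp add: val_Get)
  ultimately show ?thesis using 1(4) by metis
qed

section \<open>Encoded instances\<close>

lemma length_concat_pairs: "length (concat (map (\<lambda>(u, v). [u, v]) es)) = 2 * length es"
  by (induction es) auto

lemma nth_concat_pairs:
  assumes "e < length es"
  shows "concat (map (\<lambda>(u, v). [u, v]) es) ! (2 * e) = fst (es ! e)"
    "concat (map (\<lambda>(u, v). [u, v]) es) ! (2 * e + 1) = snd (es ! e)"
  using assms
proof (induction es arbitrary: e)
  case (Cons p es)
  {
    case 1
    then show ?case using Cons.IH(1)[of "e - 1"] by (cases e) (auto split: prod.splits)
  next
    case 2
    then show ?case using Cons.IH(2)[of "e - 1"] by (cases e) (auto split: prod.splits)
  }
qed simp_all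

locale encoded_instance =
  fixes V :: "nat set" and E :: "nat set set" and l :: "nat \<Rightarrow> nat" and k :: int
    and xs :: "nat list" and es :: "(nat \<times> nat) list"
  assumes graph: "simple_graph V E" and arrangement: "linear_arrangement V l"
    and distinct_edges: "distinct (map (\<lambda>(u, v). {u, v}) es)"
    and set_edges: "set (map (\<lambda>(u, v). {u, v}) es) = E"
    and xs_eq: "xs = [of_bool (k < 0), nat \<bar>k\<bar>, card V, card E] @ map l [1..<Suc (card V)] @
      concat (map (\<lambda>(u, v). [u, v]) es)"
begin

abbreviation "n \<equiv> card V"
abbreviation "m \<equiv> card E"
abbreviation "I \<equiv> incident xs n m"

definition edge :: "nat \<Rightarrow> nat set" where
  "edge e = {fst (es ! e), snd (es ! e)}"

lemma length_es: "length es = m"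
  using distinct_card[OF distinct_edges] set_edges by simp

lemma length_xs: "length xs = 4 + n + 2 * m"
  by (simp only: xs_eq length_append length_concat_pairs length_map length_upt length_es) simp

lemma header: "xs ! 0 = of_bool (k < 0)" "xs ! 1 = nat \<bar>k\<bar>" "xs ! 2 = n" "xs ! 3 = m"
  by (simp_all add: xs_eq)

lemma nth_vertex: "i \<in> {1..n} \<Longrightarrow> xs ! (3 + i) = l i"
  by (cases i) (auto simp: xs_eq nth_append nth_upt simp del: upt_Suc)

lemma nth_edge:
  assumes "e < m"
  shows "xs ! (4 + n + 2 * e) = fst (es ! e)" "xs ! (5 + n + 2 * e) = snd (es ! e)"
proof -
  let ?pre = "[of_bool (k < 0), nat \<bar>k\<bar>, card V, card E] @ map l [1..<Suc n]"
  have xs: "xs = ?pre @ concat (map (\<lambda>(u, v). [u, v]) es)" using xs_eq by simp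
  have len: "length ?pre = 4 + n" by simp
  have "xs ! (length ?pre + j) = concat (map (\<lambda>(u, v). [u, v]) es) ! j" for j
    by (subst xs) (rule nth_append_length_plus)
  from this[of "2 * e"] this[of "2 * e + 1"]
  show "xs ! (4 + n + 2 * e) = fst (es ! e)" "xs ! (5 + n + 2 * e) = snd (es ! e)"
    unfolding len using nth_concat_pairs[of e es] assms length_es by (simp_all add: ac_simps)
qed

lemma edge_nth: "e < m \<Longrightarrow> map (\<lambda>(u, v). {u, v}) es ! e = edge e"
  by (simp add: edge_def length_es case_prod_beta)

lemma edge_in: "e < m \<Longrightarrow> edge e \<in> E"
  using edge_nth[of e] set_edges length_es by (metis length_map nth_mem)

lemma edge_inj: "e < m \<Longrightarrow> e' < m \<Longrightarrow> edge e = edge e' \<Longrightarrow> e = e'"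
  using edge_nth[of e] edge_nth[of e'] distinct_edges length_es by (metis length_map nth_eq_iff_index_eq)

lemma edge_surj: "d \<in> E \<Longrightarrow> \<exists>e<m. d = edge e"
proof -
  assume "d \<in> E"
  then have "d \<in> set (map (\<lambda>(u, v). {u, v}) es)" by (simp only: set_edges)
  then obtain e where "e < length es" "map (\<lambda>(u, v). {u, v}) es ! e = d"
    unfolding in_set_conv_nth length_map by blast
  then show ?thesis using edge_nth length_es by auto
qed

lemma edge_ends:
  assumes "e < m"
  shows "fst (es ! e) \<noteq> snd (es ! e)" "edge e \<subseteq> V"
proof -
  obtain u v where "u \<in> V" "v \<in> V" "u \<noteq> v" "edge e = {u, v}"
    using graph edge_in[OF assms] unfolding simple_graph_def by blast
  then show "fst (es ! e) \<noteq> snd (es ! e)" "edge e \<subseteq> V"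
    by (auto simp: edge_def doubleton_eq_iff)
qed

lemma bij: "bij_betw l {1..n} V"
  using arrangement by (simp add: linear_arrangement_def)

lemma l_inj: "i \<in> {1..n} \<Longrightarrow> j \<in> {1..n} \<Longrightarrow> l i = l j \<Longrightarrow> i = j"
  using bij unfolding bij_betw_def inj_on_def by blast

lemma l_image: "l ` {1..n} = V"
  using bij unfolding bij_betw_def by blast

lemma incident_iff: "i \<in> {1..n} \<Longrightarrow> e \<in> I i \<longleftrightarrow> e < m \<and> l i \<in> edge e"
  unfolding incident_def mem_Collect_eq edge_def using nth_vertex[of i] nth_edge[of e] by metis

lemma edge_positions:
  assumes "e < m"
  obtains p q where "p \<in> {1..n}" "q \<in> {1..n}" "p \<noteq> q" "edge e = {l p, l q}"
proof -
  have "fst (es ! e) \<in> l ` {1..n}" "snd (es ! e) \<in> l ` {1..n}"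
    unfolding l_image using edge_ends(2)[OF assms] by (simp_all add: edge_def)
  then obtain p q where "p \<in> {1..n}" "q \<in> {1..n}" "fst (es ! e) = l p" "snd (es ! e) = l q"
    by blast
  moreover from this edge_ends(1)[OF assms] have "p \<noteq> q" by auto
  ultimately show ?thesis using that by (simp add: edge_def)
qed

lemma seen_count_eq:
  assumes "p \<in> {1..n}" "q \<in> {1..n}" "p \<noteq> q" "edge e = {l p, l q}" "e < m" "i \<le> n"
  shows "seen_count I i e = of_bool (p \<le> i) + of_bool (q \<le> i)"
proof -
  have "v \<in> {1..i} \<and> e \<in> I v \<longleftrightarrow> v \<le> i \<and> v \<in> {p, q}" for v
  proof (cases "v \<in> {1..n}")
    case True
    then have "e \<in> I v \<longleftrightarrow> v = p \<or> v = q"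
      using incident_iff[OF True, of e] assms l_inj[OF True] by auto
    with True show ?thesis by auto
  qed (use assms in auto)
  then have "{v \<in> {1..i}. e \<in> I v} = {v \<in> {p, q}. v \<le> i}" by blast
  also have "\<dots> = (if p \<le> i then {p} else {}) \<union> (if q \<le> i then {q} else {})" by auto
  finally show ?thesis using assms(3) by (simp add: seen_count_def)
qed

lemma seen_count_n: "e < m \<Longrightarrow> seen_count I n e = 2"
  by (rule edge_positions[of e]) (auto simp: seen_count_eq)

text \<open>An edge seen once has one end at a position up to \<open>i\<close> and the other beyond,
  so it crosses the cut. Since each edge is listed only once, no crossing edge is counted
  twice.\<close>

lemma card_active_le:
  assumes "i \<le> n"
  shows "card {e. e < m \<and> seen_count I i e = 1} \<le> cutwidth V E l"
proof -
  have "edge e \<in> cut V E l i" if e: "e < m" "seen_count I i e = 1" for e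
  proof -
    obtain p q where pq: "p \<in> {1..n}" "q \<in> {1..n}" "p \<noteq> q" "edge e = {l p, l q}"
      by (rule edge_positions[OF e(1)])
    have "p \<le> i \<and> i < q \<or> q \<le> i \<and> i < p"
      using seen_count_eq[OF pq e(1) assms] e(2) by (cases "p \<le> i"; cases "q \<le> i") auto
    then show ?thesis
    proof
      assume "p \<le> i \<and> i < q"
      then show ?thesis using pq edge_in[OF e(1)] unfolding cut_def by blast
    next
      assume "q \<le> i \<and> i < p"
      moreover have "edge e = {l q, l p}" using pq(4) by blast
      ultimately show ?thesis using pq edge_in[OF e(1)] unfolding cut_def by blast
    qed
  qed
  moreover have "finite (cut V E l i)" using set_edges finite_subset[of _ E] by (auto simp: cut_def)
  moreover have "inj_on edge {e. e < m \<and> seen_count I i e = 1}" using edge_inj by (auto intro: inj_onI)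
  ultimately have "card {e. e < m \<and> seen_count I i e = 1} \<le> card (cut V E l i)"
    by (intro card_inj_on_le[of edge]) auto
  also have "\<dots> \<le> cutwidth V E l" unfolding cutwidth_def using assms by (intro Max_ge) auto
  finally show ?thesis .
qed

text \<open>Distinct vertices share an edge exactly if they are adjacent. A vertex also shares its
  edges with itself, but such loops disappear in the reflexive closure.\<close>

lemma linked_iff:
  assumes S: "S \<subseteq> {1..n}"
  shows "linked I S \<longleftrightarrow> induced_connected E (l ` S)"
proof -
  define R where "R = {(x, y). x \<in> S \<and> y \<in> S \<and> I x \<inter> I y \<noteq> {}}"
  define R' where "R' = {(a, b). a \<in> l ` S \<and> b \<in> l ` S \<and> {a, b} \<in> E}"
  have R: "(x, y) \<in> R \<longleftrightarrow> x \<in> S \<and> y \<in> S \<and> I x \<inter> I y \<noteq> {}" for x y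
    by (simp add: R_def)
  have R': "(a, b) \<in> R' \<longleftrightarrow> a \<in> l ` S \<and> b \<in> l ` S \<and> {a, b} \<in> E" for a b
    by (simp add: R'_def)
  have edge_step: "(l x, l y) \<in> R'\<^sup>*" if xy: "(x, y) \<in> R" for x y
  proof (cases "x = y")
    case False
    obtain e where e: "e \<in> I x" "e \<in> I y" and in_S: "x \<in> S" "y \<in> S" using xy unfolding R by blast
    then have X: "x \<in> {1..n}" "y \<in> {1..n}" using S by auto
    have "e < m" "l x \<in> edge e" "l y \<in> edge e"
      using e incident_iff[OF X(1), of e] incident_iff[OF X(2), of e] by blast+
    moreover have "l x \<noteq> l y" using l_inj[OF X] False by blast
    ultimately have "{l x, l y} = edge e" unfolding edge_def by auto
    then have "{l x, l y} \<in> E" using edge_in[OF \<open>e < m\<close>] by simp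
    then have "(l x, l y) \<in> R'" unfolding R' using in_S by blast
    then show ?thesis by (rule r_into_rtrancl)
  qed simp
  have forward: "(l x, l y) \<in> R'\<^sup>*" if "(x, y) \<in> R\<^sup>*" for x y
    using that
  proof (induction rule: rtrancl_induct)
    case (step y z)
    from step.IH edge_step[OF step.hyps(2)] show ?case by (rule rtrancl_trans)
  qed simp
  have backward: "\<exists>y\<in>S. b = l y \<and> (x, y) \<in> R\<^sup>*" if "(l x, b) \<in> R'\<^sup>*" "x \<in> S" for x b
    using that
  proof (induction rule: rtrancl_induct)
    case (step b c)
    then obtain y where y: "y \<in> S" "b = l y" "(x, y) \<in> R\<^sup>*" by blast
    from step.hyps(2) obtain z where z: "z \<in> S" "c = l z" and "{b, c} \<in> E" unfolding R' by blast
    then obtain e where e: "e < m" "{l y, l z} = edge e" using edge_surj[of "{b, c}"] y(2) by blast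
    have "y \<in> {1..n}" "z \<in> {1..n}" using y z S by auto
    then have "e \<in> I y" "e \<in> I z" using incident_iff[of y e] incident_iff[of z e] e by auto
    then have "(y, z) \<in> R" unfolding R using y z by blast
    with y(3) have "(x, z) \<in> R\<^sup>*" by (rule rtrancl_into_rtrancl)
    with z show ?case by blast
  qed blast
  have "linked I S \<longleftrightarrow> (\<forall>u\<in>S. \<forall>v\<in>S. (u, v) \<in> R\<^sup>*)" by (simp only: linked_def R_def)
  also have "\<dots> \<longleftrightarrow> (\<forall>u\<in>S. \<forall>v\<in>S. (l u, l v) \<in> R'\<^sup>*)"
  proof (intro iffI ballI)
    fix u v assume uv: "u \<in> S" "v \<in> S" and "\<forall>u\<in>S. \<forall>v\<in>S. (l u, l v) \<in> R'\<^sup>*"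
    then have "(l u, l v) \<in> R'\<^sup>*" by blast
    from backward[OF this uv(1)] obtain y where y: "y \<in> S" "l v = l y" "(u, y) \<in> R\<^sup>*" by blast
    moreover have "y = v" using l_inj[of v y] uv y S by blast
    ultimately show "(u, v) \<in> R\<^sup>*" by simp
  qed (use forward in blast)
  also have "\<dots> \<longleftrightarrow> induced_connected E (l ` S)"
    by (simp add: induced_connected_def R'_def)
  finally show ?thesis .
qed

lemma covers_iff:
  assumes S: "S \<subseteq> {1..n}"
  shows "{..<m} \<subseteq> \<Union> (I ` S) \<longleftrightarrow> vertex_cover V E (l ` S)"
proof -
  have "e \<in> \<Union> (I ` S) \<longleftrightarrow> edge e \<inter> l ` S \<noteq> {}" if "e < m" for e
    using that S incident_iff[of _ e] by blast
  then have "{..<m} \<subseteq> \<Union> (I ` S) \<longleftrightarrow> (\<forall>e<m. edge e \<inter> l ` S \<noteq> {})" by blast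
  also have "\<dots> \<longleftrightarrow> (\<forall>d\<in>E. d \<inter> l ` S \<noteq> {})" using edge_in edge_surj by metis
  also have "\<dots> \<longleftrightarrow> vertex_cover V E (l ` S)"
    using image_mono[OF S, of l] unfolding l_image vertex_cover_def by blast
  finally show ?thesis .
qed

lemma connected_vertex_cover_iff:
  "connected_vertex_cover V E k \<longleftrightarrow>
     (\<exists>S. S \<subseteq> {1..n} \<and> solution I {..<m} S \<and> int (card S) \<le> k)"
proof -
  have card: "card (l ` S) = card S" if "S \<subseteq> {1..n}" for S
    using inj_on_subset[OF bij_betw_imp_inj_on[OF bij] that] by (rule card_image)
  have sol: "solution I {..<m} S \<longleftrightarrow> vertex_cover V E (l ` S) \<and> induced_connected E (l ` S)"
    if "S \<subseteq> {1..n}" for S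
    using linked_iff[OF that] covers_iff[OF that] by (auto simp: solution_def)
  show ?thesis
  proof
    assume "connected_vertex_cover V E k"
    then obtain T where T: "vertex_cover V E T" "int (card T) \<le> k" "induced_connected E T"
      unfolding connected_vertex_cover_def by blast
    then have "T \<subseteq> l ` {1..n}" unfolding l_image by (simp add: vertex_cover_def)
    then obtain S where S: "S \<subseteq> {1..n}" "T = l ` S" by (auto simp: subset_image_iff)
    show "\<exists>S. S \<subseteq> {1..n} \<and> solution I {..<m} S \<and> int (card S) \<le> k"
      using T S card[OF S(1)] sol[OF S(1)] by (intro exI[of _ S]) simp
  next
    assume "\<exists>S. S \<subseteq> {1..n} \<and> solution I {..<m} S \<and> int (card S) \<le> k"
    then obtain S where S: "S \<subseteq> {1..n}" "solution I {..<m} S" "int (card S) \<le> k" by blast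
    show "connected_vertex_cover V E k"
      unfolding connected_vertex_cover_def
      using S card[OF S(1)] sol[OF S(1)] by (intro exI[of _ "l ` S"]) simp
  qed
qed

section \<open>Polynomial bounds for the word length and the running time\<close>

lemma length_le_size: "length xs \<le> input_size xs"
  unfolding input_size_def by (induction xs) (auto simp: bits_def)

lemma less_power_size:
  assumes "x \<in> set xs" shows "x < 2 ^ input_size xs"
proof -
  have "bits x \<le> input_size xs"
    unfolding input_size_def using assms by (intro member_le_sum_list) auto
  then have "floorlog 2 x \<le> input_size xs" by (simp add: bits_def)
  then show ?thesis by (rule floorlog_leD) simp
qed

text \<open>Degree 4 arises from a base with linear exponent, a quadratic largest weight and
  \<open>n + 1\<close> factors. The estimate made for \<open>b_large\<close> gives 85 in place of
  100.\<close>

definition word_bits :: nat where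
  "word_bits = 100 * input_size xs ^ 4"

lemma size_bounds: "n \<le> input_size xs" "m \<le> input_size xs" "1 \<le> input_size xs"
  using length_le_size length_xs by linarith+

lemma size_le_power: "0 < j \<Longrightarrow> input_size xs \<le> input_size xs ^ j"
  using size_bounds(3) by (cases j) auto

lemma hash_size: "n * 2 ^ hash_bits n + 2 ^ hash_bits n \<le> 10 * input_size xs ^ 2"
proof -
  let ?N = "input_size xs"
  have "(n + 1) * 2 ^ hash_bits n \<le> (2 * ?N) * (5 * ?N)"
    using power_hash_bits_le[of n] size_bounds by (intro mult_le_mono) linarith+
  then show ?thesis by (simp add: power2_eq_square algebra_simps)
qed

sublocale machine_input xs n m word_bits
proof
  fix x assume "x \<in> set xs"
  then have "x < 2 ^ input_size xs" by (rule less_power_size)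
  also have "\<dots> \<le> 2 ^ word_bits"
    using size_le_power[of 4] by (intro power_increasing) (auto simp: word_bits_def)
  finally show "x < 2 ^ word_bits" .
qed (use length_xs header size_bounds(3) in \<open>auto simp: word_bits_def\<close>)

lemma cvc_input:
  assumes "0 < m" "0 \<le> k"
  shows "cvc_input xs n m word_bits (nat k) (cutwidth V E l)"
proof
  let ?N = "input_size xs" and ?w = "n * 2 ^ hash_bits n + 2 ^ hash_bits n"
  show "xs ! 1 = nat k" using header(2) assms(2) by simp
  show "xs ! (4 + n + 2 * e) \<noteq> xs ! (5 + n + 2 * e)" if "e < m" for e
    using edge_ends(1)[OF that] nth_edge[OF that] by simp
  have "(m + 2 * n + 1) * ?w + 2 \<le> (4 * ?N) * (10 * ?N ^ 2) + 2 * ?N ^ 3"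
    using size_bounds hash_size by (intro add_mono mult_le_mono) (linarith, linarith, simp)
  also have "\<dots> = 42 * ?N ^ 3" by (simp add: power2_eq_square power3_eq_cube)
  finally have "(n + 1) * ((m + 2 * n + 1) * ?w + 2) \<le> (2 * ?N) * (42 * ?N ^ 3)"
    using size_bounds by (intro mult_le_mono) linarith+
  also have "\<dots> = 84 * ?N ^ 4" by (simp add: power3_eq_cube power4_eq_xxxx)
  finally have "m + (n + 1) * ((m + 2 * n + 1) * ?w + 2) \<le> 85 * ?N ^ 4"
    using size_bounds(2) size_le_power[of 4] by linarith
  also have "\<dots> < word_bits" using size_bounds(3) by (simp add: word_bits_def)
  finally show "m + (n + 1) * ((m + 2 * n + 1) * ?w + 2) < word_bits" .
qed (use assms seen_count_n card_active_le in auto)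

text \<open>The cubic factor is due to computing the powers and reading the digits; the exponential
  part comes with a quadratic factor only.\<close>

lemma main_steps_le:
  assumes "0 < m" "0 \<le> k"
  shows "cvc_input.main_steps n m (cutwidth V E l) + 1 \<le> 300 * input_size xs ^ 3 * 2 ^ cutwidth V E l"
proof -
  interpret C: cvc_input xs n m word_bits "nat k" "cutwidth V E l" by (rule cvc_input[OF assms])
  let ?N = "input_size xs" and ?c = "(2::nat) ^ cutwidth V E l"
  have N: "?N \<le> ?N ^ 3" "?N ^ 2 \<le> ?N ^ 3" "1 \<le> ?N ^ 3"
    using size_bounds(3) by (auto intro: size_le_power power_increasing)
  have w: "C.max_weight \<le> 10 * ?N ^ 2" using hash_size by (simp add: C.max_weight_def)
  have "5 * n + 3 * C.base_bits + 6 \<le> 23 * ?N"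
    using size_bounds by (simp add: C.base_bits_def)
  then have 1: "5 * n + 3 * C.base_bits + 6 \<le> 23 * ?N ^ 3" using N by linarith
  have "?N * (4 * ?N + 30 * ?N ^ 2 + 7) = 4 * ?N ^ 2 + 30 * ?N ^ 3 + 7 * ?N"
    by (simp add: power2_eq_square power3_eq_cube algebra_simps)
  moreover have "n * (4 * hash_bits n + 3 * C.max_weight + 7) \<le> ?N * (4 * ?N + 30 * ?N ^ 2 + 7)"
    using w size_bounds hash_bits_le[of n] by (intro mult_le_mono) linarith+
  ultimately have 2: "n * (4 * hash_bits n + 3 * C.max_weight + 7) + 2 \<le> 43 * ?N ^ 3"
    using N by linarith
  have "(n + 1) * (?c * (20 * m + 40)) \<le> (2 * ?N) * (?c * (60 * ?N))"
    using size_bounds by (intro mult_le_mono) linarith+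
  also have "\<dots> = 120 * ?N ^ 2 * ?c" by (simp add: power2_eq_square)
  also have "\<dots> \<le> 120 * ?N ^ 3 * ?c" using N by simp
  finally have 3: "(n + 1) * (?c * (20 * m + 40)) + 3 \<le> 120 * ?N ^ 3 * ?c + 3 * ?N ^ 3"
    using N by linarith
  have "n * 2 ^ hash_bits n * (n + 1) * 4 \<le> (10 * ?N ^ 2) * (2 * ?N) * 4"
    by (rule mult_le_mono1, rule mult_le_mono) (use hash_size size_bounds in linarith)+
  also have "\<dots> = 80 * ?N ^ 3" by (simp add: power2_eq_square power3_eq_cube)
  finally have 4: "n * 2 ^ hash_bits n * (n + 1) * 4 + 3 \<le> 83 * ?N ^ 3" using N by linarith
  have "C.main_steps + 1 \<le> 153 * ?N ^ 3 + 120 * ?N ^ 3 * ?c"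
    unfolding C.main_steps_def using 1 2 3 4 N by linarith
  also have "\<dots> \<le> 153 * ?N ^ 3 * ?c + 120 * ?N ^ 3 * ?c" by simp
  also have "\<dots> = 273 * ?N ^ 3 * ?c" by (simp add: algebra_simps)
  also have "\<dots> \<le> 300 * ?N ^ 3 * ?c" by simp
  finally show ?thesis .
qed

text \<open>Degree 11 is 3 for the number of steps plus 8 for the square of
  \<open>word_bits\<close>, and the coefficient is 300 times the square of 100.\<close>

definition time_bound :: nat where
  "time_bound = poly (monom (3000000 * prog_factor cvc_prog) 11) (input_size xs) * 2 ^ cutwidth V E l"

lemma time_bound_eq:
  "300 * input_size xs ^ 3 * 2 ^ cutwidth V E l * prog_factor cvc_prog * word_bits\<^sup>2 = time_bound"
proof -
  have "input_size xs ^ 11 = input_size xs ^ 3 * (input_size xs ^ 4)\<^sup>2"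
    by (simp only: power_mult[symmetric] power_add[symmetric]) simp
  then show ?thesis by (simp add: time_bound_def poly_monom word_bits_def power_mult_distrib)
qed

lemma single_step_le: "t \<le> prog_factor cvc_prog * word_bits\<^sup>2 \<Longrightarrow> t \<le> time_bound"
proof -
  assume t: "t \<le> prog_factor cvc_prog * word_bits\<^sup>2"
  have "1 * (prog_factor cvc_prog * word_bits\<^sup>2) \<le>
      300 * input_size xs ^ 3 * 2 ^ cutwidth V E l * (prog_factor cvc_prog * word_bits\<^sup>2)"
    using size_bounds(3) by (intro mult_le_mono1) (simp add: Suc_leI)
  then show ?thesis using t unfolding time_bound_eq[symmetric] mult.assoc by linarith
qed

text \<open>A single predicate \<open>F\<close> on the flips unifies three kinds of instances: it is
  constantly false for negative \<open>k\<close>, constantly true without edges, and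
  \<open>accepts\<close> otherwise.\<close>

lemma run:
  obtains F where
    "\<And>w. \<exists>t m' w'. exec cvc_prog (initial_mem xs, w) t (m', w') \<and> t \<le> time_bound \<and> (m' 0 \<noteq> 0 \<longleftrightarrow> F w)"
    "\<And>w. F w \<Longrightarrow> connected_vertex_cover V E k"
    "connected_vertex_cover V E k \<Longrightarrow>
      {w. \<not> F w} \<in> sets coin_flips \<and> measure coin_flips {w. \<not> F w} \<le> 1 / 2"
proof -
  consider "k < 0" | "0 \<le> k" "m = 0" | "0 \<le> k" "0 < m" by linarith
  then show ?thesis
  proof cases
    case 1
    then have neg: "xs ! 0 \<noteq> 0" using header by simp
    have "\<not> connected_vertex_cover V E k" using 1 by (auto simp: connected_vertex_cover_def)
    moreover have "\<exists>t m' w'. exec cvc_prog (initial_mem xs, w) t (m', w') \<and> t \<le> time_bound \<and>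
        (m' 0 \<noteq> 0 \<longleftrightarrow> False)" for w
      using exec_negative[OF neg, of w] single_step_le unfolding initial_mem_eq_layout by blast
    ultimately show ?thesis by (intro that[of "\<lambda>_. False"]) blast+
  next
    case 2
    then have flag: "xs ! 0 = 0" using header by simp
    have "solution I {..<m} {}" using 2(2) by (simp add: solution_def linked_def)
    then have yes: "connected_vertex_cover V E k"
      unfolding connected_vertex_cover_iff using 2(1) by (intro exI[of _ "{}"]) simp
    have "\<exists>t m' w'. exec cvc_prog (initial_mem xs, w) t (m', w') \<and> t \<le> time_bound \<and>
        (m' 0 \<noteq> 0 \<longleftrightarrow> True)" for w
      using exec_no_edges[OF flag 2(2), of w] single_step_le unfolding initial_mem_eq_layout by blast
    then show ?thesis by (intro that[of "\<lambda>_. True"]) (use yes in auto)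
  next
    case 3
    interpret C: cvc_input xs n m word_bits "nat k" "cutwidth V E l" by (rule cvc_input[OF 3(2,1)])
    have flag: "xs ! 0 = 0" using 3 header by simp
    have yes_iff: "connected_vertex_cover V E k \<longleftrightarrow> (\<exists>S\<in>C.solutions. card S \<le> nat k)"
      unfolding connected_vertex_cover_iff C.solutions_def using 3(1) by (auto simp: le_nat_iff)
    have "\<exists>t m' w'. exec cvc_prog (initial_mem xs, w) t (m', w') \<and> t \<le> time_bound \<and>
        (m' 0 \<noteq> 0 \<longleftrightarrow> C.accepts w)" for w
    proof -
      obtain t m' w' where r: "exec cvc_prog (start, w) t (m', w')"
        "t \<le> (C.main_steps + 1) * prog_factor cvc_prog * word_bits\<^sup>2" "m' 0 \<noteq> 0 \<longleftrightarrow> C.accepts w"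
        using C.exec_main[OF flag, of w] by blast
      have "(C.main_steps + 1) * prog_factor cvc_prog * word_bits\<^sup>2 \<le> time_bound"
        unfolding time_bound_eq[symmetric]
        by (intro mult_le_mono1 main_steps_le[OF 3(2,1)])
      with r show ?thesis unfolding initial_mem_eq_layout by (meson le_trans)
    qed
    moreover have "connected_vertex_cover V E k" if "C.accepts w" for w
      using C.accepts_sound[OF that] yes_iff by blast
    moreover have "{w. \<not> C.accepts w} \<in> sets coin_flips \<and> measure coin_flips {w. \<not> C.accepts w} \<le> 1 / 2"
      if "connected_vertex_cover V E k"
      using that C.not_accepts_prob unfolding yes_iff by blast
    ultimately show ?thesis by (rule that)
  qed
qed

lemma solves:
  "(\<forall>w. \<exists>t b. answers cvc_prog xs w t b \<and> t \<le> time_bound) \<and>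
   (\<not> connected_vertex_cover V E k \<longrightarrow> (\<forall>w t. \<not> answers cvc_prog xs w t True)) \<and>
   (connected_vertex_cover V E k \<longrightarrow>
      {w. \<exists>t. answers cvc_prog xs w t False} \<in> sets coin_flips \<and>
      measure coin_flips {w. \<exists>t. answers cvc_prog xs w t False} \<le> 1 / 2)"
proof -
  obtain F where F: "\<And>w. \<exists>t m' w'. exec cvc_prog (initial_mem xs, w) t (m', w') \<and> t \<le> time_bound \<and>
      (m' 0 \<noteq> 0 \<longleftrightarrow> F w)"
    and sound: "\<And>w. F w \<Longrightarrow> connected_vertex_cover V E k"
    and prob: "connected_vertex_cover V E k \<Longrightarrow>
      {w. \<not> F w} \<in> sets coin_flips \<and> measure coin_flips {w. \<not> F w} \<le> 1 / 2"
    by (rule run) blast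
  \<comment> \<open>The existence of one run with outcome \<open>F w\<close> does not exclude
    others; determinism does, and so the event of a negative answer is exactly the failure of
    \<open>F\<close>.\<close>
  have answer: "(\<exists>t. answers cvc_prog xs w t b) \<longleftrightarrow> b = F w" for w b
  proof -
    obtain t m' w' where r: "exec cvc_prog (initial_mem xs, w) t (m', w')" "m' 0 \<noteq> 0 \<longleftrightarrow> F w"
      using F[of w] by blast
    have "m2 = m'" if "exec cvc_prog (initial_mem xs, w) t2 (m2, w2)" for t2 m2 w2
      using exec_deterministic[OF r(1) that] by simp
    with r show ?thesis unfolding answers_def by blast
  qed
  have "\<exists>t b. answers cvc_prog xs w t b \<and> t \<le> time_bound" for w
    using F[of w] unfolding answers_def by blast
  moreover have "{w. \<exists>t. answers cvc_prog xs w t False} = {w. \<not> F w}" using answer by auto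
  moreover have "\<not> answers cvc_prog xs w t True" if "\<not> connected_vertex_cover V E k" for w t
    using answer[of w True] sound[of w] that by blast
  ultimately show ?thesis using prob by simp
qed

end

theorem theorem12:
  "\<exists>(c :: prog) (p :: nat poly).
     \<forall>(V :: nat set) (E :: nat set set) (l :: nat \<Rightarrow> nat) (k :: int) (xs :: nat list).
       simple_graph V E \<and> linear_arrangement V l \<and> encodes V E l k xs \<longrightarrow>
         (\<forall>w. \<exists>t b. answers c xs w t b \<and> t \<le> poly p (input_size xs) * 2 ^ cutwidth V E l) \<and>
         (\<not> connected_vertex_cover V E k \<longrightarrow> (\<forall>w t. \<not> answers c xs w t True)) \<and>
         (connected_vertex_cover V E k \<longrightarrow>
            {w. \<exists>t. answers c xs w t False} \<in> sets coin_flips \<and>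
            measure coin_flips {w. \<exists>t. answers c xs w t False} \<le> 1 / 2)"
proof (intro exI allI impI)
  fix V :: "nat set" and E :: "nat set set" and l :: "nat \<Rightarrow> nat" and k :: int and xs :: "nat list"
  assume "simple_graph V E \<and> linear_arrangement V l \<and> encodes V E l k xs"
  then obtain es where "encoded_instance V E l k xs es"
    unfolding encodes_def encoded_instance_def by blast
  then interpret encoded_instance V E l k xs es .
  show "(\<forall>w. \<exists>t b. answers cvc_prog xs w t b \<and>
        t \<le> poly (monom (3000000 * prog_factor cvc_prog) 11) (input_size xs) * 2 ^ cutwidth V E l) \<and>
      (\<not> connected_vertex_cover V E k \<longrightarrow> (\<forall>w t. \<not> answers cvc_prog xs w t True)) \<and>
      (connected_vertex_cover V E k \<longrightarrow>
        {w. \<exists>t. answers cvc_prog xs w t False} \<in> sets coin_flips \<and>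
        measure coin_flips {w. \<exists>t. answers cvc_prog xs w t False} \<le> 1 / 2)"
    using solves unfolding time_bound_def .
qed

end
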